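(* Let $M$ be a complex manifold of real dimension $2m$, let $N=\mathbf{R}\times M$, and let ${}^{k}N$ be the $k$-th order extension of $N$. Let $\omega$ be a 1-form on $N$ locally expressed by $\omega=dt+\omega_{0i}dz^{0i}+\overline{\omega}_{0i}d\overline{z}^{0i}$ with $\omega_{0i},\overline{\omega}_{0i}\in\mathcal{F}(M)$. Then the $k$-th order vertical lift of $\omega$ to ${}^{k}N$ is given by $$\omega^{v^{k}}=dt+(\omega_{0i})^{v^{k}}dz^{0i}+(\overline{\omega}_{0i})^{v^{k}}d\overline{z}^{0i}.$$
   Context: All objects are of class $C^\infty$; sums are taken over repeated indices, with $1\le i\le m$. Extensions. $M={}^{0}M$ is a complex manifold of real dimension $2m$ with local complex coordinates $z^{0i}$. ${}^{k}M$ is its $k$-th order extended complex manifold, arising from a sequence ${}^{0}M\leftarrow{}^{1}M\leftarrow{}^{2}M\leftarrow\cdots$ in which ${}^{1}M=TM$ and each ${}^{k}M$ is imbedded in the tangent bundle $T({}^{k-1}M)$ compatibly with the projections. It has local coordinates $(z^{ri},\overline{z}^{ri})$, $0\le r\le k$, $1\le i\le m$, where $\dot z^{ri}=z^{r+1,i}$ and $\dot{\overline z}^{ri}=\overline{z}^{r+1,i}$ for $0\le r\le k-1$ are the velocity coordinates coming from $T({}^{k-1}M)$. The $k$-th order extension of the product manifold $N={}^{0}N=\mathbf{R}\times M$ is ${}^{k}N=\mathbf{R}\times{}^{k}M$, with local coordinates $(t,z^{ri},\overline{z}^{ri})$, $0\le r\le k$, and natural projection $\tau_{{}^{k-1}N}:{}^{k}N\to{}^{k-1}N$.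 $\mathcal{F}(M)$ is the set of (smooth) functions on $M$, regarded also as functions on $N$. Lifts of functions. For a function $\tilde f$ on ${}^{k-1}N$, its vertical lift to ${}^{k}N$ is $\tilde f^{v}=\tilde f\circ\tau_{{}^{k-1}N}$, and its complete lift to ${}^{k}N$ is $$\tilde f^{c}=t\Big(\frac{\partial\tilde f}{\partial t}\Big)^{v}+\dot z^{ri}\Big(\frac{\partial\tilde f}{\partial z^{ri}}\Big)^{v}+\dot{\overline z}^{ri}\Big(\frac{\partial\tilde f}{\partial\overline z^{ri}}\Big)^{v}\qquad(0\le r\le k-1).$$ For $f$ on $N$, $f^{v^{k}}$ and $f^{c^{k}}$ denote the functions on ${}^{k}N$ obtained by applying the vertical, respectively complete, lift $k$ times. Lifts of vector fields and 1-forms. Vector fields on $N$ are taken of the form $Z=\frac{\partial}{\partial t}+Z^{0i}\frac{\partial}{\partial z^{0i}}+\overline{Z}^{0i}\frac{\partial}{\partial\overline{z}^{0i}}$ with $Z^{0i},\overline{Z}^{0i}\in\mathcal{F}(M)$. The complete lift of order $k$ of $Z$ is the vector field $Z^{c^{k}}$ on ${}^{k}N$ given by $Z^{c^{k}}(f^{c^{k}})=(Zf)^{c^{k}}$ for every function $f$ on $N$. The vertical lift of order $k$ of a 1-form $\omega$ on $N$ is the 1-form $\omega^{v^{k}}$ on ${}^{k}N$ determined by $\omega^{v^{k}}(Z^{c^{k}})=(\omega Z)^{v^{k}}$ for every vector field $Z$ on $N$, where $\omega Z=\omega(Z)$.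
   Formalization: The complete lift of Z is required to satisfy Z^{c^k}(f^{c^k})=(Zf)^{c^k} only for f in F(M), with its ∂/∂t component taken to be 1, because with time-dependent f (f=t and f=t²) the stated formula for f^c makes the condition inconsistent for k≥1. *)

theory Defs
  imports "HOL-Analysis.Analysis"
begin

section \<open>Functions of real time and of jet coordinates\<close>

text \<open>
  A pair \<open>(t, x)\<close> stands for the coordinates \<open>t\<close> and \<open>z\<^sup>r\<^sup>i = x r $ i\<close>. The orders \<open>r\<close> range over all
  natural numbers so that one type serves every order of extension; at order \<open>k\<close> only \<open>r \<le> k\<close>
  is used.
\<close>

type_synonym 'm coords = "real \<times> (nat \<Rightarrow> complex ^ 'm)"

definition d_time :: "('m::finite coords \<Rightarrow> complex) \<Rightarrow> 'm coords \<Rightarrow> complex" where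
  "d_time F = (\<lambda>(t, x). vector_derivative (\<lambda>s. F (s, x)) (at t))"

text \<open>The line through a point along which only \<open>z\<^sup>r\<^sup>i\<close> moves, with complex velocity \<open>h\<close>.\<close>

definition coord_line :: "nat \<Rightarrow> 'm::finite \<Rightarrow> complex \<Rightarrow> 'm coords \<Rightarrow> real \<Rightarrow> 'm coords" where
  "coord_line r i h = (\<lambda>(t, x) s. (t, x(r := x r + axis i (complex_of_real s * h))))"

definition d_dir :: "nat \<Rightarrow> 'm::finite \<Rightarrow> complex \<Rightarrow> ('m coords \<Rightarrow> complex) \<Rightarrow> 'm coords \<Rightarrow> complex" where
  "d_dir r i h F = (\<lambda>p. vector_derivative (\<lambda>s. F (coord_line r i h p s)) (at 0))"

text \<open>The operators \<open>\<partial>/\<partial>z\<^sup>r\<^sup>i\<close> and \<open>\<partial>/\<partial>zbar\<^sup>r\<^sup>i\<close>.\<close>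

definition d_z :: "nat \<Rightarrow> 'm::finite \<Rightarrow> ('m coords \<Rightarrow> complex) \<Rightarrow> 'm coords \<Rightarrow> complex" where
  "d_z r i F = (\<lambda>p. (d_dir r i 1 F p - \<i> * d_dir r i \<i> F p) / 2)"

definition d_zbar :: "nat \<Rightarrow> 'm::finite \<Rightarrow> ('m coords \<Rightarrow> complex) \<Rightarrow> 'm coords \<Rightarrow> complex" where
  "d_zbar r i F = (\<lambda>p. (d_dir r i 1 F p + \<i> * d_dir r i \<i> F p) / 2)"

text \<open>
  \<open>C n k F S\<close>: all partial derivatives of \<open>F\<close> up to total order \<open>n\<close>, with respect to \<open>t\<close> and the real and
  imaginary parts of the \<open>z\<^sup>r\<^sup>i\<close> with \<open>r \<le> k\<close>, exist and are continuous on the (open) set \<open>S\<close>.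
\<close>

primrec C_on :: "nat \<Rightarrow> nat \<Rightarrow> ('m::finite coords \<Rightarrow> complex) \<Rightarrow> 'm coords set \<Rightarrow> bool" where
  "C_on 0 k F S \<longleftrightarrow> continuous_on S F"
| "C_on (Suc n) k F S \<longleftrightarrow>
     continuous_on S F \<and>
     (\<forall>(t, x)\<in>S. (\<lambda>s. F (s, x)) differentiable (at t)) \<and>
     (\<forall>p\<in>S. \<forall>r\<le>k. \<forall>i. \<forall>h\<in>{1, \<i>}. (\<lambda>s. F (coord_line r i h p s)) differentiable (at 0)) \<and>
     C_on n k (d_time F) S \<and>
     (\<forall>r\<le>k. \<forall>i. \<forall>h\<in>{1, \<i>}. C_on n k (d_dir r i h F) S)"

definition smooth_coords_on :: "nat \<Rightarrow> ('m::finite coords \<Rightarrow> complex) \<Rightarrow> 'm coords set \<Rightarrow> bool" where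
  "smooth_coords_on k F S \<longleftrightarrow> (\<forall>n. C_on n k F S)"

section \<open>Complex manifolds\<close>

text \<open>
  The manifold \<open>M\<close> is the whole type \<open>'a\<close>; a chart is a pair of its domain and its coordinate map,
  whose values outside the domain are irrelevant. Its real dimension is \<open>2 * CARD('m)\<close>.
\<close>

type_synonym ('a, 'm) chart = "'a set \<times> ('a \<Rightarrow> complex ^ 'm)"

text \<open>
  Holomorphy of the coordinate changes is expressed as smoothness together with the Cauchy-Riemann
  equations \<open>\<partial>/\<partial>zbar = 0\<close>; a function of \<open>z\<close> alone is a function of coordinates of order 0.
\<close>

definition complex_atlas ::
  "('a::{t2_space, second_countable_topology}, 'm::finite) chart set \<Rightarrow> bool" where
  "complex_atlas A \<longleftrightarrow>
     (\<Union>(U, \<phi>)\<in>A. U) = UNIV \<and>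
     (\<forall>(U, \<phi>)\<in>A. open U \<and> open (\<phi> ` U) \<and> homeomorphism U (\<phi> ` U) \<phi> (inv_into U \<phi>)) \<and>
     (\<forall>(U, \<phi>)\<in>A. \<forall>(V, \<psi>)\<in>A. \<forall>j.
        let S = {(t, x). x 0 \<in> \<phi> ` (U \<inter> V)}; F = (\<lambda>(t, x). \<psi> (inv_into U \<phi> (x 0)) $ j)
        in smooth_coords_on 0 F S \<and> (\<forall>p\<in>S. \<forall>i. d_zbar 0 i F p = 0))"

section \<open>The extensions\<close>

text \<open>
  The \<open>k\<close>-th extension of \<open>M\<close> is realised as the manifold of \<open>k\<close>-jets at \<open>0\<close> of smooth curves in \<open>M\<close>,
  with \<open>z\<^sup>r\<^sup>i\<close> the \<open>r\<close>-th derivative at \<open>0\<close> of the \<open>i\<close>-th coordinate of the curve. Sending the \<open>k\<close>-jet of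
  \<open>\<gamma>\<close> to the velocity at \<open>0\<close> of \<open>s \<mapsto> (k-1)-jet of \<gamma>(s + \<cdot>)\<close> is the imbedding into the tangent bundle
  of the \<open>(k-1)\<close>-st extension, so that the velocity coordinate of \<open>z\<^sup>r\<^sup>i\<close> is \<open>z\<^sup>r\<^sup>+\<^sup>1\<^sup>,\<^sup>i\<close>. A \<open>0\<close>-jet is the set
  of all curves through a given point, and is identified with that point.
\<close>

definition curve_deriv :: "nat \<Rightarrow> (real \<Rightarrow> 'v::real_normed_vector) \<Rightarrow> real \<Rightarrow> 'v" where
  "curve_deriv n = ((\<lambda>g s. vector_derivative g (at s)) ^^ n)"

definition curves :: "('a, 'm::finite) chart set \<Rightarrow> (real \<Rightarrow> 'a) set" where
  "curves A = {\<gamma>. \<forall>(U, \<phi>)\<in>A. \<gamma> 0 \<in> U \<longrightarrow>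
     (\<exists>\<epsilon>>0. \<forall>s. \<bar>s\<bar> < \<epsilon> \<longrightarrow>
        \<gamma> s \<in> U \<and> (\<forall>n. curve_deriv n (\<phi> \<circ> \<gamma>) differentiable (at s)))}"

definition jet_rel :: "('a, 'm::finite) chart set \<Rightarrow> nat \<Rightarrow> ((real \<Rightarrow> 'a) \<times> (real \<Rightarrow> 'a)) set" where
  "jet_rel A k = {(\<gamma>, \<delta>). \<gamma> \<in> curves A \<and> \<delta> \<in> curves A \<and> \<gamma> 0 = \<delta> 0 \<and>
     (\<forall>(U, \<phi>)\<in>A. \<gamma> 0 \<in> U \<longrightarrow>
        (\<forall>r\<le>k. curve_deriv r (\<phi> \<circ> \<gamma>) 0 = curve_deriv r (\<phi> \<circ> \<delta>) 0))}"

definition ext_M :: "('a, 'm::finite) chart set \<Rightarrow> nat \<Rightarrow> (real \<Rightarrow> 'a) set set" where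
  "ext_M A k = curves A // jet_rel A k"

type_synonym 'a ext_point = "real \<times> (real \<Rightarrow> 'a) set"

definition ext_N :: "('a, 'm::finite) chart set \<Rightarrow> nat \<Rightarrow> 'a ext_point set" where
  "ext_N A k = UNIV \<times> ext_M A k"

definition base_point :: "'a ext_point \<Rightarrow> 'a" where
  "base_point = (\<lambda>(t, X). (SOME \<gamma>. \<gamma> \<in> X) 0)"

text \<open>The projection from any higher extension to the \<open>k\<close>-th one.\<close>

definition proj_N :: "('a, 'm::finite) chart set \<Rightarrow> nat \<Rightarrow> 'a ext_point \<Rightarrow> 'a ext_point" where
  "proj_N A k = (\<lambda>(t, X). (t, jet_rel A k `` X))"

definition chart_dom :: "('a, 'm::finite) chart set \<Rightarrow> nat \<Rightarrow> ('a, 'm) chart \<Rightarrow> 'a ext_point set" where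
  "chart_dom A k c = {P \<in> ext_N A k. base_point P \<in> fst c}"

definition t_coord :: "'a ext_point \<Rightarrow> complex" where
  "t_coord = (\<lambda>(t, X). complex_of_real t)"

definition z_vec :: "('a, 'm::finite) chart \<Rightarrow> nat \<Rightarrow> 'a ext_point \<Rightarrow> complex ^ 'm" where
  "z_vec c r = (\<lambda>(t, X). curve_deriv r (snd c \<circ> (SOME \<gamma>. \<gamma> \<in> X)) 0)"

definition z_coord :: "('a, 'm::finite) chart \<Rightarrow> nat \<Rightarrow> 'm \<Rightarrow> 'a ext_point \<Rightarrow> complex" where
  "z_coord c r i P = z_vec c r P $ i"

definition zbar_coord :: "('a, 'm::finite) chart \<Rightarrow> nat \<Rightarrow> 'm \<Rightarrow> 'a ext_point \<Rightarrow> complex" where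
  "zbar_coord c r i P = cnj (z_coord c r i P)"

definition to_coords :: "nat \<Rightarrow> ('a, 'm::finite) chart \<Rightarrow> 'a ext_point \<Rightarrow> 'm coords" where
  "to_coords k c P = (fst P, \<lambda>r. if r \<le> k then z_vec c r P else 0)"

text \<open>Inverse to \<^term>\<open>to_coords\<close> on the domain of the chart; ignores \<open>x r\<close> for \<open>r > k\<close>.\<close>

definition of_coords ::
  "('a, 'm::finite) chart set \<Rightarrow> nat \<Rightarrow> ('a, 'm) chart \<Rightarrow> 'm coords \<Rightarrow> 'a ext_point" where
  "of_coords A k c = (\<lambda>(t, x).
     (t, {\<gamma> \<in> curves A. \<gamma> 0 \<in> fst c \<and> (\<forall>r\<le>k. curve_deriv r (snd c \<circ> \<gamma>) 0 = x r)}))"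

definition coords_dom :: "('a, 'm::finite) chart \<Rightarrow> 'm coords set" where
  "coords_dom c = {(t, x). x 0 \<in> snd c ` fst c}"

section \<open>Functions on the extensions\<close>

type_synonym 'a ext_fun = "'a ext_point \<Rightarrow> complex"

definition in_coords ::
  "('a, 'm::finite) chart set \<Rightarrow> nat \<Rightarrow> ('a, 'm) chart \<Rightarrow> 'a ext_fun \<Rightarrow> 'm coords \<Rightarrow> complex" where
  "in_coords A k c f = f \<circ> of_coords A k c"

definition smooth_on_chart ::
  "('a, 'm::finite) chart set \<Rightarrow> nat \<Rightarrow> ('a, 'm) chart \<Rightarrow> 'a ext_fun \<Rightarrow> bool" where
  "smooth_on_chart A k c f \<longleftrightarrow> smooth_coords_on k (in_coords A k c f) (coords_dom c)"

definition smooth_near ::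
  "('a, 'm::finite) chart set \<Rightarrow> nat \<Rightarrow> 'a ext_point \<Rightarrow> 'a ext_fun \<Rightarrow> bool" where
  "smooth_near A k P f \<longleftrightarrow>
     (\<exists>c\<in>A. P \<in> chart_dom A k c \<and>
        (\<exists>S. open S \<and> to_coords k c P \<in> S \<and> S \<subseteq> coords_dom c \<and>
             smooth_coords_on k (in_coords A k c f) S))"

text \<open>A function on \<open>M\<close>, regarded as a function on \<open>N\<close>.\<close>

definition on_N :: "('a \<Rightarrow> complex) \<Rightarrow> 'a ext_fun" where
  "on_N g = g \<circ> base_point"

definition smooth_fun_M :: "('a, 'm::finite) chart set \<Rightarrow> ('a \<Rightarrow> complex) set" where
  "smooth_fun_M A = {g. \<forall>c\<in>A. smooth_on_chart A 0 c (on_N g)}"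

definition partial_t ::
  "('a, 'm::finite) chart set \<Rightarrow> nat \<Rightarrow> ('a, 'm) chart \<Rightarrow> 'a ext_fun \<Rightarrow> 'a ext_fun" where
  "partial_t A k c f P = d_time (in_coords A k c f) (to_coords k c P)"

definition partial_z ::
  "('a, 'm::finite) chart set \<Rightarrow> nat \<Rightarrow> ('a, 'm) chart \<Rightarrow> nat \<Rightarrow> 'm \<Rightarrow> 'a ext_fun \<Rightarrow> 'a ext_fun" where
  "partial_z A k c r i f P = d_z r i (in_coords A k c f) (to_coords k c P)"

definition partial_zbar ::
  "('a, 'm::finite) chart set \<Rightarrow> nat \<Rightarrow> ('a, 'm) chart \<Rightarrow> nat \<Rightarrow> 'm \<Rightarrow> 'a ext_fun \<Rightarrow> 'a ext_fun" where
  "partial_zbar A k c r i f P = d_zbar r i (in_coords A k c f) (to_coords k c P)"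

text \<open>Lifts from order \<open>k\<close> to order \<open>k + 1\<close>, and their iterates from \<open>N\<close> to order \<open>k\<close>.\<close>

definition vlift :: "('a, 'm::finite) chart set \<Rightarrow> nat \<Rightarrow> 'a ext_fun \<Rightarrow> 'a ext_fun" where
  "vlift A k f = f \<circ> proj_N A k"

text \<open>The value of the complete lift does not depend on the chart used to compute it.\<close>

definition chart_at :: "('a, 'm::finite) chart set \<Rightarrow> 'a \<Rightarrow> ('a, 'm) chart" where
  "chart_at A p = (SOME c. c \<in> A \<and> p \<in> fst c)"

definition clift :: "('a, 'm::finite) chart set \<Rightarrow> nat \<Rightarrow> 'a ext_fun \<Rightarrow> 'a ext_fun" where
  "clift A k f P =
     (let c = chart_at A (base_point P) in
        t_coord P * vlift A k (partial_t A k c f) P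
        + (\<Sum>r\<le>k. \<Sum>i\<in>UNIV.
             z_coord c (Suc r) i P * vlift A k (partial_z A k c r i f) P
           + zbar_coord c (Suc r) i P * vlift A k (partial_zbar A k c r i f) P))"

primrec vlift_pow :: "('a, 'm::finite) chart set \<Rightarrow> nat \<Rightarrow> 'a ext_fun \<Rightarrow> 'a ext_fun" where
  "vlift_pow A 0 f = f"
| "vlift_pow A (Suc k) f = vlift A k (vlift_pow A k f)"

primrec clift_pow :: "('a, 'm::finite) chart set \<Rightarrow> nat \<Rightarrow> 'a ext_fun \<Rightarrow> 'a ext_fun" where
  "clift_pow A 0 f = f"
| "clift_pow A (Suc k) f = clift A k (clift_pow A k f)"

section \<open>Vector fields and 1-forms\<close>

text \<open>
  A (complexified) tangent vector is the operator
  \<open>a \<partial>/\<partial>t + b\<^sup>r\<^sup>i \<partial>/\<partial>z\<^sup>r\<^sup>i + b'\<^sup>r\<^sup>i \<partial>/\<partial>zbar\<^sup>r\<^sup>i\<close> on the functions that are smooth near its base point. It is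
  made to vanish on all other functions, on which the expression would depend on the chart.
\<close>

type_synonym 'a tvec = "'a ext_fun \<Rightarrow> complex"

definition coord_tvec ::
  "('a, 'm::finite) chart set \<Rightarrow> nat \<Rightarrow> ('a, 'm) chart \<Rightarrow> 'a ext_point \<Rightarrow>
   complex \<Rightarrow> (nat \<Rightarrow> 'm \<Rightarrow> complex) \<Rightarrow> (nat \<Rightarrow> 'm \<Rightarrow> complex) \<Rightarrow> 'a tvec" where
  "coord_tvec A k c P a b b' = (\<lambda>f.
     if smooth_near A k P f
     then a * partial_t A k c f P
          + (\<Sum>r\<le>k. \<Sum>i\<in>UNIV. b r i * partial_z A k c r i f P + b' r i * partial_zbar A k c r i f P)
     else 0)"

definition tangent :: "('a, 'm::finite) chart set \<Rightarrow> nat \<Rightarrow> 'a ext_point \<Rightarrow> 'a tvec set" where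
  "tangent A k P = {v. \<exists>c\<in>A. P \<in> chart_dom A k c \<and> (\<exists>a b b'. v = coord_tvec A k c P a b b')}"

type_synonym 'a vfield = "'a ext_point \<Rightarrow> 'a tvec"

text \<open>
  Vector fields are those of the form
  \<open>\<partial>/\<partial>t + Z\<^sup>r\<^sup>i \<partial>/\<partial>z\<^sup>r\<^sup>i + Z'\<^sup>r\<^sup>i \<partial>/\<partial>zbar\<^sup>r\<^sup>i\<close>; on \<open>N\<close> the coefficients are moreover functions on \<open>M\<close>.
\<close>

definition vector_field_ext :: "('a, 'm::finite) chart set \<Rightarrow> nat \<Rightarrow> 'a vfield \<Rightarrow> bool" where
  "vector_field_ext A k W \<longleftrightarrow>
     (\<forall>c\<in>A. \<exists>b b'.
        (\<forall>r\<le>k. \<forall>i. smooth_on_chart A k c (b r i) \<and> smooth_on_chart A k c (b' r i)) \<and>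
        (\<forall>P\<in>chart_dom A k c. W P = coord_tvec A k c P 1 (\<lambda>r i. b r i P) (\<lambda>r i. b' r i P)))"

definition vector_field_N :: "('a, 'm::finite) chart set \<Rightarrow> 'a vfield \<Rightarrow> bool" where
  "vector_field_N A Z \<longleftrightarrow>
     (\<forall>c\<in>A. \<exists>\<zeta> \<zeta>'.
        (\<forall>i. smooth_on_chart A 0 c (on_N (\<zeta> i)) \<and> smooth_on_chart A 0 c (on_N (\<zeta>' i))) \<and>
        (\<forall>P\<in>chart_dom A 0 c.
           Z P = coord_tvec A 0 c P 1 (\<lambda>r i. on_N (\<zeta> i) P) (\<lambda>r i. on_N (\<zeta>' i) P)))"

text \<open>
  \<open>W\<close> is the complete lift of order \<open>k\<close> of \<open>Z\<close>. The functions \<open>f\<close> range over the functions on \<open>M\<close>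
  regarded as functions on \<open>N\<close>. With functions of \<open>t\<close> admitted as well, no vector field would satisfy
  the condition for \<open>k \<ge> 1\<close>: since \<open>t\<^sup>c = t\<close>, \<open>(t\<^sup>2)\<^sup>c = 2 t\<^sup>2\<close> and \<open>1\<^sup>c = 0\<close>, the function \<open>t\<close> would give
  \<open>W t = (Z t)\<^sup>c = 0\<close>, and \<open>t\<^sup>2\<close> would give \<open>4 t W t = (2 t)\<^sup>c = 2 t\<close>.
\<close>

definition complete_lift_of ::
  "('a, 'm::finite) chart set \<Rightarrow> nat \<Rightarrow> 'a vfield \<Rightarrow> 'a vfield \<Rightarrow> bool" where
  "complete_lift_of A k Z W \<longleftrightarrow>
     vector_field_ext A k W \<and>
     (\<forall>f\<in>smooth_fun_M A. \<forall>P\<in>ext_N A k.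
        W P (clift_pow A k (on_N f)) = clift_pow A k (\<lambda>Q. Z Q (on_N f)) P)"

type_synonym 'a form1 = "'a ext_point \<Rightarrow> 'a tvec \<Rightarrow> complex"

text \<open>The differential \<open>df\<close>, so that \<open>dt\<close> is \<open>d t_coord\<close> and \<open>dz\<^sup>r\<^sup>i\<close> is \<open>d (z_coord c r i)\<close>.\<close>

definition d :: "'a ext_fun \<Rightarrow> 'a form1" where
  "d f P v = v f"

definition one_form :: "('a, 'm::finite) chart set \<Rightarrow> nat \<Rightarrow> 'a form1 \<Rightarrow> bool" where
  "one_form A k \<eta> \<longleftrightarrow>
     (\<forall>c\<in>A. \<exists>a b b'.
        smooth_on_chart A k c a \<and>
        (\<forall>r\<le>k. \<forall>i. smooth_on_chart A k c (b r i) \<and> smooth_on_chart A k c (b' r i)) \<and>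
        (\<forall>P\<in>chart_dom A k c. \<forall>v\<in>tangent A k P.
           \<eta> P v = a P * d t_coord P v
             + (\<Sum>r\<le>k. \<Sum>i\<in>UNIV. b r i P * d (z_coord c r i) P v
                              + b' r i P * d (zbar_coord c r i) P v))) \<and>
     (\<forall>P v. P \<notin> ext_N A k \<or> v \<notin> tangent A k P \<longrightarrow> \<eta> P v = 0)"

definition vertical_lift_form :: "('a, 'm::finite) chart set \<Rightarrow> nat \<Rightarrow> 'a form1 \<Rightarrow> 'a form1" where
  "vertical_lift_form A k \<omega> =
     (THE \<eta>. one_form A k \<eta> \<and>
        (\<forall>Z W. vector_field_N A Z \<and> complete_lift_of A k Z W \<longrightarrow>
           (\<forall>P\<in>ext_N A k. \<eta> P (W P) = vlift_pow A k (\<lambda>Q. \<omega> Q (Z Q)) P)))"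

end

theory Submission
  imports Defs
begin

text \<open>
  The form described in the theorem is the pullback of \<open>\<omega>\<close> along the projection of the \<open>k\<close>-th extension
  onto \<open>N\<close> (\<open>pullback_form_eq\<close>). Since the vertical lift is the \<^emph>\<open>only\<close> 1-form \<open>\<eta>\<close> with
  \<open>\<eta>(Z\<^sup>c) = (\<omega> Z)\<^sup>v\<close> for all \<open>Z\<close>, it has to be shown that the pullback has this property, and that no other
  1-form has it.

  Both parts rest on the total derivative \<open>D = z\<^sup>r\<^sup>+\<^sup>1\<^sup>,\<^sup>i \<partial>/\<partial>z\<^sup>r\<^sup>i + conjugate\<close>. On the jets of a curve \<open>\<gamma>\<close>
  it is differentiation along \<open>\<gamma>\<close>, so the \<open>k\<close>-fold complete lift of a function \<open>f\<close> on \<open>M\<close> takes the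
  \<open>k\<close>-jet of \<open>\<gamma>\<close> to the \<open>k\<close>-th derivative of \<open>f \<circ> \<gamma>\<close>, and is \<open>D\<^sup>k f\<close> in every chart (\<open>clift_pow_eq\<close>).

  \<^item> Every complete lift \<open>W\<close> of \<open>Z\<close> projects to \<open>Z\<close> (\<open>complete_lift_pushforward\<close>), which gives the property
    for the pullback. Let \<open>\<ell>\<close> be a coordinate of order 0 minus its value at the base point, and
    \<open>f = \<beta> \<ell>\<^sup>k\<^sup>+\<^sup>1\<close> with a bump function \<open>\<beta>\<close>. A product of \<open>k + 1\<close> factors differentiated \<open>k\<close> times keeps
    an undifferentiated factor, so \<open>D\<^sup>k f = (k+1)! \<beta> \<ell> (D \<ell>)\<^sup>k\<close> up to a multiple of \<open>\<ell>\<^sup>2\<close>. Hence \<open>W\<close> takes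
    the lift of \<open>f\<close> to \<open>(k+1)! \<beta> (D \<ell>)\<^sup>k W \<ell>\<close>, while the lift of \<open>Z f\<close> is \<open>(k+1)! \<beta> (D \<ell>)\<^sup>k Z \<ell>\<close>
    there.
    So \<open>W \<ell> = Z \<ell>\<close> wherever the velocity \<open>D \<ell>\<close> is not zero, and everywhere by continuity.

  \<^item> A 1-form that vanishes on all complete lifts is zero (\<open>annihilator_of_lifts\<close>), which gives uniqueness.
    The field with coefficients \<open>\<xi>\<close> has a complete lift, with coefficients \<open>D\<^sup>r \<xi>\<close> in every chart; this
    works because such a field commutes with \<open>D\<close> (\<open>prolong_total_deriv\<close>), so that its action on the
    \<open>r\<close>-th derivatives of the coordinates of another chart is given by the coefficients there. For
    \<open>\<xi> = \<beta> \<ell>\<^sup>s\<close> the lift has, where \<open>\<ell> = 0\<close>, no component of order below \<open>s\<close>, and the component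
    \<open>s! \<beta> (D \<ell>)\<^sup>s\<close> in order \<open>s\<close>. The resulting triangular system makes the coefficients of the form vanish from order \<open>k\<close>
    downwards, again first where \<open>D \<ell>\<close> is not zero.
\<close>

section \<open>Differential calculus in the coordinates\<close>

type_synonym 'm dir = "(nat \<times> 'm \<times> complex) option"

text \<open>
  The direction \<open>None\<close> is that of time; in the direction \<open>Some (r, i, h)\<close> the coordinate \<open>z\<^sup>r\<^sup>i\<close> moves with
  velocity \<open>h\<close>.
\<close>

fun move :: "'m::finite dir \<Rightarrow> 'm coords \<Rightarrow> real \<Rightarrow> 'm coords" where
  "move None p s = (fst p + s, snd p)"
| "move (Some (r, i, h)) p s = coord_line r i h p s"

text \<open>The directions along which \<^const>\<open>C_on\<close> differentiates at order \<open>k\<close>.\<close>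

definition dirs :: "nat \<Rightarrow> 'm::finite dir set" where
  "dirs k = insert None (Some ` ({..k} \<times> UNIV \<times> {1, \<i>}))"

definition pd :: "'m::finite dir \<Rightarrow> ('m coords \<Rightarrow> complex) \<Rightarrow> 'm coords \<Rightarrow> complex" where
  "pd j F p = vector_derivative (\<lambda>s. F (move j p s)) (at 0)"

lemma finite_dirs [simp]: "finite (dirs k :: 'm::finite dir set)"
  by (simp add: dirs_def)

lemma dirs_mono: "k \<le> l \<Longrightarrow> dirs k \<subseteq> dirs l"
  by (auto simp: dirs_def)

lemma axis_zero: "axis i 0 = 0"
  by (simp add: vec_eq_iff axis_def)

lemma move_0 [simp]: "move j p 0 = p"
  by (cases j) (auto simp: coord_line_def axis_zero split: prod.splits)

lemma axis_add: "axis i a + axis i b = axis i (a + b :: 'a::monoid_add)"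
  by (simp add: vec_eq_iff axis_def)

lemma move_move: "move j (move j p a) b = move j p (a + b)"
  by (cases j)
     (auto simp: coord_line_def axis_add distrib_right add.assoc split: prod.splits)

lemma continuous_on_If_const:
  "continuous_on S f \<Longrightarrow> continuous_on S g \<Longrightarrow> continuous_on S (\<lambda>x. if b then f x else g x)"
  by (cases b) simp_all

lemma continuous_on_axis [continuous_intros]:
  fixes f :: "'a::topological_space \<Rightarrow> 'b::{real_normed_vector}"
  assumes "continuous_on S f" shows "continuous_on S (\<lambda>x. axis i (f x) :: 'b ^ 'm)"
proof -
  show ?thesis unfolding axis_def
    by (intro continuous_on_vec_lambda continuous_on_If_const assms continuous_on_const)
qed

lemma continuous_on_snd_apply [continuous_intros]:
  fixes f :: "'a::topological_space \<Rightarrow> 'b::topological_space \<times> ('c \<Rightarrow> 'd::topological_space)"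
  shows "continuous_on S f \<Longrightarrow> continuous_on S (\<lambda>x. snd (f x) r)"
  by (rule continuous_on_product_then_coordinatewise[OF continuous_on_snd])

lemma continuous_on_move [continuous_intros]:
  fixes f :: "'a::topological_space \<Rightarrow> 'm::finite coords"
  assumes f: "continuous_on S f" and g: "continuous_on S g"
  shows "continuous_on S (\<lambda>x. move j (f x) (g x))"
proof (cases j)
  case None
  then show ?thesis using f g by (auto intro!: continuous_intros)
next
  case (Some a)
  obtain r i h where a: "a = (r, i, h)" by (cases a) auto
  have "(\<lambda>x. move j (f x) (g x)) = (\<lambda>x. (fst (f x), \<lambda>s. if s = r
       then snd (f x) r + axis i (complex_of_real (g x) * h) else snd (f x) s))"
    by (auto simp: Some a coord_line_def fun_eq_iff split: prod.splits)
  moreover have "continuous_on S (\<lambda>x. if s = r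
       then snd (f x) r + axis i (complex_of_real (g x) * h) else snd (f x) s)" for s
    using f g by (intro continuous_on_If_const continuous_intros)
  ultimately show ?thesis using f
    by (simp only:) (intro continuous_on_Pair continuous_on_fst continuous_on_coordinatewise_then_product)
qed

lemma has_vector_derivative_at_shift:
  "(f has_vector_derivative D) (at a) \<longleftrightarrow> ((\<lambda>s. f (a + s)) has_vector_derivative D) (at 0)"
proof
  assume "(f has_vector_derivative D) (at a)"
  then have "(f has_vector_derivative D) (at (a + 0))" by simp
  from vector_diff_chain_at[where f = "\<lambda>s. a + s" and f' = 1, OF _ this]
  show "((\<lambda>s. f (a + s)) has_vector_derivative D) (at 0)"
    using has_vector_derivative_shift[of "\<lambda>s. s" "\<lambda>_. 1" 0 a] by (simp add: o_def)
next
  assume "((\<lambda>s. f (a + s)) has_vector_derivative D) (at 0)"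
  then have "((\<lambda>s. f (a + s)) has_vector_derivative D) (at (a - a))" by simp
  from vector_diff_chain_at[where f = "\<lambda>s. s - a" and f' = 1, OF _ this]
  show "(f has_vector_derivative D) (at a)"
    using has_vector_derivative_shift[of "\<lambda>s. s" "\<lambda>_. 1" a "- a"] by (simp add: o_def)
qed

lemma d_time_eq: "d_time F = pd None F"
proof
  fix p
  have "vector_derivative (\<lambda>s. F (s, snd p)) (at (fst p)) = vector_derivative (\<lambda>s. F (fst p + s, snd p)) (at 0)"
    unfolding vector_derivative_def by (subst has_vector_derivative_at_shift) (rule refl)
  then show "d_time F p = pd None F p" by (simp add: d_time_def pd_def split_def)
qed

lemma d_dir_eq: "d_dir r i h F = pd (Some (r, i, h)) F"
  by (rule ext) (simp add: d_dir_def pd_def)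

lemma has_vector_derivative_along_at_0_iff:
  "((\<lambda>s. F (move j p s)) has_vector_derivative D) (at a) \<longleftrightarrow>
   ((\<lambda>s. F (move j (move j p a) s)) has_vector_derivative D) (at 0)"
  by (subst has_vector_derivative_at_shift) (simp add: move_move)

text \<open>
  With time as one direction among others the recursion has a single kind of derivative, so that
  each closure property of \<^const>\<open>C_on\<close> needs only one induction step.
\<close>

lemma C_on_Suc_dirs:
  "C_on (Suc n) k F S \<longleftrightarrow> continuous_on S F
     \<and> (\<forall>p\<in>S. \<forall>j\<in>dirs k. ((\<lambda>s. F (move j p s)) has_vector_derivative pd j F p) (at 0))
     \<and> (\<forall>j\<in>dirs k. C_on n k (pd j F) S)"
proof -
  have "f differentiable (at a) \<longleftrightarrow> (\<exists>D. (f has_vector_derivative D) (at a))" for f :: "real \<Rightarrow> complex" and a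
    by (metis differentiableI_vector vector_derivative_works)
  then have 1: "(\<lambda>s. F (s, snd p)) differentiable (at (fst p)) \<longleftrightarrow> 
     (\<lambda>s. F (fst p + s, snd p)) differentiable (at 0)" for p
    by (simp add: has_vector_derivative_at_shift[of _ _ "fst p"])
  have ball_dirs: "(\<forall>j\<in>dirs k. P j) \<longleftrightarrow> P None \<and> (\<forall>r\<le>k. \<forall>i. \<forall>h\<in>{1, \<i>}. P (Some (r, i, h)))" for P
    by (auto simp: dirs_def)
  show ?thesis
    unfolding C_on.simps d_time_eq d_dir_eq ball_dirs split_def
    unfolding 1 unfolding pd_def vector_derivative_works move.simps ball_conj_distrib by (simp only: conj_assoc)
qed

declare C_on.simps(2) [simp del]

lemma C_on_imp_continuous_on: "C_on n k F S \<Longrightarrow> continuous_on S F"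
  by (cases n) (auto simp: C_on_Suc_dirs)

lemma pd_works:
  "C_on (Suc n) k F S \<Longrightarrow> j \<in> dirs k \<Longrightarrow> p \<in> S \<Longrightarrow> 
   ((\<lambda>s. F (move j p s)) has_vector_derivative pd j F p) (at 0)"
  by (simp add: C_on_Suc_dirs)

lemma C_on_pd: "C_on (Suc n) k F S \<Longrightarrow> j \<in> dirs k \<Longrightarrow> C_on n k (pd j F) S"
  by (simp add: C_on_Suc_dirs)

lemma eventually_move_in:
  assumes "open S" "p \<in> S"
  shows "\<forall>\<^sub>F s in nhds (0::real). move j p s \<in> S"
proof -
  have "continuous_on UNIV (move j p)"
    by (rule continuous_on_move[OF continuous_on_const continuous_on_id])
  then have "open (move j p -` S)" using assms(1) by (rule open_vimage[rotated])
  moreover have "0 \<in> move j p -` S" using assms(2) by simp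
  ultimately show ?thesis unfolding eventually_nhds by blast
qed

lemma has_vector_derivative_along_cong:
  assumes "open S" "p \<in> S" "\<And>q. q \<in> S \<Longrightarrow> F q = G q"
  shows "((\<lambda>s. F (move j p s)) has_vector_derivative D) (at 0) \<longleftrightarrow>
         ((\<lambda>s. G (move j p s)) has_vector_derivative D) (at 0)"
proof -
  obtain T where T: "open T" "0 \<in> T" "\<forall>s\<in>T. move j p s \<in> S"
    using eventually_move_in[OF assms(1,2), of j] unfolding eventually_nhds by (elim exE conjE)
  show ?thesis
    by (rule iffI; erule has_vector_derivative_transform_within_open[OF _ T(1,2)]) (use T(3) assms(3) in simp_all)
qed

lemma pd_cong:
  assumes "open S" "p \<in> S" "\<And>q. q \<in> S \<Longrightarrow> F q = G q"
  shows "pd j F p = pd j G p"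
  unfolding pd_def vector_derivative_def
  using has_vector_derivative_along_cong[OF assms(1,2), of F G] assms(3) by simp

lemma C_on_cong:
  assumes "open S" "\<And>q. q \<in> S \<Longrightarrow> F q = G q" "C_on n k F S"
  shows "C_on n k G S"
  using assms(2,3)
proof (induction n arbitrary: F G)
  case 0
  then show ?case by (simp cong: continuous_on_cong)
next
  case (Suc n)
  have pd: "p \<in> S \<Longrightarrow> pd j F p = pd j G p" for j p
    by (rule pd_cong[OF assms(1)]) (simp_all add: Suc.prems(1))
  have "C_on n k (pd j G) S" if "j \<in> dirs k" for j
    by (rule Suc.IH[OF pd C_on_pd[OF Suc.prems(2) that]])
  moreover have "continuous_on S G"
    using C_on_imp_continuous_on[OF Suc.prems(2)] Suc.prems(1) by (simp cong: continuous_on_cong)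
  moreover have "((\<lambda>s. G (move j p s)) has_vector_derivative pd j G p) (at 0)"
    if "p \<in> S" "j \<in> dirs k" for p j
    using pd_works[OF Suc.prems(2) that(2,1)] pd[OF that(1)]
      has_vector_derivative_along_cong[OF assms(1) that(1), of F G] Suc.prems(1) by simp
  ultimately show ?case by (simp add: C_on_Suc_dirs)
qed

lemma C_on_lower: "C_on (Suc n) k F S \<Longrightarrow> C_on n k F S"
proof (induction n arbitrary: F)
  case 0
  then show ?case by (simp add: C_on_Suc_dirs)
next
  case (Suc n)
  have "C_on n k (pd j F) S" if "j \<in> dirs k" for j
    by (rule Suc.IH[OF C_on_pd[OF Suc.prems that]])
  then show ?case 
    using C_on_imp_continuous_on[OF Suc.prems] pd_works[OF Suc.prems] by (simp add: C_on_Suc_dirs)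
qed

lemma C_on_subset:
  assumes "C_on n k F S" "T \<subseteq> S" shows "C_on n k F T"
  using assms(1)
proof (induction n arbitrary: F)
  case 0
  then show ?case using assms(2) continuous_on_subset by auto
next
  case (Suc n)
  have "C_on n k (pd j F) T" if "j \<in> dirs k" for j
    by (rule Suc.IH[OF C_on_pd[OF Suc.prems that]])
  moreover have "((\<lambda>s. F (move j p s)) has_vector_derivative pd j F p) (at 0)" if "j \<in> dirs k" "p \<in> T" for j p
    using pd_works[OF Suc.prems that(1)] that(2) assms(2) by blast
  moreover have "continuous_on T F"
    by (rule continuous_on_subset[OF C_on_imp_continuous_on[OF Suc.prems] assms(2)])
  ultimately show ?case by (simp add: C_on_Suc_dirs)
qed

lemma C_on_fewer_dirs:
  assumes "C_on n k F S" "k' \<le> k" shows "C_on n k' F S"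
  using assms(1)
proof (induction n arbitrary: F)
  case (Suc n)
  have sub: "j \<in> dirs k" if "j \<in> dirs k'" for j :: "'a dir"
    using dirs_mono[OF assms(2)] that by blast
  have "C_on n k' (pd j F) S" if "j \<in> dirs k'" for j
    by (rule Suc.IH[OF C_on_pd[OF Suc.prems sub[OF that]]])
  moreover have "continuous_on S F"
    by (rule C_on_imp_continuous_on[OF Suc.prems])
  ultimately show ?case using pd_works[OF Suc.prems sub] by (simp add: C_on_Suc_dirs)
qed auto

lemma C_on_Union:
  assumes "\<And>S. S \<in> \<S> \<Longrightarrow> open S \<and> C_on n k F S"
  shows "C_on n k F (\<Union>\<S>)"
  using assms
proof (induction n arbitrary: F)
  case 0
  then show ?case by (auto intro!: continuous_on_open_Union)
next
  case (Suc n)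
  have S: "C_on (Suc n) k F S" "open S" if "S \<in> \<S>" for S
    using Suc.prems[OF that] by auto
  have "C_on n k (pd j F) (\<Union>\<S>)" if "j \<in> dirs k" for j
    by (rule Suc.IH) (use S C_on_pd[OF _ that] in auto)
  moreover have "continuous_on (\<Union>\<S>) F"
    by (rule continuous_on_open_Union) (use S C_on_imp_continuous_on[OF S(1)] in auto)
  ultimately show ?case using pd_works[OF S(1)] by (auto simp add: C_on_Suc_dirs)
qed

lemma C_on_const [simp]: "C_on n k (\<lambda>_. c) (S :: 'a::finite coords set)"
proof (induction n arbitrary: c)
  case (Suc n)
  have "pd j (\<lambda>_. c) = (\<lambda>_. 0)" for j :: "'a dir" by (simp add: pd_def fun_eq_iff)
  then show ?case using Suc by (auto simp: C_on_Suc_dirs)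
qed auto

lemma C_on_SucI:
  assumes "open S" "continuous_on S F"
    and "\<And>p j. p \<in> S \<Longrightarrow> j \<in> dirs k \<Longrightarrow> ((\<lambda>s. F (move j p s)) has_vector_derivative G j p) (at 0)"
    and "\<And>j. j \<in> dirs k \<Longrightarrow> C_on n k (G j) S"
  shows "C_on (Suc n) k F S"
proof -
  have eq: "pd j F p = G j p" if "p \<in> S" "j \<in> dirs k" for p j
    using assms(3)[OF that] by (simp add: pd_def vector_derivative_at)
  moreover have "C_on n k (pd j F) S" if "j \<in> dirs k" for j
    using C_on_cong[OF assms(1), of "G j" "pd j F" n k] assms(4) that eq by auto
  ultimately show ?thesis using assms(2,3) by (simp add: C_on_Suc_dirs)
qed

lemma C_on_add:
  fixes F :: "'a::finite coords \<Rightarrow> complex"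
  assumes "open S" "C_on n k F S" "C_on n k G S"
  shows "C_on n k (\<lambda>p. F p + G p) S"
  using assms(2,3)
proof (induction n arbitrary: F G)
  case (Suc n)
  show ?case
  proof (rule C_on_SucI[where G = "\<lambda>j p. pd j F p + pd j G p"])
    fix p and j :: "'a dir" assume "p \<in> S" "j \<in> dirs k"
    then show "((\<lambda>s. F (move j p s) + G (move j p s)) has_vector_derivative pd j F p + pd j G p) (at 0)"
      using Suc.prems by (intro has_vector_derivative_add pd_works)
  next
    show "continuous_on S (\<lambda>p. F p + G p)"
      by (intro continuous_on_add C_on_imp_continuous_on[OF Suc.prems(1)] C_on_imp_continuous_on[OF Suc.prems(2)])
    show "C_on n k (\<lambda>p. pd j F p + pd j G p) S" if "j \<in> dirs k" for j
      by (intro Suc.IH C_on_pd[OF Suc.prems(1) that] C_on_pd[OF Suc.prems(2) that])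
  qed (rule assms(1))
qed (auto intro!: continuous_intros)

lemma C_on_mult:
  fixes F :: "'a::finite coords \<Rightarrow> complex"
  assumes "open S" "C_on n k F S" "C_on n k G S"
  shows "C_on n k (\<lambda>p. F p * G p) S"
  using assms(2,3)
proof (induction n arbitrary: F G)
  case (Suc n)
  show ?case
  proof (rule C_on_SucI[where G = "\<lambda>j p. F p * pd j G p + pd j F p * G p"])
    fix j :: "'a dir" assume j: "j \<in> dirs k"
    show "C_on n k (\<lambda>p. F p * pd j G p + pd j F p * G p) S"
      by (intro C_on_add assms(1) Suc.IH C_on_pd[OF Suc.prems(1) j] C_on_pd[OF Suc.prems(2) j]
            C_on_lower[OF Suc.prems(1)] C_on_lower[OF Suc.prems(2)])
    show "((\<lambda>s. F (move j p s) * G (move j p s)) has_vector_derivative F p * pd j G p + pd j F p * G p) (at 0)"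
      if "p \<in> S" for p
      using has_vector_derivative_mult[OF pd_works[OF Suc.prems(1) j that] pd_works[OF Suc.prems(2) j that]]
      by simp
  next
    show "continuous_on S (\<lambda>p. F p * G p)"
      by (intro continuous_on_mult C_on_imp_continuous_on[OF Suc.prems(1)] C_on_imp_continuous_on[OF Suc.prems(2)])
  qed (rule assms(1))
qed (auto intro!: continuous_intros)

lemma C_on_cnj:
  fixes F :: "'a::finite coords \<Rightarrow> complex"
  assumes "open S" "C_on n k F S"
  shows "C_on n k (\<lambda>p. cnj (F p)) S"
  using assms(2)
proof (induction n arbitrary: F)
  case (Suc n)
  show ?case
  proof (rule C_on_SucI[where G = "\<lambda>j p. cnj (pd j F p)"])
    fix p and j :: "'a dir" assume "p \<in> S" "j \<in> dirs k"
    then show "((\<lambda>s. cnj (F (move j p s))) has_vector_derivative cnj (pd j F p)) (at 0)"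
      using Suc.prems by (intro has_vector_derivative_cnj pd_works)
  next
    show "continuous_on S (\<lambda>p. cnj (F p))"
      by (intro continuous_on_cnj C_on_imp_continuous_on[OF Suc.prems])
    show "C_on n k (\<lambda>p. cnj (pd j F p)) S" if "j \<in> dirs k" for j
      by (intro Suc.IH C_on_pd[OF Suc.prems that])
  qed (rule assms(1))
qed (auto intro!: continuous_intros)

subsection \<open>The chain rule\<close>

text \<open>The real coordinate that changes along a direction; for \<open>h \<noteq> 1\<close> the direction is meant to be \<open>\<i>\<close>.\<close>

definition real_coord :: "'m::finite dir \<Rightarrow> 'm coords \<Rightarrow> real" where
  "real_coord j p = (case j of None \<Rightarrow> fst p
     | Some (r, i, h) \<Rightarrow> if h = 1 then Re (snd p r $ i) else Im (snd p r $ i))"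

primrec moves :: "'m::finite dir list \<Rightarrow> ('m dir \<Rightarrow> real) \<Rightarrow> 'm coords \<Rightarrow> 'm coords" where
  "moves [] c p = p"
| "moves (j # js) c p = move j (moves js c p) (c j)"

lemma real_coord_move:
  assumes "j \<in> dirs k" "l \<in> dirs k"
  shows "real_coord l (move j p s) = real_coord l p + (if l = j then s else 0)"
  using assms
  by (auto simp: dirs_def real_coord_def coord_line_def axis_def if_distrib[of "\<lambda>v. v $ _"]
      split: prod.splits if_splits)

lemma snd_move_above:
  assumes "j \<in> dirs k" "r > k"
  shows "snd (move j p s) r = snd p r"
  using assms by (auto simp: dirs_def coord_line_def split: prod.splits)

lemma real_coord_moves:
  assumes "distinct js" "set js \<subseteq> dirs k" "l \<in> dirs k"
  shows "real_coord l (moves js c p) = real_coord l p + (if l \<in> set js then c l else 0)"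
  using assms by (induction js) (auto simp: real_coord_move[where k = k])

lemma snd_moves_above:
  assumes "set js \<subseteq> dirs k" "r > k"
  shows "snd (moves js c p) r = snd p r"
  using assms by (induction js) (auto simp: snd_move_above[where k = k])

lemma coords_eqI:
  assumes "\<And>l. l \<in> dirs k \<Longrightarrow> real_coord l p = real_coord l q" "\<And>r. r > k \<Longrightarrow> snd p r = snd q r"
  shows "p = q"
proof -
  have "fst p = fst q" using assms(1)[of None] by (simp add: dirs_def real_coord_def)
  moreover have "snd p r = snd q r" for r
  proof (cases "r \<le> k")
    case True
    then have "Re (snd p r $ i) = Re (snd q r $ i)" "Im (snd p r $ i) = Im (snd q r $ i)" for i
      using assms(1)[of "Some (r, i, 1)"] assms(1)[of "Some (r, i, \<i>)"]
      by (auto simp: dirs_def real_coord_def)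
    then show ?thesis by (simp add: vec_eq_iff complex_eq_iff)
  qed (use assms(2) in auto)
  ultimately show ?thesis by (auto simp: prod_eq_iff)
qed

lemma tendsto_move:
  assumes "(f \<longlongrightarrow> p) F" "(g \<longlongrightarrow> s) F"
  shows "((\<lambda>x. move j (f x) (g x)) \<longlongrightarrow> move j p s) F"
proof -
  have "continuous_on UNIV (\<lambda>z. move j (fst z) (snd z))"
    by (intro continuous_on_move continuous_on_fst continuous_on_snd continuous_on_id)
  then have "isCont (\<lambda>z. move j (fst z) (snd z)) (p, s)"
    unfolding continuous_on_eq_continuous_at[OF open_UNIV] by blast
  from isCont_tendsto_compose[OF this tendsto_Pair[OF assms]] show ?thesis by simp
qed

text \<open>
  The coordinates of all orders do not form a normed space, so there is no total derivative to
  compose with. Instead the directions are added one at a time: with direction \<open>j\<close> in front,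
  \<open>F\<close> becomes a function of the times of the old and of the new movement. Its derivative in the
  first is known by induction and its derivative in the second is continuous, so the function of
  two real variables is differentiable.
\<close>

lemma has_vector_derivative_moves:
  fixes c :: "'m::finite dir \<Rightarrow> real \<Rightarrow> real"
  assumes S: "open S" "p \<in> S" and F: "C_on (Suc 0) k F S"
    and js: "distinct js" "set js \<subseteq> dirs k"
    and c: "\<And>j. j \<in> set js \<Longrightarrow> (c j has_real_derivative c' j) (at 0)" "\<And>j. c j 0 = 0"
  shows "((\<lambda>s. F (moves js (\<lambda>j. c j s) p)) has_vector_derivative
           (\<Sum>j\<in>set js. of_real (c' j) * pd j F p)) (at 0)"
    and "((\<lambda>s. moves js (\<lambda>j. c j s) p) \<longlongrightarrow> p) (nhds 0)"
proof -
  have "((\<lambda>s. F (moves js (\<lambda>j. c j s) p)) has_vector_derivative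
           (\<Sum>j\<in>set js. of_real (c' j) * pd j F p)) (at 0) \<and>
    ((\<lambda>s. moves js (\<lambda>j. c j s) p) \<longlongrightarrow> p) (nhds 0)"
    using js c(1)
  proof (induction js)
    case (Cons j js)
    define Q where "Q = (\<lambda>a. moves js (\<lambda>j. c j a) p)"
    define D where "D = (\<Sum>j\<in>set js. of_real (c' j) * pd j F p)"
    have j: "j \<in> dirs k" and cj: "(c j has_real_derivative c' j) (at 0)" using Cons.prems by auto
    have IH: "((\<lambda>a. F (Q a)) has_vector_derivative D) (at 0)" "(Q \<longlongrightarrow> p) (nhds 0)"
      using Cons by (auto simp: D_def Q_def)
    have Q0: "Q 0 = p"
      unfolding Q_def by (induction js) (simp_all add: c(2))
    have cj0: "(c j \<longlongrightarrow> 0) (nhds 0)"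
      using DERIV_isCont[OF cj] c(2)[of j] tendsto_at_iff_tendsto_nhds[of "c j" 0] by (simp add: isCont_def)
    \<comment> \<open>The points reached at small times stay in \<open>S\<close>, which yields a product neighbourhood of times.\<close>
    have lim: "((\<lambda>z. move j (Q (fst z)) (snd z)) \<longlongrightarrow> p) (nhds (0, 0))"
    proof -
      have "((\<lambda>z. Q (fst z)) \<longlongrightarrow> p) (nhds ((0::real), 0::real))"
        by (rule filterlim_compose[OF IH(2)]) (use tendsto_fst[OF filterlim_ident, of "(0, 0)"] in simp)
      moreover have "(snd \<longlongrightarrow> 0) (nhds ((0::real), 0::real))"
        using tendsto_snd[OF filterlim_ident, of "(0, 0)"] by simp
      ultimately show ?thesis using tendsto_move[of _ p _ snd 0 j] by simp
    qed
    have "\<forall>\<^sub>F z in nhds (0, 0). move j (Q (fst z)) (snd z) \<in> S"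
      using topological_tendstoD[OF lim S] .
    then obtain T where T: "open T" "(0, 0) \<in> T" "\<And>z. z \<in> T \<Longrightarrow> move j (Q (fst z)) (snd z) \<in> S"
      unfolding eventually_nhds by blast
    obtain A B where AB: "open A" "open B" "(0, 0) \<in> A \<times> B" "A \<times> B \<subseteq> T"
      by (rule open_prod_elim[OF T(1,2)])
    obtain e where e: "e > 0" "ball 0 e \<subseteq> B"
      using AB(2,3) open_contains_ball[of B] by auto
    have in_S: "move j (Q a) y \<in> S" if "a \<in> A" "y \<in> ball 0 e" for a y
    proof -
      have "(a, y) \<in> A \<times> B" using that e(2) by blast
      then show ?thesis using AB(4) T(3)[of "(a, y)"] by auto
    qed
    have "((\<lambda>(a, y). F (move j (Q a) y)) has_derivative
       (\<lambda>(h, l). h *\<^sub>R D + blinfun_apply (blinfun_scaleR_left (pd j F (move j (Q 0) 0))) l)) (at (0, 0) within A \<times> ball 0 e)"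
    proof (rule has_derivative_partialsI[where f = "\<lambda>a y. F (move j (Q a) y)"
          and fx = "\<lambda>h. h *\<^sub>R D" and X = A and Y = "ball 0 e" and x = 0 and y = 0
          and fy = "\<lambda>a y. blinfun_scaleR_left (pd j F (move j (Q a) y))"])
      show "((\<lambda>a. F (move j (Q a) 0)) has_derivative (\<lambda>h. h *\<^sub>R D)) (at 0 within A)"
        using IH(1) by (simp add: has_vector_derivative_def has_derivative_at_withinI)
      show "((\<lambda>y. F (move j (Q a) y)) has_derivative
          blinfun_apply (blinfun_scaleR_left (pd j F (move j (Q a) y)))) (at y within ball 0 e)"
        if "a \<in> A" "y \<in> ball 0 e" for a y
      proof -
        have "((\<lambda>y. F (move j (Q a) y)) has_vector_derivative pd j F (move j (Q a) y)) (at y)"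
          unfolding has_vector_derivative_along_at_0_iff[of _ _ _ _ y]
          by (rule pd_works[OF F j in_S[OF that]])
        then show ?thesis by (simp add: has_vector_derivative_def has_derivative_at_withinI)
      qed
      have "isCont (pd j F) p"
        using C_on_imp_continuous_on[OF C_on_pd[OF F j]] S continuous_on_eq_continuous_at by blast
      then have "((\<lambda>z. pd j F (move j (Q (fst z)) (snd z))) \<longlongrightarrow> pd j F p) (nhds (0, 0))"
        by (rule isCont_tendsto_compose[OF _ lim])
      then have "((\<lambda>z. blinfun_scaleR_left (pd j F (move j (Q (fst z)) (snd z)))) \<longlongrightarrow>
          blinfun_scaleR_left (pd j F p)) (nhds (0, 0))"
        by (rule bounded_linear.tendsto[OF bounded_linear_blinfun_scaleR_left])
      then show "continuous (at (0, 0) within A \<times> ball 0 e)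
          (\<lambda>(a, y). blinfun_scaleR_left (pd j F (move j (Q a) y)))"
        unfolding continuous_within split_def
        by (simp add: Q0) (rule tendsto_mono[rotated], assumption, simp add: at_within_def)
    qed (use e in auto)
    then have "((\<lambda>(a, y). F (move j (Q a) y)) has_derivative
       (\<lambda>(h, l). h *\<^sub>R D + l *\<^sub>R pd j F p)) (at (0, 0))"
      using at_within_open[of "(0, 0) :: real \<times> real" "A \<times> ball 0 e"] AB(1,3) e(1) by (simp add: open_Times Q0)
    then have 1: "((\<lambda>(a, y). F (move j (Q a) y)) has_derivative
       (\<lambda>(h, l). h *\<^sub>R D + l *\<^sub>R pd j F p)) (at (0, c j 0))"
      by (simp add: c(2))
    have "((\<lambda>s. (s, c j s)) has_derivative (\<lambda>h. (h, h * c' j))) (at 0)"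
      using cj by (intro has_derivative_Pair) (auto simp: has_field_derivative_def mult_commute_abs)
    from has_derivative_compose[OF this 1]
    have "((\<lambda>s. F (move j (Q s) (c j s))) has_vector_derivative D + of_real (c' j) * pd j F p) (at 0)"
      by (simp add: has_vector_derivative_def scaleR_conv_of_real mult.assoc distrib_left)
    moreover have "((\<lambda>s. move j (Q s) (c j s)) \<longlongrightarrow> p) (nhds 0)"
      using tendsto_move[OF IH(2) cj0] by simp
    ultimately show ?case using Cons.prems(1) by (simp add: Q_def D_def add.commute)
  qed simp
  then show "((\<lambda>s. F (moves js (\<lambda>j. c j s) p)) has_vector_derivative
           (\<Sum>j\<in>set js. of_real (c' j) * pd j F p)) (at 0)"
    and "((\<lambda>s. moves js (\<lambda>j. c j s) p) \<longlongrightarrow> p) (nhds 0)" by auto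
qed


text \<open>
  A curve that keeps the coordinates of order above \<open>k\<close> fixed is reached from its starting point by
  moving along each of the finitely many directions in turn.
\<close>

lemma has_vector_derivative_curve:
  assumes S: "open S" "q a \<in> S" and F: "C_on (Suc 0) k F S"
    and q: "\<And>j. j \<in> dirs k \<Longrightarrow> ((\<lambda>s. real_coord j (q s)) has_real_derivative c' j) (at a)"
    and above: "\<And>s r. r > k \<Longrightarrow> snd (q s) r = snd (q a) r"
  shows "((\<lambda>s. F (q s)) has_vector_derivative (\<Sum>j\<in>dirs k. of_real (c' j) * pd j F (q a))) (at a)"
proof -
  obtain js :: "'a dir list" where js: "set js = dirs k" "distinct js"
    using finite_distinct_list[OF finite_dirs] by metis
  define c where "c j s = real_coord j (q (a + s)) - real_coord j (q a)" for j s
  have c': "(c j has_real_derivative c' j) (at 0)" if "j \<in> set js" for j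
    using q[of j] that DERIV_at_within_shift[of _ _ a 0 UNIV] unfolding c_def
    by (auto intro!: derivative_eq_intros simp: js(1))
  have eq: "moves js (\<lambda>j. c j s) (q a) = q (a + s)" for s
  proof (rule coords_eqI)
    show "real_coord l (moves js (\<lambda>j. c j s) (q a)) = real_coord l (q (a + s))" if "l \<in> dirs k" for l
      using real_coord_moves[OF js(2) _ that] js(1) that by (simp add: c_def)
    show "snd (moves js (\<lambda>j. c j s) (q a)) r = snd (q (a + s)) r" if "r > k" for r
      using snd_moves_above[OF _ that, of js] js(1) above[OF that, of "a + s"] by simp
  qed
  have c0: "c j 0 = 0" for j by (simp add: c_def)
  have sub: "set js \<subseteq> dirs k" by (simp add: js(1))
  note moves = has_vector_derivative_moves[where c = c and c' = c', OF S F js(2) sub c' c0]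
  show ?thesis
    unfolding has_vector_derivative_at_shift[of _ _ a] using moves(1) by (simp add: eq js(1))
qed

text \<open>Functions on the \<open>k\<close>-th extension, written in coordinates, ignore the coordinates of higher order.\<close>

definition depends_upto :: "nat \<Rightarrow> ('m::finite coords \<Rightarrow> 'c) \<Rightarrow> bool" where
  "depends_upto k F \<longleftrightarrow> (\<forall>p q. fst p = fst q \<longrightarrow> (\<forall>r\<le>k. snd p r = snd q r) \<longrightarrow> F p = F q)"

lemma depends_uptoD:
  "depends_upto k F \<Longrightarrow> fst p = fst q \<Longrightarrow> (\<And>r. r \<le> k \<Longrightarrow> snd p r = snd q r) \<Longrightarrow> F p = F q"
  unfolding depends_upto_def by blast

lemma fst_move_eq: "fst p = fst q \<Longrightarrow> fst (move j p s) = fst (move j q s)"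
  by (cases j) (auto simp: coord_line_def split: prod.splits)

lemma snd_move_eq: "snd p r = snd q r \<Longrightarrow> snd (move j p s) r = snd (move j q s) r"
  by (cases j) (auto simp: coord_line_def split: prod.splits)

lemma depends_upto_pd: 
  assumes "depends_upto k F" shows "depends_upto k (pd j F)"
  unfolding depends_upto_def
proof (intro allI impI)
  fix p q :: "'a coords" assume "fst p = fst q" "\<forall>r\<le>k. snd p r = snd q r"
  then have "F (move j p s) = F (move j q s)" for s
    by (intro depends_uptoD[OF assms] fst_move_eq snd_move_eq) auto
  then show "pd j F p = pd j F q" by (simp add: pd_def)
qed

lemma move_above:
  assumes "depends_upto k F" "j \<in> dirs k'" "j \<notin> dirs k"
  shows "F (move j p s) = F p"
  by (rule depends_uptoD[OF assms(1)]) (use assms(2,3) in \<open>auto simp: dirs_def coord_line_def split: prod.splits\<close>)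

text \<open>Derivatives in the ignored directions are zero.\<close>

lemma C_on_more_dirs:
  assumes "open S" "depends_upto k F" "C_on n k F S"
  shows "C_on n k' F S"
  using assms(2,3)
proof (induction n arbitrary: F)
  case (Suc n)
  show ?case
  proof (rule C_on_SucI[where G = "\<lambda>j. if j \<in> dirs k then pd j F else (\<lambda>_. 0)"])
    fix p and j :: "'a dir" assume *: "p \<in> S" "j \<in> dirs k'"
    show "((\<lambda>s. F (move j p s)) has_vector_derivative (if j \<in> dirs k then pd j F else (\<lambda>_. 0)) p) (at 0)"
      using pd_works[OF Suc.prems(2) _ *(1)] move_above[OF Suc.prems(1) *(2)] by auto
  next
    fix j :: "'a dir"
    show "C_on n k' (if j \<in> dirs k then pd j F else (\<lambda>_. 0)) S"
      using Suc.IH[OF depends_upto_pd[OF Suc.prems(1)]] C_on_pd[OF Suc.prems(2)] by auto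
  next
    show "continuous_on S F" by (rule C_on_imp_continuous_on[OF Suc.prems(2)])
  qed (rule assms(1))
qed auto

text \<open>
  Smoothness in the coordinates of all orders at once, which keeps the order out of the calculus.
  For functions that ignore high orders nothing is added.
\<close>

definition jet_smooth :: "'m::finite coords set \<Rightarrow> ('m coords \<Rightarrow> complex) \<Rightarrow> bool" where
  "jet_smooth S F \<longleftrightarrow> (\<forall>k. smooth_coords_on k F S)"

lemma jet_smoothD: "jet_smooth S F \<Longrightarrow> C_on n k F S"
  by (simp add: jet_smooth_def smooth_coords_on_def)

lemma jet_smoothI: "(\<And>n k. C_on n k F S) \<Longrightarrow> jet_smooth S F"
  by (simp add: jet_smooth_def smooth_coords_on_def)

lemma jet_smooth_iff:
  "open S \<Longrightarrow> depends_upto k F \<Longrightarrow> jet_smooth S F \<longleftrightarrow> smooth_coords_on k F S"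
  unfolding jet_smooth_def smooth_coords_on_def using C_on_more_dirs by blast

lemma jet_smooth_cong: "open S \<Longrightarrow> (\<And>p. p \<in> S \<Longrightarrow> F p = G p) \<Longrightarrow> jet_smooth S F \<Longrightarrow> jet_smooth S G"
  by (rule jet_smoothI, rule C_on_cong[of S F]) (simp_all add: jet_smoothD)

lemma jet_smooth_subset: "jet_smooth S F \<Longrightarrow> T \<subseteq> S \<Longrightarrow> jet_smooth T F"
  by (rule jet_smoothI, rule C_on_subset) (auto intro: jet_smoothD)

lemma jet_smooth_Union: "(\<And>S. S \<in> \<S> \<Longrightarrow> open S \<and> jet_smooth S F) \<Longrightarrow> jet_smooth (\<Union>\<S>) F"
  by (rule jet_smoothI, rule C_on_Union) (auto intro: jet_smoothD)

lemma jet_smooth_const: "jet_smooth S (\<lambda>_. c)"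
  by (rule jet_smoothI) simp

lemma jet_smooth_add:
  "open S \<Longrightarrow> jet_smooth S F \<Longrightarrow> jet_smooth S G \<Longrightarrow> jet_smooth S (\<lambda>p. F p + G p)"
  by (rule jet_smoothI, rule C_on_add) (auto intro: jet_smoothD)

lemma jet_smooth_mult:
  "open S \<Longrightarrow> jet_smooth S F \<Longrightarrow> jet_smooth S G \<Longrightarrow> jet_smooth S (\<lambda>p. F p * G p)"
  by (rule jet_smoothI, rule C_on_mult) (auto intro: jet_smoothD)

lemma jet_smooth_cnj: "open S \<Longrightarrow> jet_smooth S F \<Longrightarrow> jet_smooth S (\<lambda>p. cnj (F p))"
  by (rule jet_smoothI, rule C_on_cnj) (auto intro: jet_smoothD)

lemma jet_smooth_sum:
  "open S \<Longrightarrow> (\<And>i. i \<in> I \<Longrightarrow> jet_smooth S (F i)) \<Longrightarrow> jet_smooth S (\<lambda>p. \<Sum>i\<in>I. F i p)"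
proof (induction I rule: infinite_finite_induct)
  case (insert i I)
  then have "jet_smooth S (\<lambda>p. F i p + (\<Sum>i\<in>I. F i p))" by (intro jet_smooth_add) auto
  then show ?case using insert.hyps by simp
qed (auto intro: jet_smooth_const)

lemma jet_smooth_power: "open S \<Longrightarrow> jet_smooth S F \<Longrightarrow> jet_smooth S (\<lambda>p. F p ^ n)"
  by (induction n) (auto intro: jet_smooth_mult jet_smooth_const)

lemma jet_smooth_pd:
  assumes "jet_smooth S F" "j \<in> dirs k" shows "jet_smooth S (pd j F)"
proof (rule jet_smoothI)
  fix n k'
  have "C_on n (max k k') (pd j F) S"
    using C_on_pd[OF jet_smoothD[OF assms(1), of "Suc n" "max k k'"]] dirs_mono[of k "max k k'"] assms(2)
    by auto
  then show "C_on n k' (pd j F) S" by (rule C_on_fewer_dirs) simp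
qed

lemma jet_smooth_pd_works:
  assumes "jet_smooth S F" "j \<in> dirs k" "p \<in> S"
  shows "((\<lambda>s. F (move j p s)) has_vector_derivative pd j F p) (at 0)"
  by (rule pd_works[OF jet_smoothD[OF assms(1)] assms(2,3)])

lemma jet_smooth_continuous: "jet_smooth S F \<Longrightarrow> continuous_on S F"
  using jet_smoothD[of S F 0 0] by simp

subsection \<open>Derivatives in the complex coordinates\<close>

text \<open>
  The triple \<open>(r, i, e)\<close> stands for \<open>z\<^sup>r\<^sup>i\<close> if \<open>e\<close> is false, and for its conjugate if \<open>e\<close> is true. A pair
  \<open>(i, e)\<close> stands for a coordinate of order 0.
\<close>

type_synonym 'm cdir = "nat \<times> 'm \<times> bool"

definition cdirs :: "nat \<Rightarrow> 'm::finite cdir set" where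
  "cdirs k = {..k} \<times> UNIV \<times> UNIV"

definition coordinate :: "'m::finite cdir \<Rightarrow> 'm coords \<Rightarrow> complex" where
  "coordinate l p = (case l of (r, i, e) \<Rightarrow> if e then cnj (snd p r $ i) else snd p r $ i)"

definition wirtinger :: "'m::finite cdir \<Rightarrow> ('m coords \<Rightarrow> complex) \<Rightarrow> 'm coords \<Rightarrow> complex" where
  "wirtinger l F = (case l of (r, i, e) \<Rightarrow> if e then d_zbar r i F else d_z r i F)"

lemma finite_cdirs [simp]: "finite (cdirs k)"
  by (simp add: cdirs_def)

lemma cdirs_mono: "k \<le> k' \<Longrightarrow> cdirs k \<subseteq> cdirs k'"
  by (auto simp: cdirs_def)

lemma mem_cdirs [simp]: "(r, i, e) \<in> cdirs k \<longleftrightarrow> r \<le> k"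
  by (simp add: cdirs_def)

lemma sum_cdirs: "(\<Sum>l\<in>cdirs k. f l) = (\<Sum>r\<le>k. \<Sum>i\<in>UNIV. f (r, i, False) + f (r, i, True))"
  by (simp add: cdirs_def sum.cartesian_product' UNIV_bool add.commute)

lemma wirtinger_eq:
  "wirtinger (r, i, e) F p = (pd (Some (r, i, 1)) F p + (if e then \<i> else - \<i>) * pd (Some (r, i, \<i>)) F p) / 2"
  by (simp add: wirtinger_def d_z_def d_zbar_def d_dir_eq)

lemma in_dirs [simp]: "None \<in> dirs k" "Some (r, i, h) \<in> dirs k \<longleftrightarrow> r \<le> k \<and> h \<in> {1, \<i>}"
  by (auto simp: dirs_def)

lemma pd_eqI: "((\<lambda>s. F (move j p s)) has_vector_derivative D) (at 0) \<Longrightarrow> pd j F p = D"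
  by (simp add: pd_def vector_derivative_at)

lemma pd_const [simp]: "pd j (\<lambda>_. c) p = 0"
  by (simp add: pd_def)

context
  fixes S :: "'m::finite coords set" and p :: "'m coords" and k :: nat and j :: "'m dir"
  assumes p: "p \<in> S" and j: "j \<in> dirs k"
begin

lemma pd_add:
  assumes "jet_smooth S F" "jet_smooth S G"
  shows "pd j (\<lambda>p. F p + G p) p = pd j F p + pd j G p"
  by (intro pd_eqI has_vector_derivative_add assms[THEN jet_smooth_pd_works[OF _ j p]])

lemma pd_mult:
  assumes "jet_smooth S F" "jet_smooth S G"
  shows "pd j (\<lambda>p. F p * G p) p = F p * pd j G p + pd j F p * G p"
  using has_vector_derivative_mult[OF assms[THEN jet_smooth_pd_works[OF _ j p]]]
  by (intro pd_eqI) simp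

end

lemma has_vector_derivative_coordinate_move:
  "((\<lambda>s. coordinate (r, i, e) (move j p s)) has_vector_derivative (case j of None \<Rightarrow> 0
     | Some (r', i', h) \<Rightarrow> of_bool (r = r' \<and> i = i') * (if e then cnj h else h))) (at 0)"
proof (cases j)
  case None
  then show ?thesis by (cases e) (simp_all add: coordinate_def)
next
  case (Some a)
  obtain r' i' h where a: "a = (r', i', h)" by (cases a) auto
  define c where "c = of_bool (r = r' \<and> i = i') * (if e then cnj h else h)"
  have "coordinate (r, i, e) (move j p s) = coordinate (r, i, e) p + of_real s * c" for s
    by (cases p) (auto simp: coordinate_def Some a coord_line_def axis_def c_def)
  moreover have "((\<lambda>s. coordinate (r, i, e) p + of_real s * c) has_vector_derivative c) (at 0)"
    using has_vector_derivative_add[OF has_vector_derivative_const[of "coordinate (r, i, e) p"]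
        has_vector_derivative_scaleR[OF DERIV_ident has_vector_derivative_const[of c]]]
    by (simp add: scaleR_conv_of_real)
  ultimately show ?thesis by (simp add: Some a c_def)
qed

lemmas pd_coordinate = has_vector_derivative_coordinate_move[THEN pd_eqI]

lemma continuous_on_coordinate: "continuous_on S (coordinate l)"
proof -
  have "continuous_on S (\<lambda>p. snd p r $ i)" for r i
    by (intro continuous_on_component continuous_on_snd_apply continuous_on_id)
  then show ?thesis
    by (cases l) (auto simp: coordinate_def[abs_def] intro: continuous_on_cnj continuous_on_If_const)
qed

lemma jet_smooth_coordinate: 
  assumes "open S" shows "jet_smooth S (coordinate l)"
proof (rule jet_smoothI)
  fix n k
  show "C_on n k (coordinate l) S"
  proof (cases n)
    case (Suc m)
    obtain r i e where l: "l = (r, i, e)" by (cases l)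
    show ?thesis unfolding Suc l
      by (rule C_on_SucI[OF assms continuous_on_coordinate has_vector_derivative_coordinate_move]) simp
  qed (simp add: continuous_on_coordinate)
qed

lemma wirtinger_const [simp]: "wirtinger l (\<lambda>_. c) p = 0"
  by (cases l) (simp add: wirtinger_eq)

lemma wirtinger_coordinate: "wirtinger l (coordinate m) p = of_bool (l = m)"
  by (cases l; cases m) (auto simp: wirtinger_eq pd_coordinate)

lemma wirtinger_cong: "open S \<Longrightarrow> p \<in> S \<Longrightarrow> (\<And>q. q \<in> S \<Longrightarrow> F q = G q) \<Longrightarrow> wirtinger l F p = wirtinger l G p"
  using pd_cong[of S p F G] by (cases l) (simp add: wirtinger_eq)

context
  fixes S :: "'m::finite coords set" and p :: "'m coords"
  assumes p: "p \<in> S"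
begin

lemma wirtinger_add:
  assumes "jet_smooth S F" "jet_smooth S G"
  shows "wirtinger l (\<lambda>p. F p + G p) p = wirtinger l F p + wirtinger l G p"
proof -
  obtain r i e where l: "l = (r, i, e)" by (cases l)
  show ?thesis unfolding l wirtinger_eq
    by (simp add: pd_add[OF p _ assms, of _ r] field_simps)
qed

lemma wirtinger_mult:
  assumes "jet_smooth S F" "jet_smooth S G"
  shows "wirtinger l (\<lambda>p. F p * G p) p = F p * wirtinger l G p + wirtinger l F p * G p"
proof -
  obtain r i e where l: "l = (r, i, e)" by (cases l)
  show ?thesis unfolding l wirtinger_eq
    by (simp add: pd_mult[OF p _ assms, of _ r] field_simps)
qed

lemma wirtinger_sum:
  assumes "open S" "\<And>i. i \<in> I \<Longrightarrow> jet_smooth S (F i)"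
  shows "wirtinger l (\<lambda>p. \<Sum>i\<in>I. F i p) p = (\<Sum>i\<in>I. wirtinger l (F i) p)"
  using assms(2)
proof (induction I rule: infinite_finite_induct)
  case (insert i I)
  have "wirtinger l (\<lambda>p. F i p + (\<Sum>i\<in>I. F i p)) p = wirtinger l (F i) p + (\<Sum>i\<in>I. wirtinger l (F i) p)"
    using insert by (subst wirtinger_add) (auto intro: jet_smooth_sum assms(1))
  then show ?case using insert.hyps by simp
qed auto

end

lemma wirtinger_power:
  assumes "open S" "p \<in> S" "jet_smooth S F"
  shows "wirtinger l (\<lambda>p. F p ^ n) p = of_nat n * F p ^ (n - 1) * wirtinger l F p"
proof (induction n)
  case (Suc n)
  have "F p * (of_nat n * F p ^ (n - 1) * wirtinger l F p) = of_nat n * F p ^ n * wirtinger l F p"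
    by (cases n) auto
  then show ?case
    using wirtinger_mult[OF assms(2,3) jet_smooth_power[OF assms(1,3)], of l n] Suc by (simp add: algebra_simps)
qed simp

lemma jet_smooth_coordinate_diff: "open S \<Longrightarrow> jet_smooth S (\<lambda>q. coordinate m q - a)"
  using jet_smooth_add[OF _ jet_smooth_coordinate jet_smooth_const, of S m "- a"] by simp

lemma wirtinger_coordinate_diff: "wirtinger l (\<lambda>q. coordinate m q - a) p = of_bool (l = m)"
proof -
  have "wirtinger l (\<lambda>q. coordinate m q + - a) p = of_bool (l = m)"
    by (subst wirtinger_add[OF UNIV_I jet_smooth_coordinate[OF open_UNIV] jet_smooth_const]) (simp add: wirtinger_coordinate)
  then show ?thesis by simp
qed

lemma jet_smooth_d_time: "jet_smooth S F \<Longrightarrow> jet_smooth S (d_time F)"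
  unfolding d_time_eq by (rule jet_smooth_pd[of _ _ _ 0]) auto

lemma jet_smooth_wirtinger:
  assumes "open S" "jet_smooth S F" shows "jet_smooth S (wirtinger l F)"
proof -
  obtain r i e where l: "l = (r, i, e)" by (cases l)
  have "wirtinger l F = (\<lambda>p. (1 / 2) * (pd (Some (r, i, 1)) F p + (if e then \<i> else - \<i>) * pd (Some (r, i, \<i>)) F p))"
    by (rule ext) (simp add: l wirtinger_eq)
  moreover have "jet_smooth S \<dots>"
    by (intro jet_smooth_mult jet_smooth_add jet_smooth_const assms jet_smooth_pd[OF assms(2), of _ r]) auto
  ultimately show ?thesis by simp
qed

lemma depends_upto_d_time: "depends_upto k F \<Longrightarrow> depends_upto k (d_time F)"
  unfolding d_time_eq by (rule depends_upto_pd)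

lemma depends_upto_wirtinger: 
  assumes "depends_upto k F" shows "depends_upto k (wirtinger l F)"
proof -
  obtain r i e where l: "l = (r, i, e)" by (cases l)
  show ?thesis
    unfolding depends_upto_def l wirtinger_eq
    by (intro allI impI, subst (1 2) depends_uptoD[OF depends_upto_pd[OF assms]]) auto
qed

text \<open>This is the chain rule for real directions, rewritten with \<open>x' \<partial>/\<partial>x + y' \<partial>/\<partial>y = z' \<partial>/\<partial>z + zbar' \<partial>/\<partial>zbar\<close>.\<close>

lemma has_vector_derivative_chain:
  assumes S: "open S" "q a \<in> S" and F: "depends_upto k F" "jet_smooth S F"
    and z': "\<And>l. l \<in> cdirs k \<Longrightarrow> ((\<lambda>s. coordinate l (q s)) has_vector_derivative z' l) (at a)"
    and t': "((\<lambda>s. fst (q s)) has_real_derivative t') (at a)"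
  shows "((\<lambda>s. F (q s)) has_vector_derivative
           (of_real t' * d_time F (q a) + (\<Sum>l\<in>cdirs k. z' l * wirtinger l F (q a)))) (at a)"
proof -
  define c :: "'a dir \<Rightarrow> real" where "c j = (case j of None \<Rightarrow> t'
    | Some (r, i, h) \<Rightarrow> if h = 1 then Re (z' (r, i, False)) else Im (z' (r, i, False)))" for j
  \<comment> \<open>Freezing the orders above \<open>k\<close> does not change \<open>F\<close> along the curve.\<close>
  define q' where "q' s = (fst (q s), \<lambda>r. if r \<le> k then snd (q s) r else snd (q a) r)" for s
  have q'a: "q' a = q a" by (auto simp: q'_def)
  have eq: "F (q s) = F (q' s)" for s
    by (rule depends_uptoD[OF F(1)]) (auto simp: q'_def)
  have cnj_z': "z' (r, i, True) = cnj (z' (r, i, False))" if "r \<le> k" for r i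
    using has_vector_derivative_cnj[OF z'[of "(r, i, False)"]] z'[of "(r, i, True)"] that
    by (auto simp: coordinate_def intro: vector_derivative_unique_at)
  have "((\<lambda>s. real_coord j (q' s)) has_real_derivative c j) (at a)" if "j \<in> dirs k" for j
  proof (cases j)
    case None
    then show ?thesis using t' by (simp add: real_coord_def c_def q'_def)
  next
    case (Some b)
    obtain r i h where b: "b = (r, i, h)" by (cases b) auto
    have r: "r \<le> k" using that by (simp add: Some b)
    have "((\<lambda>s. snd (q s) r $ i) has_vector_derivative z' (r, i, False)) (at a)"
      using z'[of "(r, i, False)"] r by (simp add: coordinate_def)
    from bounded_linear.has_vector_derivative[OF bounded_linear_Re this]
      bounded_linear.has_vector_derivative[OF bounded_linear_Im this]
    show ?thesis using r
      by (simp add: Some b real_coord_def c_def q'_def has_real_derivative_iff_has_vector_derivative)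
  qed
  then have "((\<lambda>s. F (q' s)) has_vector_derivative (\<Sum>j\<in>dirs k. of_real (c j) * pd j F (q a))) (at a)"
    using has_vector_derivative_curve[OF S(1), of q' a k F c] S(2) jet_smoothD[OF F(2)] 
    by (simp add: q'a) (simp add: q'_def)
  moreover have "(\<Sum>j\<in>dirs k. of_real (c j) * pd j F (q a)) =
      of_real t' * d_time F (q a) + (\<Sum>l\<in>cdirs k. z' l * wirtinger l F (q a))"
  proof -
    have "(\<Sum>j\<in>dirs k. f j) = f None + (\<Sum>r\<le>k. \<Sum>i\<in>UNIV. f (Some (r, i, 1)) + f (Some (r, i, \<i>)))" for f :: "'a dir \<Rightarrow> complex"
      unfolding dirs_def
      by (subst sum.insert, simp, force, subst sum.reindex) (auto simp: sum.cartesian_product')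
    moreover have "of_real (Re z) * u + of_real (Im z) * v = z * ((u + - \<i> * v) / 2) + cnj z * ((u + \<i> * v) / 2)" for z u v
      by (simp add: complex_eq_iff field_simps)
    ultimately show ?thesis
      by (auto simp: sum_cdirs wirtinger_eq c_def d_time_eq cnj_z' intro!: sum.cong)
  qed
  ultimately show ?thesis by (simp add: eq)
qed


text \<open>
  Composition with a map \<open>T\<close> that preserves time. Only the coordinates of \<open>T\<close> up to order \<open>k\<close> have to be
  smooth, because the outer function ignores the others.
\<close>

context
  fixes S S' :: "'m::finite coords set" and T :: "'m coords \<Rightarrow> 'm coords" and k :: nat
  assumes S: "open S" "open S'" and T: "\<And>p. p \<in> S \<Longrightarrow> T p \<in> S'" "\<And>p. fst (T p) = fst p"
    and coordinate_T: "\<And>l. l \<in> cdirs k \<Longrightarrow> jet_smooth S (\<lambda>p. coordinate l (T p))"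
begin

lemma has_vector_derivative_compose:
  assumes F: "depends_upto k F" "jet_smooth S' F" and p: "p \<in> S" and j: "j \<in> dirs n"
  shows "((\<lambda>s. F (T (move j p s))) has_vector_derivative
     (of_bool (j = None) * d_time F (T p) + (\<Sum>l\<in>cdirs k. pd j (\<lambda>p. coordinate l (T p)) p * wirtinger l F (T p)))) (at 0)"
proof -
  have "((\<lambda>s. fst (T (move j p s))) has_real_derivative of_bool (j = None)) (at 0)"
    by (cases j) (auto simp: T(2) coord_line_def intro!: derivative_eq_intros split: prod.splits)
  from has_vector_derivative_chain[where q = "\<lambda>s. T (move j p s)" and a = 0, OF S(2) _ F _ this,
      where z' = "\<lambda>l. pd j (\<lambda>p. coordinate l (T p)) p"] jet_smooth_pd_works[OF coordinate_T j p] T(1)[OF p]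
  show ?thesis by (cases j) (simp_all del: move.simps)
qed

lemma wirtinger_compose:
  assumes F: "depends_upto k F" "jet_smooth S' F" and p: "p \<in> S"
  shows "wirtinger m (\<lambda>p. F (T p)) p = (\<Sum>l\<in>cdirs k. wirtinger m (\<lambda>p. coordinate l (T p)) p * wirtinger l F (T p))"
proof -
  obtain r i e where m: "m = (r, i, e)" by (cases m)
  have "pd (Some (r, i, h)) (\<lambda>p. F (T p)) p = (\<Sum>l\<in>cdirs k. pd (Some (r, i, h)) (\<lambda>p. coordinate l (T p)) p * wirtinger l F (T p))"
    if "h \<in> {1, \<i>}" for h
    using has_vector_derivative_compose[OF F p, of "Some (r, i, h)" r] that by (intro pd_eqI) simp
  then show ?thesis
    by (simp add: m wirtinger_eq sum_distrib_left sum_divide_distrib flip: sum.distrib)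
       (simp add: field_simps)
qed

lemma d_time_compose:
  assumes F: "depends_upto k F" "jet_smooth S' F" and p: "p \<in> S"
  shows "d_time (\<lambda>p. F (T p)) p = d_time F (T p) + (\<Sum>l\<in>cdirs k. d_time (\<lambda>p. coordinate l (T p)) p * wirtinger l F (T p))"
  using has_vector_derivative_compose[OF F p, of None 0] unfolding d_time_eq
  by (intro pd_eqI) simp

lemma jet_smooth_compose:
  assumes "continuous_on S T" "depends_upto k F" "jet_smooth S' F"
  shows "jet_smooth S (\<lambda>p. F (T p))"
proof (rule jet_smoothI)
  have sub: "T ` S \<subseteq> S'" using T(1) by (rule image_subsetI)
  have sum: "C_on n k' (\<lambda>p. \<Sum>i\<in>I. G i p) S" if "\<And>i. i \<in> I \<Longrightarrow> C_on n k' (G i) S" "finite I" for I n k' and G :: "_ \<Rightarrow> _ \<Rightarrow> complex"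
    using that(2,1) by (induction I rule: finite_induct) (auto intro: C_on_add S(1))
  fix n k'
  show "C_on n k' (\<lambda>p. F (T p)) S"
    using assms(2,3)
  proof (induction n arbitrary: F)
    case 0
    show ?case by (simp add: continuous_on_compose2[OF jet_smooth_continuous[OF 0(2)] assms(1) sub])
  next
    case (Suc n)
    have IH: "C_on n k' (\<lambda>p. d_time F (T p)) S" "C_on n k' (\<lambda>p. wirtinger l F (T p)) S" for l
      using Suc by (auto intro: Suc.IH depends_upto_wirtinger depends_upto_d_time jet_smooth_wirtinger jet_smooth_d_time S(2))
    show ?case
    proof (rule C_on_SucI[OF S(1) _ has_vector_derivative_compose[OF Suc.prems]])
      show "continuous_on S (\<lambda>p. F (T p))"
        by (rule continuous_on_compose2[OF jet_smooth_continuous[OF Suc.prems(2)] assms(1) sub])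
    next
      fix j :: "'m dir" assume j: "j \<in> dirs k'"
      show "C_on n k' (\<lambda>p. of_bool (j = None) * d_time F (T p)
          + (\<Sum>l\<in>cdirs k. pd j (\<lambda>p. coordinate l (T p)) p * wirtinger l F (T p))) S"
        by (intro C_on_add C_on_mult sum S(1) C_on_const IH finite_cdirs jet_smoothD jet_smooth_pd[OF coordinate_T j])
    qed
  qed
qed

end

text \<open>
  The second difference of \<open>f\<close> over a square of side \<open>x\<close> is \<open>x\<^sup>2\<close> times each of the mixed derivatives at
  some point of the square, by two applications of the mean value theorem in either order.
\<close>

lemma mixed_partials_eq:
  fixes f fa fb fab fba :: "real \<Rightarrow> real \<Rightarrow> real" and \<delta> :: real
  assumes d: "\<delta> > 0"
    and fa: "\<And>a b. \<bar>a\<bar> < \<delta> \<Longrightarrow> \<bar>b\<bar> < \<delta> \<Longrightarrow> ((\<lambda>a. f a b) has_real_derivative fa a b) (at a)"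
    and fb: "\<And>a b. \<bar>a\<bar> < \<delta> \<Longrightarrow> \<bar>b\<bar> < \<delta> \<Longrightarrow> ((\<lambda>b. f a b) has_real_derivative fb a b) (at b)"
    and fab: "\<And>a b. \<bar>a\<bar> < \<delta> \<Longrightarrow> \<bar>b\<bar> < \<delta> \<Longrightarrow> ((\<lambda>b. fa a b) has_real_derivative fab a b) (at b)"
    and fba: "\<And>a b. \<bar>a\<bar> < \<delta> \<Longrightarrow> \<bar>b\<bar> < \<delta> \<Longrightarrow> ((\<lambda>a. fb a b) has_real_derivative fba a b) (at a)"
    and cont: "((\<lambda>z. fab (fst z) (snd z)) \<longlongrightarrow> fab 0 0) (nhds (0, 0))"
      "((\<lambda>z. fba (fst z) (snd z)) \<longlongrightarrow> fba 0 0) (nhds (0, 0))"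
  shows "fab 0 0 = fba 0 0"
proof (rule ccontr)
  assume "fab 0 0 \<noteq> fba 0 0"
  define e where "e = \<bar>fab 0 0 - fba 0 0\<bar> / 2"
  have e: "e > 0" using \<open>fab 0 0 \<noteq> fba 0 0\<close> by (simp add: e_def)
  have "\<forall>\<^sub>F z in nhds (0, 0). dist (fab (fst z) (snd z)) (fab 0 0) < e \<and> dist (fba (fst z) (snd z)) (fba 0 0) < e"
    using tendstoD[OF cont(1) e] tendstoD[OF cont(2) e] by eventually_elim simp
  then obtain h where h: "h > 0" "\<And>z. dist z (0, 0) < h \<Longrightarrow> 
      dist (fab (fst z) (snd z)) (fab 0 0) < e \<and> dist (fba (fst z) (snd z)) (fba 0 0) < e"
    unfolding eventually_nhds_metric by blast
  define x where "x = min \<delta> h / 2"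
  have x: "0 < x" "x < \<delta>" "2 * x \<le> h" using d h(1) by (auto simp: x_def)
  have "\<exists>y>0. y < x \<and> (f x x - f x 0) - (f 0 x - f 0 0) = (x - 0) * (fa y x - fa y 0)"
    using x by (intro MVT2[of 0 x "\<lambda>a. f a x - f a 0"] DERIV_diff fa) auto
  then obtain y where y: "0 < y" "y < x" "(f x x - f x 0) - (f 0 x - f 0 0) = x * (fa y x - fa y 0)" by auto
  have "\<exists>z>0. z < x \<and> fa y x - fa y 0 = (x - 0) * fab y z"
    using x y by (intro MVT2[of 0 x "\<lambda>b. fa y b"] fab) auto
  then obtain z where z: "0 < z" "z < x" "fa y x - fa y 0 = x * fab y z" by auto
  have "\<exists>y>0. y < x \<and> (f x x - f 0 x) - (f x 0 - f 0 0) = (x - 0) * (fb x y - fb 0 y)"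
    using x by (intro MVT2[of 0 x "\<lambda>b. f x b - f 0 b"] DERIV_diff fb) auto
  then obtain v where v: "0 < v" "v < x" "(f x x - f 0 x) - (f x 0 - f 0 0) = x * (fb x v - fb 0 v)" by auto
  have "\<exists>z>0. z < x \<and> fb x v - fb 0 v = (x - 0) * fba z v"
    using x v by (intro MVT2[of 0 x "\<lambda>a. fb a v"] fba) auto
  then obtain u where u: "0 < u" "u < x" "fb x v - fb 0 v = x * fba u v" by auto
  have "x * (x * fab y z) = x * (x * fba u v)" using y(3)[unfolded z(3)] v(3)[unfolded u(3)] by linarith
  then have "fab y z = fba u v" using x(1) by simp
  moreover have near: "dist (a, b) (0, 0) < h" if "0 < a" "a < x" "0 < b" "b < x" for a b :: real
    using dist_Pair_Pair[of a b 0 0] sqrt_sum_squares_le_sum_abs[of a b] that x(3) by (simp add: dist_real_def)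
  ultimately have "\<bar>fab y z - fab 0 0\<bar> < e" "\<bar>fab y z - fba 0 0\<bar> < e"
    using h(2)[OF near[OF y(1,2) z(1,2)]] h(2)[OF near[OF u(1,2) v(1,2)]] by (simp_all add: dist_real_def)
  moreover have "\<bar>fab 0 0 - fba 0 0\<bar> \<le> \<bar>fab y z - fab 0 0\<bar> + \<bar>fab y z - fba 0 0\<bar>"
    by (metis abs_minus_commute abs_triangle_ineq diff_add_cancel add_diff_eq)
  ultimately show False unfolding e_def by argo
qed

lemma fst_move: "fst (move j p s) = fst p + (if j = None then s else 0)"
  by (cases j) (auto simp: coord_line_def split: prod.splits)

lemma snd_move: "snd (move j p s) r = snd p r + (case j of None \<Rightarrow> 0
    | Some (r', i, h) \<Rightarrow> if r = r' then axis i (of_real s * h) else 0)"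
  by (cases j) (auto simp: coord_line_def split: prod.splits)

lemma move_commute: "move i (move j p a) b = move j (move i p b) a"
  by (simp add: prod_eq_iff fun_eq_iff fst_move snd_move algebra_simps)

lemma pd_commute:
  assumes S: "open S" "p \<in> S" and F: "jet_smooth S F" and i: "i \<in> dirs k" and j: "j \<in> dirs k"
  shows "pd j (pd i F) p = pd i (pd j F) p"
proof -
  define P where "P a b = move j (move i p a) b" for a b
  have P00: "P 0 0 = p" by (simp add: P_def)
  have lim: "((\<lambda>z. P (fst z) (snd z)) \<longlongrightarrow> p) (nhds (0, 0))"
  proof -
    have "((\<lambda>z. move i p (fst z)) \<longlongrightarrow> p) (nhds ((0::real), 0::real))"
      using tendsto_move[where f = "\<lambda>_. p" and p = p and j = i and s = 0, OF tendsto_const]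
        tendsto_fst[OF filterlim_ident, of "(0::real, 0::real)"] by simp
    from tendsto_move[OF this tendsto_snd[OF filterlim_ident], of j] show ?thesis by (simp add: P_def)
  qed
  then obtain d where d: "d > 0" "\<And>z. dist z (0, 0) < d \<Longrightarrow> P (fst z) (snd z) \<in> S"
    using topological_tendstoD[OF lim S] unfolding eventually_nhds_metric by blast
  have in_S: "P a b \<in> S" if "\<bar>a\<bar> < d / 2" "\<bar>b\<bar> < d / 2" for a b
    using d(2)[of "(a, b)"] dist_Pair_Pair[of a b 0 0] sqrt_sum_squares_le_sum_abs[of a b] that
    by (simp add: dist_real_def)
  have Pb: "((\<lambda>b. G (P a b)) has_vector_derivative pd j G (P a b)) (at b)"
    if "jet_smooth S G" "\<bar>a\<bar> < d / 2" "\<bar>b\<bar> < d / 2" for G a b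
    using jet_smooth_pd_works[OF that(1) j in_S[OF that(2,3)]]
    unfolding P_def by (subst has_vector_derivative_along_at_0_iff) simp
  have Pa: "((\<lambda>a. G (P a b)) has_vector_derivative pd i G (P a b)) (at a)"
    if "jet_smooth S G" "\<bar>a\<bar> < d / 2" "\<bar>b\<bar> < d / 2" for G a b
    using jet_smooth_pd_works[OF that(1) i in_S[OF that(2,3)]]
    unfolding P_def move_commute[of j] by (subst has_vector_derivative_along_at_0_iff) simp
  have smooth: "jet_smooth S (pd i F)" "jet_smooth S (pd j F)" "jet_smooth S (pd j (pd i F))" "jet_smooth S (pd i (pd j F))"
    using jet_smooth_pd F i j by blast+
  have cont: "((\<lambda>z. G (P (fst z) (snd z))) \<longlongrightarrow> G (P 0 0)) (nhds (0, 0))" if "jet_smooth S G" for G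
    using isCont_tendsto_compose[OF _ lim, of G] jet_smooth_continuous[OF that] S
      continuous_on_eq_continuous_at P00 by auto
  have "\<phi> (pd j (pd i F) p) = \<phi> (pd i (pd j F) p)" if \<phi>: "bounded_linear \<phi>" for \<phi> :: "complex \<Rightarrow> real"
  proof -
    note [intro!] = bounded_linear.has_vector_derivative[OF \<phi>] bounded_linear.tendsto[OF \<phi>] cont smooth
    have "\<phi> (pd j (pd i F) (P 0 0)) = \<phi> (pd i (pd j F) (P 0 0))"
      by (rule mixed_partials_eq[where \<delta> = "d / 2" and f = "\<lambda>a b. \<phi> (F (P a b))"
           and fa = "\<lambda>a b. \<phi> (pd i F (P a b))" and fb = "\<lambda>a b. \<phi> (pd j F (P a b))"
           and fab = "\<lambda>a b. \<phi> (pd j (pd i F) (P a b))" and fba = "\<lambda>a b. \<phi> (pd i (pd j F) (P a b))"])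
         (use d(1) Pa Pb F smooth in \<open>auto simp: has_real_derivative_iff_has_vector_derivative\<close>)
    then show ?thesis by (simp add: P00)
  qed
  from this[OF bounded_linear_Re] this[OF bounded_linear_Im] show ?thesis by (simp add: complex_eq_iff)
qed

lemma wirtinger_commute:
  assumes S: "open S" "p \<in> S" and F: "jet_smooth S F"
  shows "wirtinger m (wirtinger l F) p = wirtinger l (wirtinger m F) p"
proof -
  have pd_wirtinger: "pd j (wirtinger (r, i, e) F) p = 
      (pd j (pd (Some (r, i, 1)) F) p + (if e then \<i> else - \<i>) * pd j (pd (Some (r, i, \<i>)) F) p) / 2"
    if "j \<in> dirs k" for j k r i e
  proof -
    have "jet_smooth S (pd (Some (r, i, h)) F)" if "h \<in> {1, \<i>}" for h
      using that by (intro jet_smooth_pd[OF F, of _ r]) auto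
    then have "((\<lambda>s. pd (Some (r, i, h)) F (move j p s)) has_vector_derivative pd j (pd (Some (r, i, h)) F) p) (at 0)"
      if "h \<in> {1, \<i>}" for h
      using jet_smooth_pd_works[OF _ \<open>j \<in> dirs k\<close> S(2)] that by blast
    then have "((\<lambda>s. (pd (Some (r, i, 1)) F (move j p s) + (if e then \<i> else - \<i>) * pd (Some (r, i, \<i>)) F (move j p s)) / 2)
      has_vector_derivative (pd j (pd (Some (r, i, 1)) F) p + (if e then \<i> else - \<i>) * pd j (pd (Some (r, i, \<i>)) F) p) / 2) (at 0)"
      by (intro has_vector_derivative_divide has_vector_derivative_add has_vector_derivative_mult_right) auto
    then show ?thesis unfolding wirtinger_eq[abs_def] by (intro pd_eqI)
  qed
  obtain r i e r' i' e' where lm: "l = (r, i, e)" "m = (r', i', e')" by (cases l, cases m)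
  have comm: "pd (Some (r', i', h')) (pd (Some (r, i, h)) F) p = pd (Some (r, i, h)) (pd (Some (r', i', h')) F) p"
    if "h \<in> {1, \<i>}" "h' \<in> {1, \<i>}" for h h'
    using pd_commute[OF S F, of "Some (r, i, h)" "max r r'" "Some (r', i', h')"] that by simp
  show ?thesis
    unfolding lm wirtinger_eq[of r' i' e' "wirtinger _ _"] wirtinger_eq[of r i e "wirtinger _ _"]
    by (simp add: pd_wirtinger[of _ r] pd_wirtinger[of _ r'] comm) (simp add: field_simps)
qed

section \<open>The total derivative\<close>

text \<open>Functions of jets alone: unlike \<^const>\<open>depends_upto\<close>, this excludes dependence on time.\<close>

definition jet_function :: "nat \<Rightarrow> ('m::finite coords \<Rightarrow> complex) \<Rightarrow> bool" where
  "jet_function k F \<longleftrightarrow> (\<forall>p q. (\<forall>r\<le>k. snd p r = snd q r) \<longrightarrow> F p = F q)"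

lemma jet_functionD: "jet_function k F \<Longrightarrow> (\<And>r. r \<le> k \<Longrightarrow> snd p r = snd q r) \<Longrightarrow> F p = F q"
  unfolding jet_function_def by blast

lemma jet_function_imp_depends_upto: "jet_function k F \<Longrightarrow> depends_upto k F"
  unfolding jet_function_def depends_upto_def by blast

lemma jet_function_mono: "jet_function k F \<Longrightarrow> k \<le> k' \<Longrightarrow> jet_function k' F"
  unfolding jet_function_def by (meson order_trans)

lemma jet_function_mult: "jet_function k F \<Longrightarrow> jet_function k G \<Longrightarrow> jet_function k (\<lambda>p. F p * G p)"
  unfolding jet_function_def by metis

lemma jet_function_sum: "(\<And>i. i \<in> I \<Longrightarrow> jet_function k (F i)) \<Longrightarrow> jet_function k (\<lambda>p. \<Sum>i\<in>I. F i p)"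
  unfolding jet_function_def by (auto intro: sum.cong)

lemma jet_function_coordinate: "fst l \<le> k \<Longrightarrow> jet_function k (coordinate l)"
  by (cases l) (auto simp: jet_function_def coordinate_def)

lemma jet_function_coordinate_diff: "fst l \<le> k \<Longrightarrow> jet_function k (\<lambda>p. coordinate l p - a)"
  by (cases l) (auto simp: jet_function_def coordinate_def)

lemma jet_function_power: "jet_function k F \<Longrightarrow> jet_function k (\<lambda>p. F p ^ n)"
  unfolding jet_function_def by metis

lemma jet_function_pd: 
  assumes "jet_function k F" shows "jet_function k (pd j F)"
  unfolding jet_function_def
proof (intro allI impI)
  fix p q :: "'a coords" assume "\<forall>r\<le>k. snd p r = snd q r"
  then have "F (move j p s) = F (move j q s)" for s
    by (intro jet_functionD[OF assms] snd_move_eq) auto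
  then show "pd j F p = pd j F q" by (simp add: pd_def)
qed

lemma jet_function_wirtinger: 
  assumes "jet_function k F" shows "jet_function k (wirtinger l F)"
proof -
  obtain r i e where l: "l = (r, i, e)" by (cases l)
  show ?thesis
    unfolding jet_function_def l wirtinger_eq
    by (intro allI impI, subst (1 2) jet_functionD[OF jet_function_pd[OF assms]]) auto
qed

lemma d_time_jet_function: "jet_function k F \<Longrightarrow> d_time F p = 0"
  unfolding d_time_eq using jet_functionD[of k F "move None p _" p] by (simp add: pd_def)

lemma wirtinger_above:
  assumes "depends_upto k F" "l \<notin> cdirs k" shows "wirtinger l F p = 0"
proof -
  obtain r i e where l: "l = (r, i, e)" by (cases l)
  have "F (move (Some (r, i, h)) p s) = F p" for h s
    by (rule depends_uptoD[OF assms(1)]) (use assms(2) in \<open>auto simp: l fst_move snd_move simp del: move.simps\<close>)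
  then have "pd (Some (r, i, h)) F p = 0" for h by (simp add: pd_def del: move.simps)
  then show ?thesis by (simp add: l wirtinger_eq)
qed

definition next_order :: "'m cdir \<Rightarrow> 'm cdir" where
  "next_order l = (Suc (fst l), snd l)"

text \<open>
  The operator \<open>z\<^sup>r\<^sup>+\<^sup>1\<^sup>,\<^sup>i \<partial>/\<partial>z\<^sup>r\<^sup>i + conjugate\<close>. The parameter \<open>k\<close> only bounds the sum: on jet functions of order
  \<open>k\<close> every larger bound gives the same result.
\<close>

definition total_deriv :: "nat \<Rightarrow> ('m::finite coords \<Rightarrow> complex) \<Rightarrow> 'm coords \<Rightarrow> complex" where
  "total_deriv k F p = (\<Sum>l\<in>cdirs k. coordinate (next_order l) p * wirtinger l F p)"

lemma jet_smooth_total_deriv: "open S \<Longrightarrow> jet_smooth S F \<Longrightarrow> jet_smooth S (total_deriv k F)"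
  unfolding total_deriv_def[abs_def]
  by (intro jet_smooth_sum jet_smooth_mult jet_smooth_coordinate jet_smooth_wirtinger)

lemma jet_function_total_deriv: "jet_function k F \<Longrightarrow> jet_function (Suc k) (total_deriv k F)"
  unfolding total_deriv_def[abs_def]
  by (intro jet_function_sum jet_function_mult jet_function_coordinate jet_function_mono[OF jet_function_wirtinger])
     (auto simp: next_order_def)

lemma total_deriv_cong:
  "open S \<Longrightarrow> p \<in> S \<Longrightarrow> (\<And>q. q \<in> S \<Longrightarrow> F q = G q) \<Longrightarrow> total_deriv k F p = total_deriv k G p"
  unfolding total_deriv_def using wirtinger_cong[of S p F G] by simp

lemma total_deriv_const [simp]: "total_deriv k (\<lambda>_. c) p = 0"
  by (simp add: total_deriv_def)

lemma total_deriv_add: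
  "p \<in> S \<Longrightarrow> jet_smooth S F \<Longrightarrow> jet_smooth S G \<Longrightarrow>
   total_deriv k (\<lambda>p. F p + G p) p = total_deriv k F p + total_deriv k G p"
  by (simp add: total_deriv_def wirtinger_add distrib_left sum.distrib)

lemma total_deriv_mult:
  "p \<in> S \<Longrightarrow> jet_smooth S F \<Longrightarrow> jet_smooth S G \<Longrightarrow>
   total_deriv k (\<lambda>p. F p * G p) p = F p * total_deriv k G p + total_deriv k F p * G p"
  by (simp add: total_deriv_def wirtinger_mult sum_distrib_left sum_distrib_right flip: sum.distrib)
     (simp add: algebra_simps)

lemma total_deriv_power:
  assumes "open S" "p \<in> S" "jet_smooth S F"
  shows "total_deriv k (\<lambda>p. F p ^ n) p = of_nat n * F p ^ (n - 1) * total_deriv k F p"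
  by (simp add: total_deriv_def wirtinger_power[OF assms] sum_distrib_left algebra_simps)

lemma total_deriv_more:
  assumes "jet_function k F" "k \<le> k'" shows "total_deriv k' F p = total_deriv k F p"
  unfolding total_deriv_def using wirtinger_above[OF jet_function_imp_depends_upto[OF assms(1)]] cdirs_mono[OF assms(2)]
  by (intro sum.mono_neutral_right) auto

text \<open>The \<open>n\<close>-th power of the total derivative, for functions of order 0.\<close>

primrec total_pow :: "nat \<Rightarrow> ('m::finite coords \<Rightarrow> complex) \<Rightarrow> 'm coords \<Rightarrow> complex" where
  "total_pow 0 F = F"
| "total_pow (Suc n) F = total_deriv n (total_pow n F)"

lemma jet_smooth_total_pow: "open S \<Longrightarrow> jet_smooth S F \<Longrightarrow> jet_smooth S (total_pow n F)"
  by (induction n) (auto intro: jet_smooth_total_deriv)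

lemma jet_function_total_pow: "jet_function 0 F \<Longrightarrow> jet_function n (total_pow n F)"
  by (induction n) (auto intro: jet_function_total_deriv)

lemma total_pow_cong:
  assumes "open S" "\<And>q. q \<in> S \<Longrightarrow> F q = G q" "p \<in> S"
  shows "total_pow n F p = total_pow n G p"
  using assms(3) by (induction n arbitrary: p) (auto simp: assms(2) intro: total_deriv_cong[OF assms(1)])

lemma total_pow_zero [simp]: "total_pow n (\<lambda>_. 0) p = 0"
proof -
  have "total_pow n (\<lambda>_. 0 :: complex) q = 0" for q :: "'a::finite coords"
  proof (induction n arbitrary: q)
    case (Suc n)
    then have "total_pow n (\<lambda>_. 0 :: complex) = (\<lambda>_ :: 'a coords. 0)" by (rule ext)
    then show ?case by simp
  qed simp
  then show ?thesis .
qed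

text \<open>
  Each differentiation lowers the power of \<open>L\<close> by at most one, and the term in which it is lowered every
  time is the one where each derivative hits a new factor \<open>L\<close>. All other terms contain one more factor
  \<open>L\<close>.
\<close>

lemma total_pow_power:
  assumes S: "open S" and l: "jet_function 0 L" "jet_smooth S L" and H: "jet_smooth S H" and "j \<le> n"
  shows "\<exists>R. jet_smooth S R \<and> (\<forall>p\<in>S. total_pow j (\<lambda>p. L p ^ n * H p) p =
     fact n / fact (n - j) * L p ^ (n - j) * (total_deriv 0 L p ^ j * H p) + L p ^ Suc (n - j) * R p)"
  using \<open>j \<le> n\<close>
proof (induction j)
  case 0
  show ?case by (intro exI[of _ "\<lambda>_. 0"]) (simp add: jet_smooth_const)
next
  case (Suc j)
  define m where "m = n - Suc j"
  have m: "n - j = Suc m" using Suc.prems by (simp add: m_def)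
  obtain R where R: "jet_smooth S R" "\<And>p. p \<in> S \<Longrightarrow> total_pow j (\<lambda>p. L p ^ n * H p) p =
     fact n / fact (Suc m) * L p ^ Suc m * (total_deriv 0 L p ^ j * H p) + L p ^ Suc (Suc m) * R p"
    using Suc m by auto
  define D where "D = total_deriv 0 L"
  define K where "K = (\<lambda>p. D p ^ j * H p)"
  define c :: complex where "c = fact n / fact (Suc m)"
  have smooth: "jet_smooth S D" "jet_smooth S K"
    unfolding D_def K_def by (intro jet_smooth_mult jet_smooth_power jet_smooth_total_deriv S l H)+
  \<comment> \<open>The derivative of the leading term splits into the new leading term and the first summand of the new remainder.\<close>
  define R' where "R' = (\<lambda>p. c * total_deriv j K p + of_nat (Suc (Suc m)) * D p * R p + L p * total_deriv j R p)"
  have "jet_smooth S R'" unfolding R'_def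
    by (intro jet_smooth_add jet_smooth_mult jet_smooth_total_deriv jet_smooth_const S smooth R(1) l(2))
  moreover have "total_pow (Suc j) (\<lambda>p. L p ^ n * H p) p =
      fact n / fact m * L p ^ m * (D p ^ Suc j * H p) + L p ^ Suc m * R' p" if "p \<in> S" for p
  proof -
    have DL: "total_deriv j L p = D p" unfolding D_def by (rule total_deriv_more[OF l(1)]) simp
    have c: "c * of_nat (Suc m) = fact n / fact m" unfolding c_def by (simp add: field_simps del: of_nat_Suc)
    have "total_pow (Suc j) (\<lambda>p. L p ^ n * H p) p =
        total_deriv j (\<lambda>p. c * (L p ^ Suc m * K p) + L p ^ Suc (Suc m) * R p) p"
      unfolding total_pow.simps by (rule total_deriv_cong[OF S that]) (simp add: R(2) c_def K_def D_def)
    also have "\<dots> = c * (L p ^ Suc m * total_deriv j K p + of_nat (Suc m) * L p ^ m * D p * K p)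
         + (L p ^ Suc (Suc m) * total_deriv j R p + of_nat (Suc (Suc m)) * L p ^ Suc m * D p * R p)"
      using that S l(2) smooth R(1)
      by (simp add: total_deriv_add[where S = S] total_deriv_mult[where S = S] total_deriv_power[where S = S]
          jet_smooth_mult jet_smooth_power jet_smooth_const DL del: power_Suc of_nat_Suc)
    also have "\<dots> = (c * of_nat (Suc m)) * L p ^ m * (D p * K p) + L p ^ Suc m * R' p"
      by (simp add: R'_def algebra_simps)
    finally show ?thesis unfolding c K_def by simp
  qed
  ultimately show ?case by (auto simp: m_def D_def)
qed

subsection \<open>Prolongation\<close>

text \<open>
  The vector field with coefficients \<open>D\<^sup>r \<xi>\<close> in order \<open>r\<close>, as an operator on functions of the coordinates.
  Apart from \<open>\<partial>/\<partial>t\<close>, this is the complete lift of the field with coefficients \<open>\<xi>\<close>.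
\<close>

definition prolong ::
  "nat \<Rightarrow> ('m \<times> bool \<Rightarrow> 'm::finite coords \<Rightarrow> complex) \<Rightarrow> ('m coords \<Rightarrow> complex) \<Rightarrow> 'm coords \<Rightarrow> complex" where
  "prolong k \<xi> F p = (\<Sum>l\<in>cdirs k. total_pow (fst l) (\<xi> (snd l)) p * wirtinger l F p)"

lemma sum_cdirs_0: "(\<Sum>l\<in>cdirs 0. f l) = (\<Sum>m\<in>UNIV. f (0, m))"
  by (rule sum.reindex_bij_witness[of _ "\<lambda>m. (0, m)" snd]) (auto simp: cdirs_def)

lemma prolong_0: "prolong 0 \<xi> F p = (\<Sum>m\<in>UNIV. \<xi> m p * wirtinger (0, m) F p)"
  by (simp add: prolong_def sum_cdirs_0)

lemma next_order_mem: "next_order l \<in> cdirs (Suc k) \<longleftrightarrow> l \<in> cdirs k"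
  by (cases l) (simp add: next_order_def)

lemma prolong_more:
  assumes "jet_function k F" "k \<le> k'" shows "prolong k' \<xi> F p = prolong k \<xi> F p"
  unfolding prolong_def using wirtinger_above[OF jet_function_imp_depends_upto[OF assms(1)]] cdirs_mono[OF assms(2)]
  by (intro sum.mono_neutral_right) auto

text \<open>
  The prolongation commutes with the total derivative \<open>D\<close>. In the commutator the second derivatives cancel
  because mixed partial derivatives agree; the first derivatives cancel because the coefficient of the
  prolongation in order \<open>r + 1\<close> is \<open>D\<close> of its coefficient in order \<open>r\<close>.
\<close>

lemma prolong_total_deriv:
  assumes S: "open S" "p \<in> S" and F: "jet_function k F" "jet_smooth S F"
    and \<xi>: "\<And>m. jet_function 0 (\<xi> m)" "\<And>m. jet_smooth S (\<xi> m)"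
  shows "prolong (Suc k) \<xi> (total_deriv k F) p = total_deriv k (prolong k \<xi> F) p"
proof -
  define X where "X l = total_pow (fst l) (\<xi> (snd l))" for l :: "'a cdir"
  have X: "jet_smooth S (X l)" for l
    unfolding X_def by (intro jet_smooth_total_pow S \<xi>)
  have X_next: "X (next_order l) p = total_deriv k (X l) p" if "l \<in> cdirs k" for l
    using total_deriv_more[OF jet_function_total_pow[OF \<xi>(1)], of "fst l" k "snd l" p] that
    by (cases l) (auto simp: X_def next_order_def)
  have dF: "jet_smooth S (wirtinger l F)" for l by (rule jet_smooth_wirtinger[OF S(1) F(2)])
  have eq: "wirtinger m (total_deriv k F) p =
      (\<Sum>l\<in>cdirs k. coordinate (next_order l) p * wirtinger m (wirtinger l F) p + (if m = next_order l then wirtinger l F p else 0))" for m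
    unfolding total_deriv_def[abs_def]
    by (subst wirtinger_sum[OF S(2,1)])
       (auto intro!: jet_smooth_mult jet_smooth_coordinate S dF sum.cong
         simp: wirtinger_mult[OF S(2) jet_smooth_coordinate[OF S(1)] dF] wirtinger_coordinate)
  have "prolong (Suc k) \<xi> (total_deriv k F) p = (\<Sum>m\<in>cdirs (Suc k). \<Sum>l\<in>cdirs k.
      X m p * coordinate (next_order l) p * wirtinger m (wirtinger l F) p + (if m = next_order l then X m p * wirtinger l F p else 0))"
    unfolding prolong_def X_def[symmetric] eq sum_distrib_left
    by (intro sum.cong refl) (simp add: algebra_simps)
  also have "\<dots> = (\<Sum>m\<in>cdirs (Suc k). \<Sum>l\<in>cdirs k. X m p * coordinate (next_order l) p * wirtinger m (wirtinger l F) p)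
      + (\<Sum>m\<in>cdirs (Suc k). \<Sum>l\<in>cdirs k. if m = next_order l then X m p * wirtinger l F p else 0)"
    by (simp add: sum.distrib)
  also have "(\<Sum>m\<in>cdirs (Suc k). \<Sum>l\<in>cdirs k. if m = next_order l then X m p * wirtinger l F p else 0)
     = (\<Sum>l\<in>cdirs k. X (next_order l) p * wirtinger l F p)"
    by (subst sum.swap) (simp add: sum.delta next_order_mem)
  also have "(\<Sum>m\<in>cdirs (Suc k). \<Sum>l\<in>cdirs k. X m p * coordinate (next_order l) p * wirtinger m (wirtinger l F) p) =
      (\<Sum>m\<in>cdirs k. \<Sum>l\<in>cdirs k. X m p * coordinate (next_order l) p * wirtinger m (wirtinger l F) p)"
    using wirtinger_above[OF jet_function_imp_depends_upto[OF jet_function_wirtinger[OF F(1)]]] cdirs_mono[of k "Suc k"]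
    by (intro sum.mono_neutral_right) auto
  also have "\<dots> = (\<Sum>l\<in>cdirs k. \<Sum>m\<in>cdirs k. X m p * coordinate (next_order l) p * wirtinger l (wirtinger m F) p)"
    using wirtinger_commute[OF S F(2)] by (subst sum.swap) simp
  also have "(\<Sum>l\<in>cdirs k. X (next_order l) p * wirtinger l F p) = 
      (\<Sum>l\<in>cdirs k. \<Sum>m\<in>cdirs k. coordinate (next_order l) p * wirtinger l (X m) p * wirtinger m F p)"
    by (subst sum.swap) (simp add: X_next total_deriv_def sum_distrib_right)
  also have "(\<Sum>l\<in>cdirs k. \<Sum>m\<in>cdirs k. X m p * coordinate (next_order l) p * wirtinger l (wirtinger m F) p)
      + (\<Sum>l\<in>cdirs k. \<Sum>m\<in>cdirs k. coordinate (next_order l) p * wirtinger l (X m) p * wirtinger m F p)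
      = (\<Sum>l\<in>cdirs k. coordinate (next_order l) p * (\<Sum>m\<in>cdirs k. X m p * wirtinger l (wirtinger m F) p + wirtinger l (X m) p * wirtinger m F p))"
    by (simp add: sum_distrib_left sum.distrib algebra_simps)
  also have "\<dots> = total_deriv k (prolong k \<xi> F) p"
    unfolding total_deriv_def prolong_def[abs_def] X_def[symmetric]
    by (subst wirtinger_sum[OF S(2,1)]) (auto intro!: jet_smooth_mult S dF X simp: wirtinger_mult[OF S(2) X dF])
  finally show ?thesis .
qed

lemma jet_smooth_prolong:
  assumes "open S" "jet_smooth S F" "\<And>m. jet_smooth S (\<xi> m)" shows "jet_smooth S (prolong k \<xi> F)"
  unfolding prolong_def[abs_def]
  by (intro jet_smooth_sum jet_smooth_mult jet_smooth_total_pow jet_smooth_wirtinger assms)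

lemma jet_function_prolong:
  assumes "jet_function k F" "\<And>m. jet_function 0 (\<xi> m)" shows "jet_function k (prolong k \<xi> F)"
  unfolding prolong_def[abs_def]
  by (intro jet_function_sum jet_function_mult jet_function_wirtinger assms jet_function_mono[OF jet_function_total_pow])
     (auto simp: cdirs_def)

lemma prolong_total_pow:
  assumes S: "open S" "p \<in> S" and G: "jet_function 0 G" "jet_smooth S G"
    and \<xi>: "\<And>m. jet_function 0 (\<xi> m)" "\<And>m. jet_smooth S (\<xi> m)"
  shows "prolong k \<xi> (total_pow k G) p = total_pow k (prolong 0 \<xi> G) p"
  using S(2)
proof (induction k arbitrary: p)
  case (Suc k)
  have "prolong (Suc k) \<xi> (total_pow (Suc k) G) p = total_deriv k (prolong k \<xi> (total_pow k G)) p"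
    by (simp add: prolong_total_deriv[OF S(1) Suc.prems jet_function_total_pow[OF G(1)]
        jet_smooth_total_pow[OF S(1) G(2)] \<xi>])
  also have "\<dots> = total_deriv k (total_pow k (prolong 0 \<xi> G)) p"
    by (rule total_deriv_cong[OF S(1) Suc.prems]) (rule Suc.IH)
  finally show ?case by simp
qed simp


subsection \<open>Curves\<close>

lemma curve_deriv_0 [simp]: "curve_deriv 0 g = g"
  by (simp add: curve_deriv_def)

lemma curve_deriv_Suc: "curve_deriv (Suc n) g s = vector_derivative (curve_deriv n g) (at s)"
  by (simp add: curve_deriv_def)

definition smooth_curve_on :: "real set \<Rightarrow> (real \<Rightarrow> 'v::real_normed_vector) \<Rightarrow> bool" where
  "smooth_curve_on I g \<longleftrightarrow> (\<forall>n. \<forall>s\<in>I. curve_deriv n g differentiable (at s))"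

lemma smooth_curve_onD:
  "smooth_curve_on I g \<Longrightarrow> s \<in> I \<Longrightarrow> (curve_deriv n g has_vector_derivative curve_deriv (Suc n) g s) (at s)"
  by (simp add: smooth_curve_on_def curve_deriv_Suc vector_derivative_works)

text \<open>The iterated derivatives of a curve can be guessed and then verified one differentiation at a time.\<close>

lemma curve_deriv_unique:
  assumes "open I" "\<And>s. s \<in> I \<Longrightarrow> g s = G 0 s"
    and "\<And>n s. s \<in> I \<Longrightarrow> (G n has_vector_derivative G (Suc n) s) (at s)"
  shows "s \<in> I \<Longrightarrow> curve_deriv n g s = G n s" "smooth_curve_on I g"
proof -
  have der: "(curve_deriv n g has_vector_derivative G (Suc n) s) (at s)"
    if "\<And>s. s \<in> I \<Longrightarrow> curve_deriv n g s = G n s" "s \<in> I" for n s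
    using has_vector_derivative_transform_within_open[OF assms(3)[OF that(2)] assms(1) that(2)] that(1) by auto
  have eq: "curve_deriv n g s = G n s" if "s \<in> I" for n s
    using that
  proof (induction n arbitrary: s)
    case (Suc n)
    show ?case unfolding curve_deriv_Suc by (rule vector_derivative_at[OF der[OF Suc.IH Suc.prems]])
  qed (simp add: assms(2))
  show "s \<in> I \<Longrightarrow> curve_deriv n g s = G n s" by (rule eq)
  show "smooth_curve_on I g"
    unfolding smooth_curve_on_def using der[OF eq] differentiableI_vector by blast
qed

text \<open>A default value: jet functions do not see the time coordinate.\<close>

definition jet_at :: "(real \<Rightarrow> complex ^ 'm) \<Rightarrow> real \<Rightarrow> 'm coords" where
  "jet_at u s = (0, \<lambda>r. curve_deriv r u s)"

text \<open>
  On the jets of a curve the coordinate of order \<open>r\<close> moves with the velocity given by the coordinate of order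
  \<open>r + 1\<close>, so by the chain rule differentiation along the curve is the total derivative.
\<close>

lemma curve_deriv_eq_total_pow:
  assumes I: "open I" and u: "smooth_curve_on I u"
    and S: "open S" "\<And>s. s \<in> I \<Longrightarrow> jet_at u s \<in> S"
    and G: "jet_function 0 G" "jet_smooth S G" and g: "\<And>s. s \<in> I \<Longrightarrow> g s = G (jet_at u s)"
  shows "s \<in> I \<Longrightarrow> curve_deriv n g s = total_pow n G (jet_at u s)" "smooth_curve_on I g"
proof -
  have "((\<lambda>s. total_pow n G (jet_at u s)) has_vector_derivative total_pow (Suc n) G (jet_at u s)) (at s)"
    if s: "s \<in> I" for n s
  proof -
    have "((\<lambda>s. coordinate l (jet_at u s)) has_vector_derivative coordinate (next_order l) (jet_at u s)) (at s)" for l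
    proof -
      obtain r i e where l: "l = (r, i, e)" by (cases l)
      have "((\<lambda>s. curve_deriv r u s $ i) has_vector_derivative curve_deriv (Suc r) u s $ i) (at s)"
        by (rule bounded_linear.has_vector_derivative[OF bounded_linear_vec_nth smooth_curve_onD[OF u s]])
      then show ?thesis
        by (cases e) (auto simp: l coordinate_def jet_at_def next_order_def intro: has_vector_derivative_cnj)
    qed
    then have "((\<lambda>s. total_pow n G (jet_at u s)) has_vector_derivative
        (of_real 0 * d_time (total_pow n G) (jet_at u s) +
         (\<Sum>l\<in>cdirs n. coordinate (next_order l) (jet_at u s) * wirtinger l (total_pow n G) (jet_at u s)))) (at s)"
      by (intro has_vector_derivative_chain[where q = "jet_at u" and a = s, OF S(1) S(2)[OF s]] jet_function_imp_depends_upto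
            jet_function_total_pow G jet_smooth_total_pow S(1)) (simp_all add: jet_at_def)
    then show ?thesis by (simp add: total_deriv_def)
  qed
  from curve_deriv_unique[where G = "\<lambda>n s. total_pow n G (jet_at u s)" and g = g, OF I _ this]
  show "s \<in> I \<Longrightarrow> curve_deriv n g s = total_pow n G (jet_at u s)" "smooth_curve_on I g"
    using g by simp_all
qed

lemma has_vector_derivative_vec:
  fixes v :: "real \<Rightarrow> complex ^ 'm::finite"
  assumes "\<And>i. ((\<lambda>s. v s $ i) has_vector_derivative v' $ i) (at a)"
  shows "(v has_vector_derivative v') (at a)"
proof -
  have "bounded_linear (axis i :: complex \<Rightarrow> complex ^ 'm)" for i
    by (intro linear_conv_bounded_linear[THEN iffD1] linearI) (auto simp: vec_eq_iff axis_def)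
  from has_vector_derivative_sum[of UNIV, OF bounded_linear.has_vector_derivative[OF this assms]]
  have "((\<lambda>s. \<Sum>i\<in>UNIV. axis i (v s $ i)) has_vector_derivative (\<Sum>i\<in>UNIV. axis i (v' $ i))) (at a)" .
  moreover have "(\<Sum>i\<in>UNIV. axis i (x $ i)) = x" for x :: "complex ^ 'm"
    by (simp add: vec_eq_iff axis_def if_distrib[of "\<lambda>f. f $ _"] sum.delta)
  ultimately show ?thesis by simp
qed

lemma curve_deriv_component:
  fixes v :: "real \<Rightarrow> complex ^ 'm::finite"
  assumes "open I" "\<And>i. smooth_curve_on I (\<lambda>s. v s $ i)"
  shows "s \<in> I \<Longrightarrow> curve_deriv n v s $ i = curve_deriv n (\<lambda>s. v s $ i) s" "smooth_curve_on I v"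
proof -
  have "((\<lambda>s. \<chi> i. curve_deriv n (\<lambda>s. v s $ i) s) has_vector_derivative (\<chi> i. curve_deriv (Suc n) (\<lambda>s. v s $ i) s)) (at s)"
    if "s \<in> I" for n s
    by (rule has_vector_derivative_vec) (use smooth_curve_onD[OF assms(2) that] in simp)
  from curve_deriv_unique[where G = "\<lambda>n s. \<chi> i. curve_deriv n (\<lambda>s. v s $ i) s" and g = v, OF assms(1) _ this]
  show "s \<in> I \<Longrightarrow> curve_deriv n v s $ i = curve_deriv n (\<lambda>s. v s $ i) s" "smooth_curve_on I v"
    by simp_all
qed

section \<open>Curves and jets in a manifold\<close>

definition point_of :: "('a, 'm::finite) chart \<Rightarrow> 'm coords \<Rightarrow> 'a" where
  "point_of c p = inv_into (fst c) (snd c) (snd p 0)"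

text \<open>The part of the domain of the chart that lies over \<open>V\<close>.\<close>

definition coords_over :: "('a, 'm::finite) chart \<Rightarrow> 'a set \<Rightarrow> 'm coords set" where
  "coords_over c V = {p. snd p 0 \<in> snd c ` (fst c \<inter> V)}"

definition local_rep :: "('a, 'm::finite) chart \<Rightarrow> ('a \<Rightarrow> complex) \<Rightarrow> 'm coords \<Rightarrow> complex" where
  "local_rep c g p = g (point_of c p)"

definition coord_fun :: "('a, 'm::finite) chart \<Rightarrow> 'm \<times> bool \<Rightarrow> 'a \<Rightarrow> complex" where
  "coord_fun c m x = (if snd m then cnj (snd c x $ fst m) else snd c x $ fst m)"

lemma jet_function_local_rep: "jet_function 0 (local_rep c g)"
  by (simp add: jet_function_def local_rep_def point_of_def)

lemma curves_iff: "\<gamma> \<in> curves A \<longleftrightarrow> (\<forall>c\<in>A. \<gamma> 0 \<in> fst c \<longrightarrow>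
    (\<exists>\<epsilon>>0. (\<forall>s\<in>{-\<epsilon><..<\<epsilon>}. \<gamma> s \<in> fst c) \<and> smooth_curve_on {-\<epsilon><..<\<epsilon>} (snd c \<circ> \<gamma>)))"
proof -
  have *: "(\<forall>s. \<bar>s\<bar> < \<epsilon> \<longrightarrow> \<gamma> s \<in> U \<and> (\<forall>n. P n s)) \<longleftrightarrow>
      (\<forall>s\<in>{-\<epsilon><..<\<epsilon>}. \<gamma> s \<in> U) \<and> (\<forall>n. \<forall>s\<in>{-\<epsilon><..<\<epsilon>}. P n s)" for \<epsilon> U P
    by (auto simp: abs_less_iff)
  show ?thesis
    unfolding curves_def smooth_curve_on_def split_def mem_Collect_eq * ..
qed

lemma jet_rel_iff: "(\<gamma>, \<delta>) \<in> jet_rel A k \<longleftrightarrow> \<gamma> \<in> curves A \<and> \<delta> \<in> curves A \<and> \<gamma> 0 = \<delta> 0 \<and>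
    (\<forall>c\<in>A. \<gamma> 0 \<in> fst c \<longrightarrow> (\<forall>r\<le>k. curve_deriv r (snd c \<circ> \<gamma>) 0 = curve_deriv r (snd c \<circ> \<delta>) 0))"
  by (simp add: jet_rel_def split_def)

lemma equiv_jet_rel: "equiv (curves A) (jet_rel A k)"
  by (rule equivI) (auto simp: jet_rel_iff refl_on_def sym_def trans_def)

lemma jet_rel_mono: "j \<le> k \<Longrightarrow> jet_rel A k \<subseteq> jet_rel A j"
  by (auto simp: jet_rel_iff)

lemma smooth_curve_on_subset: "smooth_curve_on I g \<Longrightarrow> J \<subseteq> I \<Longrightarrow> smooth_curve_on J g"
  by (auto simp: smooth_curve_on_def)

lemma curve_deriv_cong:
  assumes "open I" "smooth_curve_on I g" "\<And>s. s \<in> I \<Longrightarrow> f s = g s"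
  shows "s \<in> I \<Longrightarrow> curve_deriv n f s = curve_deriv n g s" "smooth_curve_on I f"
  using curve_deriv_unique[where G = "\<lambda>n. curve_deriv n g" and g = f, OF assms(1)] assms(2,3)
    smooth_curve_onD[OF assms(2)] by simp_all

text \<open>The curve is the Taylor polynomial with the given derivatives.\<close>

lemma polynomial_curve:
  fixes z :: "nat \<Rightarrow> complex ^ 'm::finite"
  obtains u where "smooth_curve_on UNIV u" "\<And>r. r \<le> k \<Longrightarrow> curve_deriv r u 0 = z r"
proof -
  \<comment> \<open>\<open>G n\<close> is the \<open>n\<close>-th derivative of the Taylor polynomial \<open>G 0\<close>.\<close>
  define G where "G n s = (\<Sum>r\<in>{n..k}. (s ^ (r - n) / fact (r - n)) *\<^sub>R z r)" for n and s :: real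
  have "(G n has_vector_derivative G (Suc n) s) (at s)" for n s
  proof -
    have "((\<lambda>s. (s ^ (r - n) / fact (r - n)) *\<^sub>R z r) has_vector_derivative
       (if r = n then 0 else (s ^ (r - Suc n) / fact (r - Suc n)) *\<^sub>R z r)) (at s)" if "r \<in> {n..k}" for r
    proof (cases "r = n")
      case False
      then obtain d where d: "r - n = Suc d" "r - Suc n = d" using \<open>r \<in> {n..k}\<close>
        by (metis Suc_diff_Suc atLeastAtMost_iff le_neq_implies_less)
      have "((\<lambda>s. s ^ Suc d / fact (Suc d)) has_real_derivative s ^ d / fact d) (at s)"
        using DERIV_cdivide[OF DERIV_pow[of "Suc d" s UNIV], of "fact (Suc d)"] by (simp del: of_nat_Suc)
      then have "((\<lambda>s. (s ^ Suc d / fact (Suc d)) *\<^sub>R z r) has_vector_derivative (s ^ d / fact d) *\<^sub>R z r) (at s)"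
        using has_vector_derivative_scaleR[OF _ has_vector_derivative_const[of "z r"]] by fastforce
      then show ?thesis unfolding d using False by simp
    qed simp
    then have "(G n has_vector_derivative (\<Sum>r\<in>{n..k}. if r = n then 0 else (s ^ (r - Suc n) / fact (r - Suc n)) *\<^sub>R z r)) (at s)"
      unfolding G_def[abs_def] by (rule has_vector_derivative_sum)
    moreover have "(\<Sum>r\<in>{n..k}. if r = n then 0 else (s ^ (r - Suc n) / fact (r - Suc n)) *\<^sub>R z r) = G (Suc n) s"
      unfolding G_def by (rule sum.mono_neutral_cong_right) auto
    ultimately show ?thesis by simp
  qed
  note * = curve_deriv_unique[where G = G and g = "G 0" and I = UNIV, OF open_UNIV refl this]
  have "curve_deriv r (G 0) 0 = z r" if "r \<le> k" for r
  proof -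
    have "G r 0 = (\<Sum>r'\<in>{r..k}. if r' = r then z r else 0)"
      unfolding G_def by (rule sum.cong) (auto simp: power_0_left)
    then show ?thesis using that *(1) by simp
  qed
  then show ?thesis using that[of "G 0"] *(2) by simp
qed

locale atlas =
  fixes A :: "('a::{t2_space, second_countable_topology}, 'm::finite) chart set"
  assumes complex_atlas: "complex_atlas A"
begin

lemma ex_chart: "\<exists>c\<in>A. x \<in> fst c"
  using complex_atlas unfolding complex_atlas_def by (force simp: split_def)

lemma chart_facts:
  assumes "c \<in> A"
  shows open_chart: "open (fst c)" and open_chart_image: "open (snd c ` fst c)"
    and chart_homeomorphism: "homeomorphism (fst c) (snd c ` fst c) (snd c) (inv_into (fst c) (snd c))"
  using complex_atlas assms unfolding complex_atlas_def by (auto simp: split_def)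

lemma inj_on_chart: "c \<in> A \<Longrightarrow> inj_on (snd c) (fst c)"
  using chart_homeomorphism[of c] unfolding homeomorphism_def by (metis inj_on_inverseI)

lemma open_image_chart:
  assumes "c \<in> A" "open V" shows "open (snd c ` (fst c \<inter> V))"
proof -
  have "snd c ` (fst c \<inter> V) = inv_into (fst c) (snd c) -` V \<inter> snd c ` fst c"
    using inj_on_chart[OF assms(1)] by (force simp: inv_into_f_f)
  moreover have "continuous_on (snd c ` fst c) (inv_into (fst c) (snd c))"
    using chart_homeomorphism[OF assms(1)] unfolding homeomorphism_def by blast
  ultimately show ?thesis
    using continuous_on_open_vimage[OF open_chart_image[OF assms(1)]] assms(2) by metis
qed

lemma open_coords_over:
  assumes "c \<in> A" "open V" shows "open (coords_over c V)"
proof -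
  have "coords_over c V = (\<lambda>p. snd p 0) -` (snd c ` (fst c \<inter> V))" by (auto simp: coords_over_def)
  moreover have "continuous_on UNIV (\<lambda>p :: 'm coords. snd p 0)"
    by (intro continuous_on_snd_apply continuous_on_id)
  ultimately show ?thesis using open_image_chart[OF assms] by (simp add: open_vimage)
qed

lemma coords_dom_eq: "coords_dom c = coords_over c UNIV"
  by (auto simp: coords_dom_def coords_over_def)

lemma open_coords_dom: "c \<in> A \<Longrightarrow> open (coords_dom c)"
  by (simp add: coords_dom_eq open_coords_over)

lemma coords_over_subset: "coords_over c V \<subseteq> coords_dom c"
  by (auto simp: coords_dom_eq coords_over_def)

lemma point_of_coords:
  assumes "p \<in> coords_over c V"
  shows "point_of c p \<in> fst c" "snd c (point_of c p) = snd p 0"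
proof -
  have "snd p 0 \<in> snd c ` fst c" using assms by (auto simp: coords_over_def)
  then show "point_of c p \<in> fst c" "snd c (point_of c p) = snd p 0"
    unfolding point_of_def by (rule inv_into_into, rule f_inv_into_f)
qed

lemma point_of_eq: "c \<in> A \<Longrightarrow> x \<in> fst c \<Longrightarrow> snd p 0 = snd c x \<Longrightarrow> point_of c p = x"
  by (simp add: point_of_def inv_into_f_f[OF inj_on_chart])

lemma coords_over_iff:
  assumes "c \<in> A" shows "p \<in> coords_over c V \<longleftrightarrow> p \<in> coords_dom c \<and> point_of c p \<in> V"
proof
  assume p: "p \<in> coords_over c V"
  then obtain x where "x \<in> fst c" "x \<in> V" "snd p 0 = snd c x" by (auto simp: coords_over_def)
  then show "p \<in> coords_dom c \<and> point_of c p \<in> V" 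
    using p coords_over_subset point_of_eq[OF assms] by blast
next
  assume "p \<in> coords_dom c \<and> point_of c p \<in> V"
  then have "snd p 0 = snd c (point_of c p)" "point_of c p \<in> fst c \<inter> V"
    using point_of_coords[of p c UNIV] by (auto simp: coords_dom_eq)
  then show "p \<in> coords_over c V" unfolding coords_over_def mem_Collect_eq by (rule image_eqI)
qed

lemma jet_smooth_transition:
  assumes "c \<in> A" "c' \<in> A"
  shows "jet_smooth (coords_over c (fst c')) (local_rep c (coord_fun c' m))"
proof -
  define S where "S = coords_over c (fst c')"
  have S: "open S" unfolding S_def by (intro open_coords_over open_chart assms)
  obtain i e where m: "m = (i, e)" by (cases m)
  have 1: "S = {(t, x). x 0 \<in> snd c ` (fst c \<inter> fst c')}" by (auto simp: coords_over_def S_def)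
  have 2: "local_rep c (coord_fun c' (i, False)) = (\<lambda>(t, x). snd c' (inv_into (fst c) (snd c) (x 0)) $ i)"
    by (auto simp: local_rep_def coord_fun_def point_of_def)
  have "smooth_coords_on 0 (local_rep c (coord_fun c' (i, False))) S"
    using complex_atlas assms unfolding complex_atlas_def Let_def 1 2 by (auto simp: split_def)
  then have *: "jet_smooth S (local_rep c (coord_fun c' (i, False)))"
    by (rule jet_smooth_iff[OF S jet_function_imp_depends_upto[OF jet_function_local_rep], THEN iffD2])
  show ?thesis
  proof (cases e)
    case True
    then have "local_rep c (coord_fun c' m) = (\<lambda>p. cnj (local_rep c (coord_fun c' (i, False)) p))"
      by (auto simp: m local_rep_def coord_fun_def)
    then show ?thesis using jet_smooth_cnj[OF S *] by (simp add: S_def)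
  qed (use * in \<open>simp add: S_def m\<close>)
qed

text \<open>The curve is not assumed to be smooth in other charts: this lemma is what proves that it is.\<close>

lemma curve_in_chart:
  assumes c: "c \<in> A" and I: "open I" and \<gamma>: "\<And>s. s \<in> I \<Longrightarrow> \<gamma> s \<in> fst c" "smooth_curve_on I (snd c \<circ> \<gamma>)"
    and V: "open V" and g: "jet_smooth (coords_over c V) (local_rep c g)"
  shows "open {s \<in> I. \<gamma> s \<in> V}" "smooth_curve_on {s \<in> I. \<gamma> s \<in> V} (g \<circ> \<gamma>)"
    and "s \<in> I \<Longrightarrow> \<gamma> s \<in> V \<Longrightarrow> curve_deriv n (g \<circ> \<gamma>) s = total_pow n (local_rep c g) (jet_at (snd c \<circ> \<gamma>) s)"
proof -
  have "continuous_on I (snd c \<circ> \<gamma>)"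
    unfolding continuous_on_eq_continuous_at[OF I]
    using smooth_curve_onD[OF \<gamma>(2), of _ 0] has_vector_derivative_continuous by fastforce
  moreover have "continuous_on (snd c ` fst c) (inv_into (fst c) (snd c))"
    using chart_homeomorphism[OF c] unfolding homeomorphism_def by blast
  ultimately have "continuous_on I (inv_into (fst c) (snd c) \<circ> (snd c \<circ> \<gamma>))"
    by (rule continuous_on_compose[OF _ continuous_on_subset]) (use \<gamma>(1) in auto)
  then have "continuous_on I \<gamma>"
    by (rule continuous_on_cong[THEN iffD1, rotated -1]) (use \<gamma>(1) in \<open>auto simp: inv_into_f_f[OF inj_on_chart[OF c]]\<close>)
  then have "open (\<gamma> -` V \<inter> I)" using continuous_on_open_vimage[OF I] V by blast
  moreover have "\<gamma> -` V \<inter> I = {s \<in> I. \<gamma> s \<in> V}" by auto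
  ultimately show J: "open {s \<in> I. \<gamma> s \<in> V}" by simp
  have in_over: "jet_at (snd c \<circ> \<gamma>) s \<in> coords_over c V" if "s \<in> {s \<in> I. \<gamma> s \<in> V}" for s
    using that \<gamma>(1) by (auto simp: coords_over_def jet_at_def)
  have eq: "(g \<circ> \<gamma>) s = local_rep c g (jet_at (snd c \<circ> \<gamma>) s)" if "s \<in> {s \<in> I. \<gamma> s \<in> V}" for s
    using that \<gamma>(1) point_of_eq[OF c, of "\<gamma> s"] by (simp add: local_rep_def jet_at_def)
  have "smooth_curve_on {s \<in> I. \<gamma> s \<in> V} (snd c \<circ> \<gamma>)" by (rule smooth_curve_on_subset[OF \<gamma>(2)]) auto
  note * = curve_deriv_eq_total_pow[OF J this open_coords_over[OF c V] in_over jet_function_local_rep g eq]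
  show "smooth_curve_on {s \<in> I. \<gamma> s \<in> V} (g \<circ> \<gamma>)" by (rule *(2))
  show "curve_deriv n (g \<circ> \<gamma>) s = total_pow n (local_rep c g) (jet_at (snd c \<circ> \<gamma>) s)" if "s \<in> I" "\<gamma> s \<in> V"
    by (rule *(1)) (use that in auto)
qed

text \<open>
  Smoothness in one chart suffices, because the coordinates of any other chart are smooth functions of
  those of the first.
\<close>

lemma curvesI:
  assumes c: "c \<in> A" and I: "open I" "0 \<in> I"
    and \<gamma>: "\<And>s. s \<in> I \<Longrightarrow> \<gamma> s \<in> fst c" "smooth_curve_on I (snd c \<circ> \<gamma>)"
  shows "\<gamma> \<in> curves A"
  unfolding curves_iff
proof (intro ballI impI)
  fix c' assume c': "c' \<in> A" "\<gamma> 0 \<in> fst c'"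
  define J where "J = {s \<in> I. \<gamma> s \<in> fst c'}"
  have *: "open J" "smooth_curve_on J (coord_fun c' (i, False) \<circ> \<gamma>)" for i
    unfolding J_def
    by (rule curve_in_chart[OF c I(1) \<gamma> open_chart[OF c'(1)] jet_smooth_transition[OF c c'(1)]]; assumption)+
  have "smooth_curve_on J (snd c' \<circ> \<gamma>)"
    by (rule curve_deriv_component(2)[OF *(1)]) (use *(2) in \<open>simp add: coord_fun_def[abs_def] o_def\<close>)
  moreover obtain \<epsilon> where \<epsilon>: "\<epsilon> > 0" "ball 0 \<epsilon> \<subseteq> J"
    using *(1) I(2) c'(2) open_contains_ball[of J] by (auto simp: J_def)
  moreover have "ball 0 \<epsilon> = {-\<epsilon><..<\<epsilon>}" by (auto simp: dist_real_def)
  ultimately show "\<exists>\<epsilon>>0. (\<forall>s\<in>{-\<epsilon><..<\<epsilon>}. \<gamma> s \<in> fst c') \<and> smooth_curve_on {-\<epsilon><..<\<epsilon>} (snd c' \<circ> \<gamma>)"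
    by (intro exI[of _ \<epsilon>]) (auto simp: J_def intro: smooth_curve_on_subset)
qed

lemma curvesE:
  assumes "\<gamma> \<in> curves A" "c \<in> A" "\<gamma> 0 \<in> fst c"
  obtains I where "open I" "0 \<in> I" "\<And>s. s \<in> I \<Longrightarrow> \<gamma> s \<in> fst c" "smooth_curve_on I (snd c \<circ> \<gamma>)"
proof -
  obtain \<epsilon> where "\<epsilon> > 0" "\<forall>s\<in>{-\<epsilon><..<\<epsilon>}. \<gamma> s \<in> fst c" "smooth_curve_on {-\<epsilon><..<\<epsilon>} (snd c \<circ> \<gamma>)"
    using assms unfolding curves_iff by blast
  then show ?thesis using that[of "{-\<epsilon><..<\<epsilon>}"] by simp
qed

lemma curve_deriv_in_chart:
  assumes "\<gamma> \<in> curves A" "c \<in> A" "\<gamma> 0 \<in> fst c" and "open V" "\<gamma> 0 \<in> V"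
    and g: "jet_smooth (coords_over c V) (local_rep c g)"
  shows "curve_deriv n (g \<circ> \<gamma>) 0 = total_pow n (local_rep c g) (jet_at (snd c \<circ> \<gamma>) 0)"
proof -
  obtain I where I: "open I" "0 \<in> I" "\<And>s. s \<in> I \<Longrightarrow> \<gamma> s \<in> fst c" "smooth_curve_on I (snd c \<circ> \<gamma>)"
    using curvesE[OF assms(1-3)] by blast
  show ?thesis by (rule curve_in_chart(3)[OF assms(2) I(1,3,4) assms(4) g I(2) assms(5)])
qed

lemma curve_deriv_chart_component:
  assumes "\<gamma> \<in> curves A" "c \<in> A" "\<gamma> 0 \<in> fst c"
  shows "curve_deriv r (snd c \<circ> \<gamma>) 0 $ i = curve_deriv r (coord_fun c (i, False) \<circ> \<gamma>) 0"
proof -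
  obtain I where I: "open I" "0 \<in> I" "\<And>s. s \<in> I \<Longrightarrow> \<gamma> s \<in> fst c" "smooth_curve_on I (snd c \<circ> \<gamma>)"
    using curvesE[OF assms] by blast
  have "{s \<in> I. \<gamma> s \<in> fst c} = I" using I(3) by auto
  then have "smooth_curve_on I (coord_fun c (i, False) \<circ> \<gamma>)" for i
    using curve_in_chart(2)[OF assms(2) I(1,3,4) open_chart[OF assms(2)] jet_smooth_transition[OF assms(2,2)]] by simp
  then show ?thesis
    using curve_deriv_component(1)[OF I(1) _ I(2), of "snd c \<circ> \<gamma>"] by (simp add: coord_fun_def[abs_def] o_def)
qed

text \<open>
  Equality of derivatives in one chart suffices: the \<open>r\<close>-th derivative in another chart is the value of a
  jet function of order \<open>r\<close>, namely \<open>D\<^sup>r\<close> of the coordinate change.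
\<close>

lemma jet_relI:
  assumes "\<gamma> \<in> curves A" "\<delta> \<in> curves A" and c: "c \<in> A" "\<gamma> 0 \<in> fst c" "\<delta> 0 \<in> fst c"
    and eq: "\<And>r. r \<le> k \<Longrightarrow> curve_deriv r (snd c \<circ> \<gamma>) 0 = curve_deriv r (snd c \<circ> \<delta>) 0"
  shows "(\<gamma>, \<delta>) \<in> jet_rel A k"
  unfolding jet_rel_iff
proof (intro conjI ballI impI allI assms(1,2))
  show 0: "\<gamma> 0 = \<delta> 0" using eq[of 0] c by (simp add: inj_on_eq_iff[OF inj_on_chart])
  fix c' r assume c': "c' \<in> A" "\<gamma> 0 \<in> fst c'" and r: "r \<le> k"
  have "curve_deriv r (snd c' \<circ> \<gamma>) 0 $ i = curve_deriv r (snd c' \<circ> \<delta>) 0 $ i" for i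
  proof -
    define g where "g = coord_fun c' (i, False)"
    have "total_pow r (local_rep c g) (jet_at (snd c \<circ> \<gamma>) 0) = total_pow r (local_rep c g) (jet_at (snd c \<circ> \<delta>) 0)"
      by (rule jet_functionD[OF jet_function_total_pow[OF jet_function_local_rep]]) (use eq r in \<open>simp add: jet_at_def\<close>)
    then show ?thesis
      using curve_deriv_in_chart[OF _ c(1) _ open_chart[OF c'(1)] _ jet_smooth_transition[OF c(1) c'(1)]]
        assms(1,2) c c' 0 by (simp add: curve_deriv_chart_component g_def)
  qed
  then show "curve_deriv r (snd c' \<circ> \<gamma>) 0 = curve_deriv r (snd c' \<circ> \<delta>) 0" by (simp add: vec_eq_iff)
qed

end

section \<open>Coordinates and lifts on the extensions\<close>

text \<open>The coordinates that \<^const>\<open>to_coords\<close> returns for the point with coordinates \<open>p\<close>.\<close>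

definition truncate :: "nat \<Rightarrow> 'm::finite coords \<Rightarrow> 'm coords" where
  "truncate k p = (fst p, \<lambda>r. if r \<le> k then snd p r else 0)"

context atlas
begin

lemma ext_N_curve:
  assumes "P \<in> ext_N A k" "\<gamma> \<in> snd P"
  shows "\<gamma> \<in> curves A" "snd P = jet_rel A k `` {\<gamma>}"
proof -
  obtain \<delta> where \<delta>: "\<delta> \<in> curves A" "snd P = jet_rel A k `` {\<delta>}"
    using assms(1) by (auto simp: ext_N_def ext_M_def quotient_def)
  then have "(\<delta>, \<gamma>) \<in> jet_rel A k" using assms(2) by simp
  then show "\<gamma> \<in> curves A" "snd P = jet_rel A k `` {\<gamma>}"
    using \<delta>(2) equiv_class_eq[OF equiv_jet_rel] by (auto simp: jet_rel_iff)
qed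

lemma ext_NI: "\<gamma> \<in> curves A \<Longrightarrow> snd P = jet_rel A k `` {\<gamma>} \<Longrightarrow> P \<in> ext_N A k"
  by (cases P) (auto simp: ext_N_def ext_M_def intro: quotientI)

lemma curve_in_own_jet: "\<gamma> \<in> curves A \<Longrightarrow> \<gamma> \<in> jet_rel A k `` {\<gamma>}"
  using equiv_class_self[OF equiv_jet_rel] .

lemma ext_N_ex_curve: "P \<in> ext_N A k \<Longrightarrow> \<exists>\<gamma>. \<gamma> \<in> snd P"
  unfolding ext_N_def ext_M_def quotient_def using curve_in_own_jet by fastforce

lemma ext_N_eqI:
  "P \<in> ext_N A k \<Longrightarrow> Q \<in> ext_N A k \<Longrightarrow> fst P = fst Q \<Longrightarrow> \<gamma> \<in> snd P \<Longrightarrow> \<gamma> \<in> snd Q \<Longrightarrow> P = Q"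
  using ext_N_curve(2)[of P k \<gamma>] ext_N_curve(2)[of Q k \<gamma>] by (simp add: prod_eq_iff)

lemma ext_N_related:
  assumes "P \<in> ext_N A k" "\<gamma> \<in> snd P" "\<delta> \<in> snd P" shows "(\<gamma>, \<delta>) \<in> jet_rel A k"
  using ext_N_curve(2)[OF assms(1,2)] assms(3) by simp

lemma base_point_eq:
  assumes "P \<in> ext_N A k" "\<gamma> \<in> snd P" shows "base_point P = \<gamma> 0"
proof -
  have "(SOME \<gamma>. \<gamma> \<in> snd P) \<in> snd P" by (rule someI[of "\<lambda>\<gamma>. \<gamma> \<in> snd P", OF assms(2)])
  from ext_N_related[OF assms this] show ?thesis by (simp add: base_point_def split_def jet_rel_iff)
qed

lemma z_vec_eq:
  assumes "P \<in> ext_N A k" "\<gamma> \<in> snd P" "c \<in> A" "\<gamma> 0 \<in> fst c" "r \<le> k"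
  shows "z_vec c r P = curve_deriv r (snd c \<circ> \<gamma>) 0"
proof -
  have "(SOME \<gamma>. \<gamma> \<in> snd P) \<in> snd P" by (rule someI[of "\<lambda>\<gamma>. \<gamma> \<in> snd P", OF assms(2)])
  from ext_N_related[OF assms(1,2) this] show ?thesis
    using assms(3-5) by (simp add: z_vec_def split_def jet_rel_iff)
qed

lemma ex_curve_with_jet:
  assumes "c \<in> A" "p \<in> coords_dom c"
  shows "\<exists>\<gamma>\<in>curves A. \<gamma> 0 \<in> fst c \<and> (\<forall>r\<le>k. curve_deriv r (snd c \<circ> \<gamma>) 0 = snd p r)"
proof -
  obtain u where u: "smooth_curve_on UNIV u" "\<And>r. r \<le> k \<Longrightarrow> curve_deriv r u 0 = snd p r"
    using polynomial_curve[of k "snd p"] by metis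
  have "continuous_on UNIV u"
    unfolding continuous_on_eq_continuous_at[OF open_UNIV]
    using smooth_curve_onD[OF u(1), of _ 0] has_vector_derivative_continuous by fastforce
  then have I: "open (u -` (snd c ` fst c))" (is "open ?I") using open_chart_image[OF assms(1)] by (simp add: open_vimage)
  have 0: "0 \<in> ?I" using u(2)[of 0] assms(2) by (auto simp: coords_dom_def)
  \<comment> \<open>Outside the preimage of the chart the values of \<open>\<gamma>\<close> are arbitrary.\<close>
  define \<gamma> where "\<gamma> s = inv_into (fst c) (snd c) (u s)" for s
  have \<gamma>: "\<gamma> s \<in> fst c" "(snd c \<circ> \<gamma>) s = u s" if "s \<in> ?I" for s
    using that unfolding \<gamma>_def by (auto simp: f_inv_into_f intro: inv_into_into)
  have eq: "curve_deriv n (snd c \<circ> \<gamma>) 0 = curve_deriv n u 0" for n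
    by (rule curve_deriv_cong(1)[OF I smooth_curve_on_subset[OF u(1) subset_UNIV] \<gamma>(2) 0])
  have "smooth_curve_on ?I (snd c \<circ> \<gamma>)"
    by (rule curve_deriv_cong(2)[OF I smooth_curve_on_subset[OF u(1) subset_UNIV] \<gamma>(2)])
  from curvesI[OF assms(1) I 0 \<gamma>(1) this] have "\<gamma> \<in> curves A" .
  then show ?thesis using \<gamma>(1)[OF 0] eq u(2) by (intro bexI[of _ \<gamma>]) simp_all
qed

lemma fst_of_coords [simp]: "fst (of_coords A k c p) = fst p"
  by (simp add: of_coords_def split_def)

lemma mem_of_coords: "\<gamma> \<in> snd (of_coords A k c p) \<longleftrightarrow>
    \<gamma> \<in> curves A \<and> \<gamma> 0 \<in> fst c \<and> (\<forall>r\<le>k. curve_deriv r (snd c \<circ> \<gamma>) 0 = snd p r)"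
  by (simp add: of_coords_def split_def)

lemma ex_curve_of_coords: "c \<in> A \<Longrightarrow> p \<in> coords_dom c \<Longrightarrow> \<exists>\<gamma>. \<gamma> \<in> snd (of_coords A k c p)"
  using ex_curve_with_jet[of c p k] unfolding mem_of_coords by blast

lemma of_coords_in_ext_N:
  assumes "c \<in> A" "p \<in> coords_dom c" shows "of_coords A k c p \<in> ext_N A k"
proof -
  obtain \<gamma> where \<gamma>: "\<gamma> \<in> snd (of_coords A k c p)" using ex_curve_of_coords assms by blast
  have "snd (of_coords A k c p) = jet_rel A k `` {\<gamma>}"
  proof (intro equalityI subsetI)
    fix \<delta> assume "\<delta> \<in> snd (of_coords A k c p)"
    then show "\<delta> \<in> jet_rel A k `` {\<gamma>}"
      using \<gamma> jet_relI[of \<gamma> \<delta> c k] assms(1) by (simp add: mem_of_coords)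
  next
    fix \<delta> assume "\<delta> \<in> jet_rel A k `` {\<gamma>}"
    then show "\<delta> \<in> snd (of_coords A k c p)" using \<gamma> assms(1) by (auto simp: mem_of_coords jet_rel_iff)
  qed
  then show ?thesis using \<gamma> by (intro ext_NI) (auto simp: mem_of_coords)
qed

lemma base_point_of_coords:
  assumes "c \<in> A" "p \<in> coords_dom c" shows "base_point (of_coords A k c p) = point_of c p"
proof -
  obtain \<gamma> where \<gamma>: "\<gamma> \<in> snd (of_coords A k c p)" using ex_curve_of_coords assms by blast
  have "curve_deriv 0 (snd c \<circ> \<gamma>) 0 = snd p 0" using \<gamma> unfolding mem_of_coords by blast
  then have "point_of c p = \<gamma> 0" using \<gamma> by (intro point_of_eq assms(1)) (auto simp: mem_of_coords)
  then show ?thesis using base_point_eq[OF of_coords_in_ext_N[OF assms] \<gamma>] by simp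
qed

lemma of_coords_in_chart_dom:
  "c \<in> A \<Longrightarrow> p \<in> coords_dom c \<Longrightarrow> of_coords A k c p \<in> chart_dom A k c"
  using point_of_coords(1)[of p c UNIV]
  by (simp add: chart_dom_def of_coords_in_ext_N base_point_of_coords coords_dom_eq)

lemma z_vec_of_coords:
  assumes "c \<in> A" "p \<in> coords_dom c" "r \<le> k" shows "z_vec c r (of_coords A k c p) = snd p r"
proof -
  obtain \<gamma> where \<gamma>: "\<gamma> \<in> snd (of_coords A k c p)" using ex_curve_of_coords assms by blast
  then show ?thesis
    using z_vec_eq[OF of_coords_in_ext_N[OF assms(1,2)] \<gamma> assms(1) _ assms(3)] assms(3) by (simp add: mem_of_coords)
qed

lemma to_coords_of_coords:
  "c \<in> A \<Longrightarrow> p \<in> coords_dom c \<Longrightarrow> to_coords k c (of_coords A k c p) = truncate k p"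
  by (auto simp: to_coords_def truncate_def z_vec_of_coords)

lemma to_coords_curve:
  assumes "P \<in> ext_N A k" "\<gamma> \<in> snd P" "c \<in> A" "\<gamma> 0 \<in> fst c" "r \<le> k"
  shows "snd (to_coords k c P) r = snd (jet_at (snd c \<circ> \<gamma>) 0) r"
  using z_vec_eq[OF assms] assms(5) by (simp add: to_coords_def jet_at_def)

lemma to_coords_in_coords_dom:
  assumes "c \<in> A" "P \<in> chart_dom A k c" shows "to_coords k c P \<in> coords_dom c"
proof -
  have P: "P \<in> ext_N A k" "base_point P \<in> fst c" using assms(2) by (auto simp: chart_dom_def)
  obtain \<gamma> where \<gamma>: "\<gamma> \<in> snd P" using ext_N_ex_curve[OF P(1)] by blast
  then show ?thesis
    using to_coords_curve[OF P(1) \<gamma> assms(1), of 0] P(2) base_point_eq[OF P(1) \<gamma>]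
    by (auto simp: coords_dom_def jet_at_def split_def)
qed

lemma of_coords_to_coords:
  assumes "c \<in> A" "P \<in> chart_dom A k c" shows "of_coords A k c (to_coords k c P) = P"
proof -
  have P: "P \<in> ext_N A k" "base_point P \<in> fst c" using assms(2) by (auto simp: chart_dom_def)
  obtain \<gamma> where \<gamma>: "\<gamma> \<in> snd P" using ext_N_ex_curve[OF P(1)] by blast
  have "\<gamma> 0 \<in> fst c" using P(2) base_point_eq[OF P(1) \<gamma>] by simp
  then have "\<gamma> \<in> snd (of_coords A k c (to_coords k c P))"
    using to_coords_curve[OF P(1) \<gamma> assms(1)] ext_N_curve(1)[OF P(1) \<gamma>] by (simp add: mem_of_coords jet_at_def)
  then show ?thesis
    using ext_N_eqI[OF of_coords_in_ext_N[OF assms(1) to_coords_in_coords_dom[OF assms]] P(1) _ _ \<gamma>]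
    by (simp add: to_coords_def)
qed

lemma of_coords_cong:
  assumes "fst p = fst q" "\<And>r. r \<le> k \<Longrightarrow> snd p r = snd q r"
  shows "of_coords A k c p = of_coords A k c q"
proof -
  have "snd (of_coords A k c p) = snd (of_coords A k c q)"
    using assms(2) by (auto simp: mem_of_coords)
  then show ?thesis using assms(1) by (simp add: prod_eq_iff)
qed

lemma depends_upto_in_coords: "depends_upto k (in_coords A k c f)"
  unfolding depends_upto_def in_coords_def o_def using of_coords_cong by metis

lemma proj_N_in_ext_N:
  assumes "P \<in> ext_N A k" "j \<le> k" "\<gamma> \<in> snd P"
  shows "proj_N A j P \<in> ext_N A j" "\<gamma> \<in> snd (proj_N A j P)" "fst (proj_N A j P) = fst P"
proof -
  note \<gamma> = ext_N_curve[OF assms(1,3)]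
  have "jet_rel A j `` (jet_rel A k `` {\<gamma>}) = jet_rel A j `` {\<gamma>}"
    using jet_rel_mono[OF assms(2)] equiv_jet_rel[of A j] curve_in_own_jet[OF \<gamma>(1), of k]
    unfolding equiv_def by (auto dest: transD)
  then have "snd (proj_N A j P) = jet_rel A j `` {\<gamma>}" by (simp add: proj_N_def split_def \<gamma>(2))
  then show "proj_N A j P \<in> ext_N A j" "\<gamma> \<in> snd (proj_N A j P)"
    using ext_NI[OF \<gamma>(1)] curve_in_own_jet[OF \<gamma>(1)] by auto
  show "fst (proj_N A j P) = fst P" by (simp add: proj_N_def split_def)
qed

lemma proj_N_proj_N:
  assumes "P \<in> ext_N A k" "i \<le> j" "j \<le> k" shows "proj_N A i (proj_N A j P) = proj_N A i P"
proof -
  obtain \<gamma> where \<gamma>: "\<gamma> \<in> snd P" using ext_N_ex_curve[OF assms(1)] by blast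
  note 1 = proj_N_in_ext_N[OF assms(1,3) \<gamma>]
  note 2 = proj_N_in_ext_N[OF 1(1) assms(2) 1(2)]
  note 3 = proj_N_in_ext_N[OF assms(1) order_trans[OF assms(2,3)] \<gamma>]
  show ?thesis by (rule ext_N_eqI[OF 2(1) 3(1) _ 2(2) 3(2)]) (simp add: 1(3) 2(3) 3(3))
qed

lemma proj_N_same:
  assumes "P \<in> ext_N A k" shows "proj_N A k P = P"
proof -
  obtain \<gamma> where \<gamma>: "\<gamma> \<in> snd P" using ext_N_ex_curve[OF assms(1)] by blast
  note 1 = proj_N_in_ext_N[OF assms(1) order_refl \<gamma>]
  show ?thesis by (rule ext_N_eqI[OF 1(1) assms 1(3) 1(2) \<gamma>])
qed

lemma base_point_proj_N:
  assumes "P \<in> ext_N A k" "j \<le> k" shows "base_point (proj_N A j P) = base_point P"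
proof -
  obtain \<gamma> where \<gamma>: "\<gamma> \<in> snd P" using ext_N_ex_curve[OF assms(1)] by blast
  show ?thesis using base_point_eq[OF assms(1) \<gamma>] base_point_eq[OF proj_N_in_ext_N(1,2)[OF assms \<gamma>]] by simp
qed

lemma proj_N_of_coords:
  assumes "c \<in> A" "p \<in> coords_dom c" "j \<le> k"
  shows "proj_N A j (of_coords A k c p) = of_coords A j c p"
proof -
  obtain \<gamma> where \<gamma>: "\<gamma> \<in> snd (of_coords A k c p)" using ex_curve_of_coords assms by blast
  note 1 = proj_N_in_ext_N[OF of_coords_in_ext_N[OF assms(1,2)] assms(3) \<gamma>]
  have "\<gamma> \<in> snd (of_coords A j c p)" using \<gamma> assms(3) by (auto simp: mem_of_coords)
  from ext_N_eqI[OF 1(1) of_coords_in_ext_N[OF assms(1,2)] _ 1(2) this] show ?thesis by (simp add: 1(3))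
qed

lemma vlift_pow_eq:
  "P \<in> ext_N A k \<Longrightarrow> vlift_pow A k f P = f (proj_N A 0 P)"
proof (induction k arbitrary: P)
  case 0
  then show ?case by (simp add: proj_N_same)
next
  case (Suc k)
  obtain \<gamma> where \<gamma>: "\<gamma> \<in> snd P" using ext_N_ex_curve[OF Suc.prems] by blast
  show ?case
    using Suc.IH[OF proj_N_in_ext_N(1)[OF Suc.prems _ \<gamma>]] proj_N_proj_N[OF Suc.prems, of 0 k] by (simp add: vlift_def)
qed

lemma vlift_pow_on_N: "P \<in> ext_N A k \<Longrightarrow> vlift_pow A k (on_N g) P = g (base_point P)"
  by (simp add: vlift_pow_eq on_N_def base_point_proj_N)

lemma in_coords_on_N: "c \<in> A \<Longrightarrow> p \<in> coords_dom c \<Longrightarrow> in_coords A k c (on_N g) p = local_rep c g p"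
  by (simp add: in_coords_def on_N_def base_point_of_coords local_rep_def)

lemma smooth_on_chartI:
  assumes "c \<in> A" "jet_smooth (coords_dom c) F" "\<And>p. p \<in> coords_dom c \<Longrightarrow> in_coords A k c f p = F p"
  shows "smooth_on_chart A k c f"
proof -
  have "jet_smooth (coords_dom c) (in_coords A k c f)"
    by (rule jet_smooth_cong[OF open_coords_dom[OF assms(1)] _ assms(2)]) (simp add: assms(3))
  then show ?thesis by (simp add: smooth_on_chart_def jet_smooth_def)
qed

lemma smooth_on_chartD:
  assumes "c \<in> A" "smooth_on_chart A k c f"
  shows "jet_smooth (coords_dom c) (in_coords A k c f)"
  using assms jet_smooth_iff[OF open_coords_dom[OF assms(1)] depends_upto_in_coords]
  unfolding smooth_on_chart_def by blast

lemma smooth_on_chart_on_N: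
  assumes "c \<in> A" shows "smooth_on_chart A k c (on_N g) \<longleftrightarrow> jet_smooth (coords_dom c) (local_rep c g)"
proof
  assume "smooth_on_chart A k c (on_N g)"
  from smooth_on_chartD[OF assms this] show "jet_smooth (coords_dom c) (local_rep c g)"
    by (rule jet_smooth_cong[OF open_coords_dom[OF assms], rotated]) (simp add: in_coords_on_N[OF assms])
next
  assume "jet_smooth (coords_dom c) (local_rep c g)"
  then show "smooth_on_chart A k c (on_N g)" by (rule smooth_on_chartI[OF assms]) (rule in_coords_on_N[OF assms])
qed

lemma smooth_fun_M_iff: "g \<in> smooth_fun_M A \<longleftrightarrow> (\<forall>c\<in>A. jet_smooth (coords_dom c) (local_rep c g))"
  by (simp add: smooth_fun_M_def smooth_on_chart_on_N)

lemma chart_at: "chart_at A x \<in> A" "x \<in> fst (chart_at A x)"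
proof -
  have "\<exists>c. c \<in> A \<and> x \<in> fst c" using ex_chart by blast
  from someI_ex[OF this] show "chart_at A x \<in> A" "x \<in> fst (chart_at A x)" by (simp_all add: chart_at_def)
qed

text \<open>
  The recursion for the complete lift uses, at every order, a chart chosen at the point in question, so the
  lift of order \<open>k\<close> has to be known near a point independently of charts before it can be differentiated.
  The description by derivatives along curves provides this: it yields the expression \<open>D\<^sup>k\<close> in any chart,
  and from that the description of the next order. Besides functions on \<open>M\<close> themselves, the
  lemma is meant for \<open>h = Z f\<close> with a vector field \<open>Z\<close>, which comes from a function on \<open>M\<close> only at the
  points of \<open>N\<close>.
\<close>

lemma clift_pow_eq:
  assumes g: "g \<in> smooth_fun_M A" and h: "\<And>Q. Q \<in> ext_N A 0 \<Longrightarrow> h Q = g (base_point Q)"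
  shows "P \<in> ext_N A k \<Longrightarrow> \<gamma> \<in> snd P \<Longrightarrow> clift_pow A k h P = curve_deriv k (g \<circ> \<gamma>) 0"
    and "c \<in> A \<Longrightarrow> p \<in> coords_dom c \<Longrightarrow> in_coords A k c (clift_pow A k h) p = total_pow k (local_rep c g) p"
proof -
  have smooth: "jet_smooth (coords_over c UNIV) (local_rep c g)" if "c \<in> A" for c
    using g that by (simp add: smooth_fun_M_iff coords_dom_eq)
  have step: "in_coords A k c (clift_pow A k h) p = total_pow k (local_rep c g) p"
    if IH: "\<And>P \<gamma>. P \<in> ext_N A k \<Longrightarrow> \<gamma> \<in> snd P \<Longrightarrow> clift_pow A k h P = curve_deriv k (g \<circ> \<gamma>) 0"
      and c: "c \<in> A" "p \<in> coords_dom c" for k c p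
  proof -
    obtain \<gamma> where \<gamma>: "\<gamma> \<in> snd (of_coords A k c p)" using ex_curve_of_coords[OF c] by blast
    then have "in_coords A k c (clift_pow A k h) p = curve_deriv k (g \<circ> \<gamma>) 0"
      by (simp add: in_coords_def IH[OF of_coords_in_ext_N[OF c]])
    also have "\<dots> = total_pow k (local_rep c g) (jet_at (snd c \<circ> \<gamma>) 0)"
      using \<gamma> by (intro curve_deriv_in_chart[OF _ c(1) _ open_UNIV UNIV_I smooth[OF c(1)]]) (auto simp: mem_of_coords)
    also have "\<dots> = total_pow k (local_rep c g) p"
      by (rule jet_functionD[OF jet_function_total_pow[OF jet_function_local_rep]])
         (use \<gamma> in \<open>simp add: mem_of_coords jet_at_def\<close>)
    finally show ?thesis .
  qed
  have *: "clift_pow A k h P = curve_deriv k (g \<circ> \<gamma>) 0" if "P \<in> ext_N A k" "\<gamma> \<in> snd P" for P \<gamma> k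
    using that
  proof (induction k arbitrary: P \<gamma>)
    case 0
    then show ?case by (simp add: h base_point_eq[OF 0])
  next
    case (Suc k)
    define c where "c = chart_at A (base_point P)"
    define G where "G = total_pow k (local_rep c g)"
    define q where "q = jet_at (snd c \<circ> \<gamma>) 0"
    define p where "p = to_coords k c (proj_N A k P)"
    have c: "c \<in> A" "\<gamma> 0 \<in> fst c"
      using chart_at[of "\<gamma> 0"] base_point_eq[OF Suc.prems] by (simp_all add: c_def)
    note proj = proj_N_in_ext_N[OF Suc.prems(1) _ Suc.prems(2), of k, simplified]
    have P': "proj_N A k P \<in> chart_dom A k c"
      using c proj base_point_eq[OF proj(1,2)] by (simp add: chart_dom_def)
    have p: "p \<in> coords_dom c" unfolding p_def by (rule to_coords_in_coords_dom[OF c(1) P'])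
    have G: "jet_function k G" unfolding G_def by (rule jet_function_total_pow[OF jet_function_local_rep])
    have pq: "F p = F q" if "jet_function k F" for F :: "'m coords \<Rightarrow> complex"
      by (rule jet_functionD[OF that]) (simp add: p_def q_def to_coords_curve[OF proj(1,2) c])
    have loc: "in_coords A k c (clift_pow A k h) p = G p" if "p \<in> coords_dom c" for p
      unfolding G_def by (rule step[OF Suc.IH c(1) that])
    have "vlift A k (partial_t A k c (clift_pow A k h)) P = 0"
      using pd_cong[OF open_coords_dom[OF c(1)] p loc, where j = None] d_time_jet_function[OF G]
      by (simp add: vlift_def partial_t_def p_def d_time_eq)
    moreover have wirtinger: "wirtinger l (in_coords A k c (clift_pow A k h)) p = wirtinger l G q" for l
      using wirtinger_cong[OF open_coords_dom[OF c(1)] p loc] pq[OF jet_function_wirtinger[OF G]] by simp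
    have "vlift A k (partial_z A k c r i (clift_pow A k h)) P = wirtinger (r, i, False) G q"
      "vlift A k (partial_zbar A k c r i (clift_pow A k h)) P = wirtinger (r, i, True) G q" for r i
      using wirtinger[of "(r, i, False)"] wirtinger[of "(r, i, True)"]
      by (simp_all add: vlift_def partial_z_def partial_zbar_def p_def wirtinger_def)
    moreover have "z_coord c (Suc r) i P = coordinate (next_order (r, i, False)) q"
      "zbar_coord c (Suc r) i P = coordinate (next_order (r, i, True)) q" if "r \<le> k" for r i
      using z_vec_eq[OF Suc.prems c, of "Suc r"] that
      by (simp_all add: z_coord_def zbar_coord_def next_order_def coordinate_def q_def jet_at_def)
    ultimately have "clift_pow A (Suc k) h P = total_deriv k G q"
      by (simp add: clift_def Let_def c_def[symmetric] total_deriv_def sum_cdirs)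
    also have "\<dots> = curve_deriv (Suc k) (g \<circ> \<gamma>) 0"
      using curve_deriv_in_chart[OF ext_N_curve(1)[OF Suc.prems] c open_UNIV UNIV_I smooth[OF c(1)], of "Suc k"]
      by (simp add: G_def q_def)
    finally show ?case .
  qed
  show "P \<in> ext_N A k \<Longrightarrow> \<gamma> \<in> snd P \<Longrightarrow> clift_pow A k h P = curve_deriv k (g \<circ> \<gamma>) 0" by (rule *)
  show "c \<in> A \<Longrightarrow> p \<in> coords_dom c \<Longrightarrow> in_coords A k c (clift_pow A k h) p = total_pow k (local_rep c g) p"
    by (rule step[OF *])
qed

end

section \<open>Tangent vectors and change of charts\<close>

text \<open>Tangent vectors with coefficients indexed by all complex directions.\<close>

definition tvec_of ::
  "('a, 'm::finite) chart set \<Rightarrow> nat \<Rightarrow> ('a, 'm) chart \<Rightarrow> 'a ext_point \<Rightarrow> complex \<Rightarrow> ('m cdir \<Rightarrow> complex) \<Rightarrow> 'a tvec" where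
  "tvec_of A k c P a \<beta> = coord_tvec A k c P a (\<lambda>r i. \<beta> (r, i, False)) (\<lambda>r i. \<beta> (r, i, True))"

lemma coord_tvec_eq_tvec_of:
  "coord_tvec A k c P a b b' = tvec_of A k c P a (\<lambda>(r, i, e). if e then b' r i else b r i)"
  by (simp add: tvec_of_def)

lemma tvec_of_apply:
  "tvec_of A k c P a \<beta> f = (if smooth_near A k P f
     then a * d_time (in_coords A k c f) (to_coords k c P)
        + (\<Sum>l\<in>cdirs k. \<beta> l * wirtinger l (in_coords A k c f) (to_coords k c P)) else 0)"
  by (simp add: tvec_of_def coord_tvec_def partial_t_def partial_z_def partial_zbar_def sum_cdirs wirtinger_def)

lemma tvec_of_cong: "(\<And>l. l \<in> cdirs k \<Longrightarrow> \<beta> l = \<beta>' l) \<Longrightarrow> tvec_of A k c P a \<beta> = tvec_of A k c P a \<beta>'"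
  by (rule ext) (simp add: tvec_of_apply)

lemma tangent_iff: "v \<in> tangent A k P \<longleftrightarrow> (\<exists>c\<in>A. P \<in> chart_dom A k c \<and> (\<exists>a \<beta>. v = tvec_of A k c P a \<beta>))"
  unfolding tangent_def by (auto simp: coord_tvec_eq_tvec_of) (auto simp: tvec_of_def)

context atlas
begin

lemma smooth_nearE:
  assumes "smooth_near A k P f"
  obtains c S where "c \<in> A" "P \<in> chart_dom A k c" "open S" "to_coords k c P \<in> S" "S \<subseteq> coords_dom c"
    "jet_smooth S (in_coords A k c f)"
  using assms jet_smooth_iff[OF _ depends_upto_in_coords] unfolding smooth_near_def by blast

lemma smooth_nearI:
  assumes "c \<in> A" "P \<in> chart_dom A k c" "open S" "to_coords k c P \<in> S" "S \<subseteq> coords_dom c"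
    "jet_smooth S (in_coords A k c f)"
  shows "smooth_near A k P f"
  using assms unfolding smooth_near_def jet_smooth_def by blast

lemma smooth_on_chart_imp_smooth_near:
  assumes "c \<in> A" "P \<in> chart_dom A k c" "smooth_on_chart A k c f"
  shows "smooth_near A k P f"
  by (rule smooth_nearI[OF assms(1,2) open_coords_dom[OF assms(1)] to_coords_in_coords_dom[OF assms(1,2)]
        order_refl smooth_on_chartD[OF assms(1,3)]])

lemma chart_domI: "P \<in> ext_N A k \<Longrightarrow> base_point P \<in> fst c \<Longrightarrow> P \<in> chart_dom A k c"
  by (simp add: chart_dom_def)

lemma chart_domD: "P \<in> chart_dom A k c \<Longrightarrow> P \<in> ext_N A k" "P \<in> chart_dom A k c \<Longrightarrow> base_point P \<in> fst c"
  by (simp_all add: chart_dom_def)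

lemma point_of_to_coords:
  assumes "c \<in> A" "P \<in> chart_dom A k c" shows "point_of c (to_coords k c P) = base_point P"
  using base_point_of_coords[OF assms(1) to_coords_in_coords_dom[OF assms], of k] by (simp add: of_coords_to_coords[OF assms])

lemma of_coords_in_other_chart_dom:
  assumes "c \<in> A" "p \<in> coords_over c (fst c')" shows "of_coords A k c p \<in> chart_dom A k c'"
  using assms by (intro chart_domI) (auto simp: coords_over_iff of_coords_in_ext_N base_point_of_coords)

lemma to_coords_in_coords_over:
  assumes "c \<in> A" "P \<in> chart_dom A k c" "P \<in> chart_dom A k c'"
  shows "to_coords k c P \<in> coords_over c (fst c')"
  using assms by (simp add: coords_over_iff point_of_to_coords to_coords_in_coords_dom chart_domD)

lemma total_pow_at_curve:
  assumes "P \<in> ext_N A k" "\<gamma> \<in> snd P" "c \<in> A" "\<gamma> 0 \<in> fst c" "r \<le> k"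
  shows "total_pow r (local_rep c g) (to_coords k c P) = total_pow r (local_rep c g) (jet_at (snd c \<circ> \<gamma>) 0)"
  by (rule jet_functionD[OF jet_function_total_pow[OF jet_function_local_rep]])
     (use to_coords_curve[OF assms(1-4)] assms(5) in simp)

lemma total_pow_chart_independent:
  assumes c: "c \<in> A" "P \<in> chart_dom A k c" and c': "c' \<in> A" "P \<in> chart_dom A k c'" and r: "r \<le> k"
    and V: "open V" "base_point P \<in> V"
    and g: "jet_smooth (coords_over c V) (local_rep c g)" "jet_smooth (coords_over c' V) (local_rep c' g)"
  shows "total_pow r (local_rep c g) (to_coords k c P) = total_pow r (local_rep c' g) (to_coords k c' P)"
proof -
  note P = chart_domD[OF c(2)] chart_domD[OF c'(2)]
  obtain \<gamma> where \<gamma>: "\<gamma> \<in> snd P" using ext_N_ex_curve[OF P(1)] by blast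
  have "\<gamma> 0 = base_point P" using base_point_eq[OF P(1) \<gamma>] by simp
  then show ?thesis
    using curve_deriv_in_chart[OF ext_N_curve(1)[OF P(1) \<gamma>] c(1) _ V(1) _ g(1)]
      curve_deriv_in_chart[OF ext_N_curve(1)[OF P(1) \<gamma>] c'(1) _ V(1) _ g(2)] P V(2)
    by (simp add: total_pow_at_curve[OF P(1) \<gamma> _ _ r] c(1) c'(1))
qed

text \<open>
  The coordinates of order \<open>r\<close> in the chart \<open>c'\<close>, seen in the chart \<open>c\<close>, are \<open>D\<^sup>r\<close> of the coordinate change,
  since both are \<open>r\<close>-th derivatives along a curve.
\<close>

lemma coordinate_to_coords:
  assumes "c \<in> A" "p \<in> coords_over c (fst c')" "c' \<in> A" "l \<in> cdirs k"
  shows "coordinate l (to_coords k c' (of_coords A k c p)) = total_pow (fst l) (local_rep c (coord_fun c' (snd l))) p"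
proof -
  obtain r i e where l: "l = (r, i, e)" by (cases l)
  have r: "r \<le> k" using assms(4) by (simp add: l)
  define P where "P = of_coords A k c p"
  have p: "p \<in> coords_dom c" using assms(2) coords_over_subset by blast
  have P: "P \<in> chart_dom A k c" "P \<in> chart_dom A k c'"
    unfolding P_def by (intro of_coords_in_chart_dom of_coords_in_other_chart_dom assms p)+
  note P' = chart_domD[OF P(1)] chart_domD[OF P(2)]
  obtain \<gamma> where \<gamma>: "\<gamma> \<in> snd P" using ext_N_ex_curve[OF P'(1)] by blast
  have \<gamma>0: "\<gamma> 0 = base_point P" using base_point_eq[OF P'(1) \<gamma>] by simp
  have cur: "curve_deriv r (coord_fun c' m \<circ> \<gamma>) 0 = total_pow r (local_rep c (coord_fun c' m)) p" for m
  proof -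
    have "curve_deriv r (coord_fun c' m \<circ> \<gamma>) 0 = total_pow r (local_rep c (coord_fun c' m)) (jet_at (snd c \<circ> \<gamma>) 0)"
      using P' \<gamma>0 by (intro curve_deriv_in_chart[OF ext_N_curve(1)[OF P'(1) \<gamma>] assms(1) _ open_chart[OF assms(3)] _
         jet_smooth_transition[OF assms(1,3)]]) auto
    also have "\<dots> = total_pow r (local_rep c (coord_fun c' m)) p"
      by (rule jet_functionD[OF jet_function_total_pow[OF jet_function_local_rep]])
         (use \<gamma> r in \<open>simp add: P_def mem_of_coords jet_at_def\<close>)
    finally show ?thesis .
  qed
  have cur': "curve_deriv r (coord_fun c' m \<circ> \<gamma>) 0 = total_pow r (local_rep c' (coord_fun c' m)) (jet_at (snd c' \<circ> \<gamma>) 0)" for m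
    using P' \<gamma>0 by (intro curve_deriv_in_chart[OF ext_N_curve(1)[OF P'(1) \<gamma>] assms(3) _ open_chart[OF assms(3)] _
         jet_smooth_transition[OF assms(3,3)]]) auto
  have "snd (to_coords k c' P) r $ i = curve_deriv r (coord_fun c' (i, False) \<circ> \<gamma>) 0"
    using to_coords_curve[OF P'(1) \<gamma> assms(3) _ r] P'(4) \<gamma>0
      curve_deriv_chart_component[OF ext_N_curve(1)[OF P'(1) \<gamma>] assms(3)]
    by (simp add: jet_at_def)
  moreover have "curve_deriv r (coord_fun c' (i, True) \<circ> \<gamma>) 0 = cnj (curve_deriv r (coord_fun c' (i, False) \<circ> \<gamma>) 0)"
  proof -
    obtain I where I: "open I" "0 \<in> I" "\<And>s. s \<in> I \<Longrightarrow> \<gamma> s \<in> fst c'" "smooth_curve_on I (snd c' \<circ> \<gamma>)"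
      using curvesE[OF ext_N_curve(1)[OF P'(1) \<gamma>] assms(3)] P'(4) \<gamma>0 by metis
    have "{s \<in> I. \<gamma> s \<in> fst c'} = I" using I(3) by auto
    then have "smooth_curve_on I (coord_fun c' (i, False) \<circ> \<gamma>)"
      using curve_in_chart(2)[OF assms(3) I(1,3,4) open_chart[OF assms(3)] jet_smooth_transition[OF assms(3,3)]] by simp
    from has_vector_derivative_cnj[OF smooth_curve_onD[OF this]]
    show ?thesis
      using curve_deriv_unique(1)[where g = "coord_fun c' (i, True) \<circ> \<gamma>" and I = I
        and G = "\<lambda>n s. cnj (curve_deriv n (coord_fun c' (i, False) \<circ> \<gamma>) s)", OF I(1) _ _ I(2)]
      by (simp add: coord_fun_def)
  qed
  ultimately show ?thesis by (cases e) (simp_all add: l coordinate_def cur P_def[symmetric])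
qed

definition transition :: "nat \<Rightarrow> ('a, 'm) chart \<Rightarrow> ('a, 'm) chart \<Rightarrow> 'm coords \<Rightarrow> 'm coords" where
  "transition k c c' q = to_coords k c' (of_coords A k c q)"

lemma fst_transition: "fst (transition k c c' q) = fst q"
  by (simp add: transition_def to_coords_def)

lemma transition_facts:
  assumes c: "c \<in> A" "c' \<in> A"
  shows jet_smooth_coordinate_transition:
      "l \<in> cdirs k \<Longrightarrow> jet_smooth (coords_over c (fst c')) (\<lambda>q. coordinate l (transition k c c' q))"
    and continuous_on_transition: "continuous_on (coords_over c (fst c')) (transition k c c')"
proof -
  define O' where "O' = coords_over c (fst c')"
  have O': "open O'" unfolding O'_def by (intro open_coords_over open_chart c)
  have smooth: "jet_smooth O' (\<lambda>q. coordinate l (transition k c c' q))" if "l \<in> cdirs k" for l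
  proof (rule jet_smooth_cong[OF O'])
    show "jet_smooth O' (total_pow (fst l) (local_rep c (coord_fun c' (snd l))))"
      unfolding O'_def by (intro jet_smooth_total_pow jet_smooth_transition open_coords_over open_chart c)
  qed (use coordinate_to_coords[OF c(1) _ c(2) that] in \<open>simp add: O'_def transition_def\<close>)
  have "continuous_on O' (\<lambda>q. snd (transition k c c' q) r)" for r
  proof (cases "r \<le> k")
    case True
    have "continuous_on O' (\<lambda>q. \<chi> i. coordinate (r, i, False) (transition k c c' q))"
      by (intro continuous_on_vec_lambda jet_smooth_continuous smooth) (use True in simp)
    then show ?thesis by (simp add: coordinate_def)
  qed (simp add: transition_def to_coords_def)
  then have "continuous_on O' (\<lambda>q. (fst q, snd (transition k c c' q)))"
    by (intro continuous_on_Pair continuous_on_fst continuous_on_id continuous_on_coordinatewise_then_product)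
  then have "continuous_on O' (transition k c c')"
    using fst_transition by (metis (no_types, lifting) continuous_on_cong prod.collapse)
  then show "continuous_on (coords_over c (fst c')) (transition k c c')" by (simp add: O'_def)
  show "l \<in> cdirs k \<Longrightarrow> jet_smooth (coords_over c (fst c')) (\<lambda>q. coordinate l (transition k c c' q))"
    using smooth by (simp add: O'_def)
qed

text \<open>
  The transformation law for tangent vectors. The function \<open>f\<close> is only assumed to be smooth in the
  coordinates of \<open>c'\<close>, and is differentiated in those of \<open>c\<close> by the chain rule.
\<close>

lemma change_of_chart:
  assumes c: "c \<in> A" "P \<in> chart_dom A k c" and c': "c' \<in> A" "P \<in> chart_dom A k c'"
    and S': "open S'" "to_coords k c' P \<in> S'" "S' \<subseteq> coords_dom c'" and f: "jet_smooth S' (in_coords A k c' f)"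
  shows "a * d_time (in_coords A k c f) (to_coords k c P) + (\<Sum>m\<in>cdirs k. \<beta> m * wirtinger m (in_coords A k c f) (to_coords k c P))
    = a * d_time (in_coords A k c' f) (to_coords k c' P) + (\<Sum>l\<in>cdirs k.
       (\<Sum>m\<in>cdirs k. \<beta> m * wirtinger m (total_pow (fst l) (local_rep c (coord_fun c' (snd l)))) (to_coords k c P))
         * wirtinger l (in_coords A k c' f) (to_coords k c' P))"
proof -
  define F where "F = in_coords A k c f"
  define F' where "F' = in_coords A k c' f"
  define p where "p = to_coords k c P"
  define T where "T = transition k c c'"
  define \<tau> where "\<tau> l = total_pow (fst l) (local_rep c (coord_fun c' (snd l)))" for l :: "'m cdir"
  define O' where "O' = coords_over c (fst c')"
  have O': "open O'" unfolding O'_def by (intro open_coords_over open_chart c c')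
  have fst_T: "fst (T q) = fst q" for q by (simp add: T_def fst_transition)
  have coordinate_T: "coordinate l (T q) = \<tau> l q" if "q \<in> O'" "l \<in> cdirs k" for q l
    unfolding T_def transition_def \<tau>_def using coordinate_to_coords[OF c(1) _ c'(1)] that by (simp add: O'_def)
  have T: "continuous_on O' T" unfolding T_def O'_def by (rule continuous_on_transition[OF c(1) c'(1)])
  define S where "S = T -` S' \<inter> O'"
  have S: "open S" unfolding S_def using continuous_on_open_vimage[OF O'] T S'(1) by blast
  have Tp: "T p = to_coords k c' P" by (simp add: T_def transition_def p_def of_coords_to_coords[OF c])
  have p: "p \<in> S" unfolding S_def using S'(2) to_coords_in_coords_over[OF c c'(2)] by (simp add: Tp O'_def p_def[symmetric])
  have F_eq: "F q = F' (T q)" if "q \<in> S" for q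
  proof -
    have "of_coords A k c q \<in> chart_dom A k c'"
      using that by (intro of_coords_in_other_chart_dom c) (simp add: S_def O'_def)
    from of_coords_to_coords[OF c'(1) this] show ?thesis by (simp add: F_def F'_def in_coords_def T_def transition_def)
  qed
  have coordinate_smooth: "jet_smooth S (\<lambda>q. coordinate l (T q))" if "l \<in> cdirs k" for l
    unfolding T_def by (rule jet_smooth_subset[OF jet_smooth_coordinate_transition[OF c(1) c'(1) that]]) (auto simp: S_def O'_def)
  have coordinate_wirtinger: "wirtinger m (\<lambda>q. coordinate l (T q)) p = wirtinger m (\<tau> l) p" if "l \<in> cdirs k" for l m
    by (rule wirtinger_cong[OF S p]) (use that in \<open>auto simp: coordinate_T S_def\<close>)
  have coordinate_time: "d_time (\<lambda>q. coordinate l (T q)) p = 0" if "l \<in> cdirs k" for l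
  proof -
    have "d_time (\<lambda>q. coordinate l (T q)) p = d_time (\<tau> l) p"
      unfolding d_time_eq by (rule pd_cong[OF S p]) (use that in \<open>auto simp: coordinate_T S_def\<close>)
    then show ?thesis
      using d_time_jet_function[OF jet_function_total_pow[OF jet_function_local_rep]] by (simp add: \<tau>_def)
  qed
  have TS: "q \<in> S \<Longrightarrow> T q \<in> S'" for q by (simp add: S_def)
  note comp = S S'(1) TS fst_T coordinate_smooth depends_upto_in_coords f p
  have "wirtinger m F p = (\<Sum>l\<in>cdirs k. wirtinger m (\<tau> l) p * wirtinger l F' (T p))" for m
  proof -
    have "wirtinger m F p = wirtinger m (\<lambda>q. F' (T q)) p" by (rule wirtinger_cong[OF S p F_eq])
    also have "\<dots> = (\<Sum>l\<in>cdirs k. wirtinger m (\<lambda>q. coordinate l (T q)) p * wirtinger l F' (T p))"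
      unfolding F'_def by (rule wirtinger_compose[OF comp])
    finally show ?thesis by (simp add: coordinate_wirtinger)
  qed
  moreover have "d_time F p = d_time F' (T p)"
  proof -
    have "d_time F p = d_time (\<lambda>q. F' (T q)) p" unfolding d_time_eq by (rule pd_cong[OF S p F_eq])
    also have "\<dots> = d_time F' (T p) + (\<Sum>l\<in>cdirs k. d_time (\<lambda>q. coordinate l (T q)) p * wirtinger l F' (T p))"
      unfolding F'_def by (rule d_time_compose[OF comp])
    finally show ?thesis by (simp add: coordinate_time)
  qed
  moreover have "(\<Sum>m\<in>cdirs k. \<beta> m * (\<Sum>l\<in>cdirs k. wirtinger m (\<tau> l) p * wirtinger l F' (T p))) =
      (\<Sum>l\<in>cdirs k. (\<Sum>m\<in>cdirs k. \<beta> m * wirtinger m (\<tau> l) p) * wirtinger l F' (T p))"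
    unfolding sum_distrib_left sum_distrib_right by (subst sum.swap) (simp add: mult.assoc)
  ultimately show ?thesis
    unfolding F_def[symmetric] F'_def[symmetric] p_def[symmetric] Tp[symmetric] \<tau>_def[symmetric] by simp
qed

lemma jet_smooth_change_of_chart:
  assumes c: "c \<in> A" "c' \<in> A" and V: "open V" and g: "jet_smooth (coords_over c V) (local_rep c g)"
  shows "jet_smooth (coords_over c' (fst c \<inter> V)) (local_rep c' g)"
proof -
  define S where "S = coords_over c' (fst c \<inter> V)"
  have S: "open S" unfolding S_def by (intro open_coords_over open_chart open_Int c V)
  have sub: "S \<subseteq> coords_over c' (fst c)" by (auto simp: S_def coords_over_def)
  have pt: "transition 0 c' c q \<in> coords_dom c" "point_of c (transition 0 c' c q) = point_of c' q" if "q \<in> S" for q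
  proof -
    have q: "q \<in> coords_over c' (fst c)" using that sub by blast
    have dom: "of_coords A 0 c' q \<in> chart_dom A 0 c" by (rule of_coords_in_other_chart_dom[OF c(2) q])
    show "transition 0 c' c q \<in> coords_dom c"
      unfolding transition_def by (rule to_coords_in_coords_dom[OF c(1) dom])
    show "point_of c (transition 0 c' c q) = point_of c' q"
      using point_of_to_coords[OF c(1) dom] base_point_of_coords[OF c(2) subsetD[OF coords_over_subset q]]
      by (simp add: transition_def)
  qed
  have "jet_smooth S (\<lambda>q. local_rep c g (transition 0 c' c q))"
  proof (rule jet_smooth_compose[OF S open_coords_over[OF c(1) V] _ fst_transition])
    show "transition 0 c' c q \<in> coords_over c V" if "q \<in> S" for q
      using that pt[OF that] by (simp add: coords_over_iff c S_def)
    show "jet_smooth S (\<lambda>q. coordinate l (transition 0 c' c q))" if "l \<in> cdirs 0" for l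
      by (rule jet_smooth_subset[OF jet_smooth_coordinate_transition[OF c(2,1) that] sub])
  qed (rule continuous_on_subset[OF continuous_on_transition[OF c(2,1)] sub],
       rule jet_function_imp_depends_upto[OF jet_function_local_rep], rule g)
  then show ?thesis
    unfolding S_def[symmetric] by (rule jet_smooth_cong[OF S, rotated]) (simp add: local_rep_def pt)
qed

lemma jet_smooth_coords_domI:
  assumes c: "c \<in> A" and V: "open V" "open V'" "fst c \<subseteq> V \<union> V'"
    and g: "jet_smooth (coords_over c V) (local_rep c g)" "jet_smooth (coords_over c V') (local_rep c g)"
  shows "jet_smooth (coords_dom c) (local_rep c g)"
proof -
  have "coords_dom c = \<Union>{coords_over c V, coords_over c V'}"
    using V(3) by (auto simp: coords_dom_eq coords_over_def)
  moreover have "jet_smooth (\<Union>{coords_over c V, coords_over c V'}) (local_rep c g)"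
    by (rule jet_smooth_Union) (use g open_coords_over[OF c] V in auto)
  ultimately show ?thesis by simp
qed

end

section \<open>Complete lifts of vector fields\<close>

context atlas
begin

text \<open>
  The coefficients of one vector field in all charts. The second condition is the transformation law: the
  coefficient for a coordinate of the chart \<open>c'\<close> is the result of applying the field, written in the
  chart \<open>c\<close>, to this coordinate.
\<close>

definition vector_family :: "(('a, 'm) chart \<Rightarrow> 'm \<times> bool \<Rightarrow> 'a \<Rightarrow> complex) \<Rightarrow> bool" where
  "vector_family X \<longleftrightarrow>
     (\<forall>c\<in>A. \<forall>m. jet_smooth (coords_dom c) (local_rep c (X c m))) \<and>
     (\<forall>c\<in>A. \<forall>c'\<in>A. \<forall>m. \<forall>p\<in>coords_over c (fst c').
        local_rep c (X c' m) p = prolong 0 (\<lambda>m. local_rep c (X c m)) (local_rep c (coord_fun c' m)) p)"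

definition lift_coeff ::
  "(('a, 'm) chart \<Rightarrow> 'm \<times> bool \<Rightarrow> 'a \<Rightarrow> complex) \<Rightarrow> nat \<Rightarrow> ('a, 'm) chart \<Rightarrow> 'a ext_point \<Rightarrow> 'm cdir \<Rightarrow> complex" where
  "lift_coeff X k c P l = total_pow (fst l) (local_rep c (X c (snd l))) (to_coords k c P)"

definition lifted_field ::
  "(('a, 'm) chart \<Rightarrow> 'm \<times> bool \<Rightarrow> 'a \<Rightarrow> complex) \<Rightarrow> nat \<Rightarrow> 'a vfield" where
  "lifted_field X k P =
     (let c = chart_at A (base_point P) in tvec_of A k c P 1 (lift_coeff X k c P))"

lemma vector_family_smooth:
  assumes "vector_family X" "c \<in> A" shows "jet_smooth (coords_dom c) (local_rep c (X c m))"
  using assms unfolding vector_family_def by blast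

text \<open>
  By \<open>change_of_chart\<close> the coefficient for a coordinate of order \<open>r\<close> in \<open>c'\<close> is the prolongation applied to
  \<open>D\<^sup>r \<tau>\<close>, with \<open>\<tau>\<close> the coordinate change. The prolongation passes through \<open>D\<^sup>r\<close>, and applied to \<open>\<tau>\<close> it
  gives the coefficient of the field in the chart \<open>c'\<close>.
\<close>

lemma lift_tvec_apply:
  assumes X: "vector_family X"
    and c: "c \<in> A" "P \<in> chart_dom A k c" and c': "c' \<in> A" "P \<in> chart_dom A k c'"
    and S': "open S'" "to_coords k c' P \<in> S'" "S' \<subseteq> coords_dom c'" and f: "jet_smooth S' (in_coords A k c' f)"
  shows "tvec_of A k c P 1 (lift_coeff X k c P) f =
    d_time (in_coords A k c' f) (to_coords k c' P) +
    (\<Sum>l\<in>cdirs k. lift_coeff X k c' P l * wirtinger l (in_coords A k c' f) (to_coords k c' P))"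
proof -
  define p where "p = to_coords k c P"
  define \<xi> where "\<xi> m = local_rep c (X c m)" for m
  define O' where "O' = coords_over c (fst c')"
  have O': "open O'" unfolding O'_def by (intro open_coords_over open_chart c c')
  have p: "p \<in> O'" unfolding p_def O'_def by (rule to_coords_in_coords_over[OF c c'(2)])
  have \<xi>: "jet_function 0 (\<xi> m)" "jet_smooth O' (\<xi> m)" for m
    unfolding \<xi>_def O'_def
    by (rule jet_function_local_rep, rule jet_smooth_subset[OF vector_family_smooth[OF X c(1)] coords_over_subset])
  have trans: "jet_smooth O' (local_rep c (coord_fun c' m))" for m
    unfolding O'_def by (rule jet_smooth_transition[OF c(1) c'(1)])
  have X': "local_rep c (X c' m) q = prolong 0 \<xi> (local_rep c (coord_fun c' m)) q" if "q \<in> O'" for m q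
    using X[unfolded vector_family_def, THEN conjunct2, rule_format, OF c(1) c'(1)] that
    by (simp add: O'_def \<xi>_def[abs_def])
  have X'_smooth: "jet_smooth O' (local_rep c (X c' m))" for m
    by (rule jet_smooth_cong[OF O' X'[symmetric] jet_smooth_prolong[OF O' trans \<xi>(2)]])
  have X'_smooth': "jet_smooth (coords_over c' (fst c')) (local_rep c' (X c' m))" for m
    by (rule jet_smooth_subset[OF vector_family_smooth[OF X c'(1)] coords_over_subset])
  have "(\<Sum>m\<in>cdirs k. lift_coeff X k c P m * wirtinger m (total_pow (fst l) (local_rep c (coord_fun c' (snd l)))) p)
      = lift_coeff X k c' P l" if "l \<in> cdirs k" for l
  proof -
    obtain r m where l: "l = (r, m)" by (cases l)
    have r: "r \<le> k" using that by (cases m) (simp add: l)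
    have "(\<Sum>l\<in>cdirs k. lift_coeff X k c P l * wirtinger l (total_pow r (local_rep c (coord_fun c' m))) p)
       = prolong k \<xi> (total_pow r (local_rep c (coord_fun c' m))) p"
      by (simp add: prolong_def lift_coeff_def \<xi>_def p_def)
    also have "\<dots> = prolong r \<xi> (total_pow r (local_rep c (coord_fun c' m))) p"
      by (rule prolong_more[OF jet_function_total_pow[OF jet_function_local_rep] r])
    also have "\<dots> = total_pow r (prolong 0 \<xi> (local_rep c (coord_fun c' m))) p"
      by (rule prolong_total_pow[OF O' p jet_function_local_rep trans \<xi>])
    also have "\<dots> = total_pow r (local_rep c (X c' m)) p"
      by (rule total_pow_cong[OF O' X'[symmetric] p])
    also have "\<dots> = lift_coeff X k c' P l"
      unfolding lift_coeff_def l p_def fst_conv snd_conv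
      by (rule total_pow_chart_independent[OF c c' r open_chart[OF c'(1)] chart_domD(2)[OF c'(2)] 
            X'_smooth[unfolded O'_def] X'_smooth'])
    finally show ?thesis by (simp add: l)
  qed
  moreover have "smooth_near A k P f" by (rule smooth_nearI[OF c' S' f])
  ultimately show ?thesis
    using change_of_chart[OF c c' S' f, of 1 "lift_coeff X k c P"]
    by (simp add: tvec_of_apply p_def)
qed

text \<open>A function may be known to be smooth only in a third chart, so both sides are compared there.\<close>

lemma lift_tvec_chart_independent:
  assumes X: "vector_family X"
    and c: "c \<in> A" "P \<in> chart_dom A k c" and c': "c' \<in> A" "P \<in> chart_dom A k c'"
  shows "tvec_of A k c P 1 (lift_coeff X k c P) = tvec_of A k c' P 1 (lift_coeff X k c' P)"
proof
  fix f
  show "tvec_of A k c P 1 (lift_coeff X k c P) f = tvec_of A k c' P 1 (lift_coeff X k c' P) f"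
  proof (cases "smooth_near A k P f")
    case True
    then obtain c'' S where *: "c'' \<in> A" "P \<in> chart_dom A k c''" "open S" "to_coords k c'' P \<in> S"
      "S \<subseteq> coords_dom c''" "jet_smooth S (in_coords A k c'' f)" by (rule smooth_nearE)
    show ?thesis using lift_tvec_apply[OF X c *] lift_tvec_apply[OF X c' *] by simp
  qed (simp add: tvec_of_apply)
qed

lemma lifted_field_eq:
  assumes X: "vector_family X" and c: "c \<in> A" "P \<in> chart_dom A k c"
  shows "lifted_field X k P = tvec_of A k c P 1 (lift_coeff X k c P)"
  unfolding lifted_field_def Let_def
  by (rule lift_tvec_chart_independent[OF X _ _ c])
     (use chart_at[of "base_point P"] c(2) in \<open>simp_all add: chart_dom_def\<close>)

lemma in_coords_lift_coeff:
  assumes "c \<in> A" "p \<in> coords_dom c" "l \<in> cdirs k"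
  shows "in_coords A k c (\<lambda>P. lift_coeff X k c P l) p = total_pow (fst l) (local_rep c (X c (snd l))) p"
proof -
  have "fst l \<le> k" using assms(3) by (cases l) simp
  then show ?thesis
    by (simp add: in_coords_def lift_coeff_def to_coords_of_coords[OF assms(1,2)])
       (rule jet_functionD[OF jet_function_total_pow[OF jet_function_local_rep]], simp add: truncate_def)
qed

lemma vector_field_ext_lifted_field:
  assumes X: "vector_family X" shows "vector_field_ext A k (lifted_field X k)"
  unfolding vector_field_ext_def
proof (intro ballI exI conjI allI impI)
  fix c assume c: "c \<in> A"
  have "smooth_on_chart A k c (\<lambda>P. lift_coeff X k c P (r, i, e))" if "r \<le> k" for r i e
    by (rule smooth_on_chartI[OF c _ in_coords_lift_coeff[OF c]])
       (use that in \<open>auto intro: jet_smooth_total_pow open_coords_dom[OF c] vector_family_smooth[OF X c]\<close>)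
  then show "r \<le> k \<Longrightarrow> smooth_on_chart A k c (\<lambda>P. lift_coeff X k c P (r, i, False))"
    "r \<le> k \<Longrightarrow> smooth_on_chart A k c (\<lambda>P. lift_coeff X k c P (r, i, True))" for r i by blast+
  show "lifted_field X k P = coord_tvec A k c P 1 (\<lambda>r i. lift_coeff X k c P (r, i, False))
      (\<lambda>r i. lift_coeff X k c P (r, i, True))" if "P \<in> chart_dom A k c" for P
    using lifted_field_eq[OF X c that] by (simp add: tvec_of_def)
qed

lemma vector_field_N_lifted_field:
  assumes X: "vector_family X" shows "vector_field_N A (lifted_field X 0)"
  unfolding vector_field_N_def
proof (intro ballI exI conjI allI)
  fix c assume c: "c \<in> A"
  have "smooth_on_chart A 0 c (on_N (X c m))" for m
    unfolding smooth_on_chart_on_N[OF c] by (rule vector_family_smooth[OF X c])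
  then show "smooth_on_chart A 0 c (on_N (X c (i, False)))" "smooth_on_chart A 0 c (on_N (X c (i, True)))" for i
    by blast+
  fix P assume P: "P \<in> chart_dom A 0 c"
  have "lift_coeff X 0 c P (0, m) = on_N (X c m) P" for m
    by (simp add: lift_coeff_def local_rep_def point_of_to_coords[OF c P] on_N_def)
  then have "tvec_of A 0 c P 1 (lift_coeff X 0 c P) = tvec_of A 0 c P 1 (\<lambda>(r, m). on_N (X c m) P)"
    by (intro tvec_of_cong) (auto simp: cdirs_def)
  then show "lifted_field X 0 P = coord_tvec A 0 c P 1 (\<lambda>r i. on_N (X c (i, False)) P) (\<lambda>r i. on_N (X c (i, True)) P)"
    using lifted_field_eq[OF X c P] by (simp add: tvec_of_def)
qed

lemma vector_field_N_local:
  assumes Z: "vector_field_N A Z" and c: "c \<in> A"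
  obtains \<zeta> where "\<And>m. jet_smooth (coords_dom c) (local_rep c (\<zeta> m))"
    "\<And>P. P \<in> chart_dom A 0 c \<Longrightarrow> Z P = tvec_of A 0 c P 1 (\<lambda>l. \<zeta> (snd l) (base_point P))"
proof -
  obtain b b' where *: "\<And>i. smooth_on_chart A 0 c (on_N (b i)) \<and> smooth_on_chart A 0 c (on_N (b' i))"
    "\<And>P. P \<in> chart_dom A 0 c \<Longrightarrow> Z P = coord_tvec A 0 c P 1 (\<lambda>r i. on_N (b i) P) (\<lambda>r i. on_N (b' i) P)"
    using Z c unfolding vector_field_N_def by meson
  have "jet_smooth (coords_dom c) (local_rep c (if snd m then b' (fst m) else b (fst m)))" for m
    using *(1)[of "fst m"] by (simp add: smooth_on_chart_on_N[OF c])
  then show ?thesis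
    by (rule that[of "\<lambda>m. if snd m then b' (fst m) else b (fst m)"]) (simp add: *(2) tvec_of_def on_N_def)
qed

lemma tvec_of_on_N:
  assumes c: "c \<in> A" "P \<in> chart_dom A 0 c" and f: "f \<in> smooth_fun_M A"
  shows "tvec_of A 0 c P 1 (\<lambda>l. \<zeta> (snd l) (base_point P)) (on_N f) =
    prolong 0 (\<lambda>m. local_rep c (\<zeta> m)) (local_rep c f) (to_coords 0 c P)"
proof -
  have f': "smooth_on_chart A 0 c (on_N f)" using f c(1) by (simp add: smooth_fun_M_def)
  note p = open_coords_dom[OF c(1)] to_coords_in_coords_dom[OF c] in_coords_on_N[OF c(1)]
  have "d_time (in_coords A 0 c (on_N f)) (to_coords 0 c P) = 0"
    using pd_cong[OF p, where j = None] d_time_jet_function[OF jet_function_local_rep] by (simp add: d_time_eq)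
  moreover have "wirtinger l (in_coords A 0 c (on_N f)) (to_coords 0 c P) = wirtinger l (local_rep c f) (to_coords 0 c P)" for l
    by (rule wirtinger_cong[OF p])
  ultimately show ?thesis
    using smooth_on_chart_imp_smooth_near[OF c f']
    by (simp add: tvec_of_apply prolong_0 sum_cdirs_0 local_rep_def point_of_to_coords[OF c])
qed

text \<open>
  The function \<open>Z f\<close> does not depend on time, hence comes from a function on \<open>M\<close>, and this function is smooth
  because in each chart it is given by the coefficients of \<open>Z\<close> there. This makes the description of iterated
  complete lifts applicable to \<open>Z f\<close>.
\<close>

lemma vector_field_N_apply:
  assumes Z: "vector_field_N A Z" and f: "f \<in> smooth_fun_M A"
  obtains g where "g \<in> smooth_fun_M A" "\<And>Q. Q \<in> ext_N A 0 \<Longrightarrow> Z Q (on_N f) = g (base_point Q)"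
    "\<And>c p \<zeta>. c \<in> A \<Longrightarrow> p \<in> coords_dom c \<Longrightarrow>
       (\<And>P. P \<in> chart_dom A 0 c \<Longrightarrow> Z P = tvec_of A 0 c P 1 (\<lambda>l. \<zeta> (snd l) (base_point P))) \<Longrightarrow>
       local_rep c g p = prolong 0 (\<lambda>m. local_rep c (\<zeta> m)) (local_rep c f) p"
proof -
  \<comment> \<open>\<open>J x\<close> is the point of \<open>N\<close> over \<open>x\<close> at time 0.\<close>
  define J where "J x = (let c = chart_at A x in of_coords A 0 c (0, \<lambda>_. snd c x))" for x
  have J: "J x \<in> ext_N A 0" "base_point (J x) = x" for x
  proof -
    define c where "c = chart_at A x"
    have c: "c \<in> A" "x \<in> fst c" using chart_at[of x] by (simp_all add: c_def)
    then have "(0, \<lambda>_. snd c x) \<in> coords_dom c" by (auto simp: coords_dom_def)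
    then show "J x \<in> ext_N A 0" "base_point (J x) = x"
      using of_coords_in_ext_N[OF c(1)] base_point_of_coords[OF c(1)] point_of_eq[OF c]
      by (auto simp: J_def c_def[symmetric])
  qed
  define g where "g x = Z (J x) (on_N f)" for x
  have g_eq: "Z Q (on_N f) = prolong 0 (\<lambda>m. local_rep c (\<zeta> m)) (local_rep c f) (to_coords 0 c Q)"
    if "c \<in> A" "Q \<in> chart_dom A 0 c"
      "\<And>P. P \<in> chart_dom A 0 c \<Longrightarrow> Z P = tvec_of A 0 c P 1 (\<lambda>l. \<zeta> (snd l) (base_point P))" for c Q \<zeta>
    using tvec_of_on_N[OF that(1,2) f] that by simp
  have eq: "Z Q (on_N f) = g (base_point Q)" if Q: "Q \<in> ext_N A 0" for Q
  proof -
    obtain c where c: "c \<in> A" "base_point Q \<in> fst c" using ex_chart by blast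
    then have dom: "Q \<in> chart_dom A 0 c" "J (base_point Q) \<in> chart_dom A 0 c"
      using Q J by (auto intro: chart_domI)
    obtain \<zeta> where \<zeta>: "\<And>P. P \<in> chart_dom A 0 c \<Longrightarrow> Z P = tvec_of A 0 c P 1 (\<lambda>l. \<zeta> (snd l) (base_point P))"
      by (rule vector_field_N_local[OF Z c(1)]) (rule that)
    have "snd (to_coords 0 c P) 0 = snd c (base_point P)" if "P \<in> chart_dom A 0 c" for P
      using point_of_coords(2)[of "to_coords 0 c P" c UNIV] to_coords_in_coords_dom[OF c(1) that]
        point_of_to_coords[OF c(1) that] by (simp add: coords_dom_eq)
    from this[OF dom(1)] this[OF dom(2)]
    have "prolong 0 (\<lambda>m. local_rep c (\<zeta> m)) (local_rep c f) (to_coords 0 c Q) =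
        prolong 0 (\<lambda>m. local_rep c (\<zeta> m)) (local_rep c f) (to_coords 0 c (J (base_point Q)))"
      by (intro jet_functionD[OF jet_function_prolong[OF jet_function_local_rep jet_function_local_rep]])
         (simp add: J(2))
    then show ?thesis
      using g_eq[OF c(1) dom(1) \<zeta>] g_eq[OF c(1) dom(2) \<zeta>] by (simp add: g_def)
  qed
  have loc: "local_rep c g p = prolong 0 (\<lambda>m. local_rep c (\<zeta> m)) (local_rep c f) p"
    if c: "c \<in> A" and p: "p \<in> coords_dom c"
      and \<zeta>: "\<And>P. P \<in> chart_dom A 0 c \<Longrightarrow> Z P = tvec_of A 0 c P 1 (\<lambda>l. \<zeta> (snd l) (base_point P))" for c p \<zeta>
  proof -
    have "local_rep c g p = Z (of_coords A 0 c p) (on_N f)"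
      using eq[OF of_coords_in_ext_N[OF c p]] base_point_of_coords[OF c p] by (simp add: local_rep_def)
    also have "\<dots> = prolong 0 (\<lambda>m. local_rep c (\<zeta> m)) (local_rep c f) (truncate 0 p)"
      using g_eq[OF c of_coords_in_chart_dom[OF c p] \<zeta>] by (simp add: to_coords_of_coords[OF c p])
    also have "\<dots> = prolong 0 (\<lambda>m. local_rep c (\<zeta> m)) (local_rep c f) p"
      by (rule jet_functionD[OF jet_function_prolong[OF jet_function_local_rep jet_function_local_rep]])
         (simp add: truncate_def)
    finally show ?thesis .
  qed
  have "g \<in> smooth_fun_M A"
    unfolding smooth_fun_M_iff
  proof
    fix c assume c: "c \<in> A"
    obtain \<zeta> where \<zeta>: "\<And>m. jet_smooth (coords_dom c) (local_rep c (\<zeta> m))"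
      "\<And>P. P \<in> chart_dom A 0 c \<Longrightarrow> Z P = tvec_of A 0 c P 1 (\<lambda>l. \<zeta> (snd l) (base_point P))"
      by (rule vector_field_N_local[OF Z c]) (rule that)
    have "jet_smooth (coords_dom c) (prolong 0 (\<lambda>m. local_rep c (\<zeta> m)) (local_rep c f))"
      by (rule jet_smooth_prolong[OF open_coords_dom[OF c] _ \<zeta>(1)]) (use f c in \<open>simp add: smooth_fun_M_iff\<close>)
    then show "jet_smooth (coords_dom c) (local_rep c g)"
      by (rule jet_smooth_cong[OF open_coords_dom[OF c], rotated]) (rule loc[where \<zeta> = \<zeta>, OF c _ \<zeta>(2), symmetric])
  qed
  then show ?thesis using eq loc by (rule that)
qed

lemma in_coords_clift_pow_vector_field:
  assumes Z: "vector_field_N A Z" and f: "f \<in> smooth_fun_M A" and c: "c \<in> A" "p \<in> coords_dom c"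
    and \<zeta>: "\<And>P. P \<in> chart_dom A 0 c \<Longrightarrow> Z P = tvec_of A 0 c P 1 (\<lambda>l. \<zeta> (snd l) (base_point P))"
  shows "in_coords A k c (clift_pow A k (\<lambda>Q. Z Q (on_N f))) p =
    total_pow k (prolong 0 (\<lambda>m. local_rep c (\<zeta> m)) (local_rep c f)) p"
proof (rule vector_field_N_apply[OF Z f])
  fix g assume g: "g \<in> smooth_fun_M A" "\<And>Q. Q \<in> ext_N A 0 \<Longrightarrow> Z Q (on_N f) = g (base_point Q)"
    and loc: "\<And>c p \<zeta>. c \<in> A \<Longrightarrow> p \<in> coords_dom c \<Longrightarrow>
       (\<And>P. P \<in> chart_dom A 0 c \<Longrightarrow> Z P = tvec_of A 0 c P 1 (\<lambda>l. \<zeta> (snd l) (base_point P))) \<Longrightarrow>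
       local_rep c g p = prolong 0 (\<lambda>m. local_rep c (\<zeta> m)) (local_rep c f) p"
  have "in_coords A k c (clift_pow A k (\<lambda>Q. Z Q (on_N f))) p = total_pow k (local_rep c g) p"
    using clift_pow_eq(2)[OF g c, of k] by simp
  also have "\<dots> = total_pow k (prolong 0 (\<lambda>m. local_rep c (\<zeta> m)) (local_rep c f)) p"
    by (rule total_pow_cong[OF open_coords_dom[OF c(1)] _ c(2)]) (rule loc[where \<zeta> = \<zeta>, OF c(1) _ \<zeta>])
  finally show ?thesis .
qed

lemma tvec_of_clift_pow:
  assumes f: "f \<in> smooth_fun_M A" and c: "c \<in> A" "P \<in> chart_dom A k c"
  shows "tvec_of A k c P a \<beta> (clift_pow A k (on_N f)) =
    (\<Sum>l\<in>cdirs k. \<beta> l * wirtinger l (total_pow k (local_rep c f)) (to_coords k c P))"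
proof -
  note lift = clift_pow_eq(2)[OF f, of "on_N f", simplified on_N_def o_def, OF refl, folded o_def on_N_def]
  have "smooth_on_chart A k c (clift_pow A k (on_N f))"
    by (rule smooth_on_chartI[OF c(1) _ lift[OF c(1)]])
       (use f c in \<open>auto simp: smooth_fun_M_iff intro: jet_smooth_total_pow open_coords_dom\<close>)
  note near = smooth_on_chart_imp_smooth_near[OF c this]
  note p = open_coords_dom[OF c(1)] to_coords_in_coords_dom[OF c] lift[OF c(1)]
  have "d_time (in_coords A k c (clift_pow A k (on_N f))) (to_coords k c P) = 0"
    using pd_cong[OF p, where j = None] d_time_jet_function[OF jet_function_total_pow[OF jet_function_local_rep]]
    by (simp add: d_time_eq)
  then show ?thesis using near wirtinger_cong[OF p] by (simp add: tvec_of_apply)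
qed

text \<open>In coordinates this is the statement that the prolongation commutes with \<open>D\<^sup>k\<close>.\<close>

lemma complete_lift_lifted_field:
  assumes X: "vector_family X" shows "complete_lift_of A k (lifted_field X 0) (lifted_field X k)"
  unfolding complete_lift_of_def
proof (intro conjI ballI vector_field_ext_lifted_field[OF X])
  fix f P assume f: "f \<in> smooth_fun_M A" and P: "P \<in> ext_N A k"
  obtain c where "c \<in> A" "base_point P \<in> fst c" using bexE[OF ex_chart[of "base_point P"]] .
  with chart_domI[OF P] have c: "c \<in> A" "P \<in> chart_dom A k c" by simp_all
  define p where "p = to_coords k c P"
  define \<xi> where "\<xi> = (\<lambda>m. local_rep c (X c m))"
  have p: "p \<in> coords_dom c" unfolding p_def by (rule to_coords_in_coords_dom[OF c])
  have "lifted_field X k P (clift_pow A k (on_N f)) = prolong k \<xi> (total_pow k (local_rep c f)) p"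
    by (simp add: lifted_field_eq[OF X c] tvec_of_clift_pow[OF f c] prolong_def lift_coeff_def \<xi>_def p_def)
  also have "\<dots> = total_pow k (prolong 0 \<xi> (local_rep c f)) p"
    unfolding \<xi>_def
    by (intro prolong_total_pow[OF open_coords_dom[OF c(1)] p] jet_function_local_rep vector_family_smooth[OF X c(1)])
       (use f c(1) in \<open>simp add: smooth_fun_M_iff\<close>)
  also have "\<dots> = in_coords A k c (clift_pow A k (\<lambda>Q. lifted_field X 0 Q (on_N f))) p"
    unfolding \<xi>_def
  proof (rule in_coords_clift_pow_vector_field[where \<zeta> = "X c", OF vector_field_N_lifted_field[OF X] f c(1) p, symmetric])
    fix Q assume Q: "Q \<in> chart_dom A 0 c"
    have "lift_coeff X 0 c Q l = X c (snd l) (base_point Q)" if "l \<in> cdirs 0" for l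
      using that by (cases l) (simp add: lift_coeff_def local_rep_def point_of_to_coords[OF c(1) Q])
    then have "tvec_of A 0 c Q 1 (lift_coeff X 0 c Q) = tvec_of A 0 c Q 1 (\<lambda>l. X c (snd l) (base_point Q))"
      by (rule tvec_of_cong)
    then show "lifted_field X 0 Q = tvec_of A 0 c Q 1 (\<lambda>l. X c (snd l) (base_point Q))"
      by (simp only: lifted_field_eq[OF X c(1) Q])
  qed
  also have "\<dots> = clift_pow A k (\<lambda>Q. lifted_field X 0 Q (on_N f)) P"
    by (simp add: in_coords_def p_def of_coords_to_coords[OF c])
  finally show "lifted_field X k P (clift_pow A k (on_N f)) = clift_pow A k (\<lambda>Q. lifted_field X 0 Q (on_N f)) P" .
qed

end

section \<open>Functions and vector fields with support in a chart\<close>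

text \<open>
  For \<open>n = 0\<close> this is \<open>e\<^sup>-\<^sup>1\<^sup>/\<^sup>x\<close> extended by 0. Its derivatives are linear combinations of the functions with
  larger \<open>n\<close>, so that smoothness of the whole family follows by one induction.
\<close>

definition flat_exp :: "nat \<Rightarrow> real \<Rightarrow> real" where
  "flat_exp n x = (if x > 0 then inverse x ^ n / exp (inverse x) else 0)"

lemma flat_exp_tendsto: "(flat_exp n \<longlongrightarrow> 0) (at 0)"
proof (rule filterlim_split_at)
  show "(flat_exp n \<longlongrightarrow> 0) (at_left 0)"
    by (rule tendsto_eventually) (auto simp: flat_exp_def eventually_at_filter)
  have "((\<lambda>x. inverse x ^ n / exp (inverse x)) \<longlongrightarrow> 0) (at_right (0::real))"
    by (rule filterlim_compose[OF tendsto_power_div_exp_0 filterlim_inverse_at_top_right])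
  then show "(flat_exp n \<longlongrightarrow> 0) (at_right 0)"
    by (rule Lim_transform_eventually) (auto simp: flat_exp_def eventually_at_filter)
qed

lemma DERIV_flat_exp:
  "(flat_exp n has_real_derivative flat_exp (n + 2) x - of_nat n * flat_exp (n + 1) x) (at x)"
proof (cases "x = 0")
  case True
  have "((\<lambda>h. (flat_exp n (0 + h) - flat_exp n 0) / h) \<longlongrightarrow> 0) (at 0)"
    by (rule Lim_transform_eventually[OF flat_exp_tendsto[of "n + 1"]])
       (auto simp: flat_exp_def eventually_at_filter divide_inverse)
  then show ?thesis by (simp add: True DERIV_def flat_exp_def)
next
  case False
  show ?thesis
  proof (cases "x > 0")
    case True
    define y where "y = inverse x"
    have "(of_nat n * y ^ (n - 1) * - y\<^sup>2 * E - y ^ n * (E * - y\<^sup>2)) / (E * E)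
        = y ^ (n + 2) / E - of_nat n * (y ^ (n + 1) / E)" if "E \<noteq> 0" for E :: real
      using that by (cases n) (simp_all add: field_simps power2_eq_square)
    moreover have "((\<lambda>x. inverse x ^ n / exp (inverse x)) has_real_derivative
        (of_nat n * y ^ (n - 1) * - y\<^sup>2 * exp y - y ^ n * (exp y * - y\<^sup>2)) / (exp y * exp y)) (at x)"
      using True by (auto intro!: derivative_eq_intros simp: y_def power2_eq_square)
    ultimately have "((\<lambda>x. inverse x ^ n / exp (inverse x)) has_real_derivative flat_exp (n + 2) x - of_nat n * flat_exp (n + 1) x) (at x)"
      using True by (simp add: flat_exp_def y_def)
    then show ?thesis
      by (rule has_field_derivative_transform_within_open[where S = "{0<..}"]) (use True in \<open>auto simp: flat_exp_def\<close>)
  next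
    case neg: False
    have "((\<lambda>x. 0) has_real_derivative flat_exp (n + 2) x - of_nat n * flat_exp (n + 1) x) (at x)"
      using neg by (simp add: flat_exp_def)
    then show ?thesis
      by (rule has_field_derivative_transform_within_open[where S = "{..<0}"]) (use False neg in \<open>auto simp: flat_exp_def\<close>)
  qed
qed

lemma jet_smooth_flat_exp:
  fixes \<rho> :: "'m::finite coords \<Rightarrow> real"
  assumes S: "open S" and \<rho>: "jet_smooth S (\<lambda>p. of_real (\<rho> p))"
  shows "jet_smooth S (\<lambda>p. of_real (flat_exp m (\<rho> p)))"
proof (rule jet_smoothI)
  fix n k
  have "continuous_on S (\<lambda>p. Re (of_real (\<rho> p)))"
    by (intro continuous_on_Re jet_smooth_continuous \<rho>)
  moreover have "continuous_on UNIV (flat_exp m)" for m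
    using DERIV_isCont[OF DERIV_flat_exp] by (simp add: continuous_on_eq_continuous_at)
  ultimately have cont: "continuous_on S (\<lambda>p. complex_of_real (flat_exp m (\<rho> p)))" for m
    by (intro continuous_on_of_real) (auto intro: continuous_on_compose2)
  show "C_on n k (\<lambda>p. of_real (flat_exp m (\<rho> p))) S"
  proof (induction n arbitrary: m)
    case 0
    show ?case using cont by simp
  next
    case (Suc n)
    define G where "G j p = (of_real (flat_exp (m + 2) (\<rho> p)) + (- of_nat m) * of_real (flat_exp (m + 1) (\<rho> p)))
        * pd j (\<lambda>p. of_real (\<rho> p)) p" for j p
    show ?case
    proof (rule C_on_SucI[OF S cont])
      fix p and j :: "'m dir" assume p: "p \<in> S" and j: "j \<in> dirs k"
      define D where "D = pd j (\<lambda>p. of_real (\<rho> p)) p"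
      have D: "((\<lambda>s. complex_of_real (\<rho> (move j p s))) has_vector_derivative D) (at 0)"
        unfolding D_def by (rule jet_smooth_pd_works[OF \<rho> j p])
      have "((\<lambda>s. Re (of_real (\<rho> (move j p s)))) has_vector_derivative Re D) (at 0)"
        by (rule bounded_linear.has_vector_derivative[OF bounded_linear_Re D])
      then have Re_D: "((\<lambda>s. \<rho> (move j p s)) has_real_derivative Re D) (at 0)"
        by (simp add: has_real_derivative_iff_has_vector_derivative)
      have "D = of_real (Re D)"
        by (rule vector_derivative_unique_at[OF D has_vector_derivative_of_real[OF Re_D]])
      moreover have "((\<lambda>s. complex_of_real (flat_exp m (\<rho> (move j p s)))) has_vector_derivative
          of_real ((flat_exp (m + 2) (\<rho> (move j p 0)) - of_nat m * flat_exp (m + 1) (\<rho> (move j p 0))) * Re D)) (at 0)"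
        by (rule has_vector_derivative_of_real[OF DERIV_chain2[OF DERIV_flat_exp Re_D]])
      ultimately show "((\<lambda>s. complex_of_real (flat_exp m (\<rho> (move j p s)))) has_vector_derivative G j p) (at 0)"
        unfolding G_def D_def[symmetric] by simp
    next
      fix j :: "'m dir" assume j: "j \<in> dirs k"
      show "C_on n k (G j) S" unfolding G_def[abs_def]
        by (intro C_on_mult C_on_add S C_on_const Suc.IH jet_smoothD[OF jet_smooth_pd[OF \<rho> j]])
    qed
  qed
qed

context atlas
begin

text \<open>The domain of \<open>c\<close> and the complement of \<open>K\<close> are open and cover \<open>M\<close>; on the second \<open>g\<close> vanishes.\<close>

lemma smooth_fun_M_extend:
  assumes c: "c \<in> A" and K: "closed K" "K \<subseteq> fst c" and g: "jet_smooth (coords_dom c) (local_rep c g)"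
    and zero: "\<And>x. x \<notin> K \<Longrightarrow> g x = 0"
  shows "g \<in> smooth_fun_M A"
  unfolding smooth_fun_M_iff
proof
  fix c' assume c': "c' \<in> A"
  show "jet_smooth (coords_dom c') (local_rep c' g)"
  proof (rule jet_smooth_coords_domI[OF c' open_chart[OF c] open_Compl[OF K(1)]])
    show "jet_smooth (coords_over c' (fst c)) (local_rep c' g)"
      using jet_smooth_change_of_chart[OF c c' open_UNIV] g by (simp add: coords_dom_eq)
    show "jet_smooth (coords_over c' (- K)) (local_rep c' g)"
      by (rule jet_smooth_cong[OF open_coords_over[OF c' open_Compl[OF K(1)]] _ jet_smooth_const[of _ 0]])
         (use zero in \<open>auto simp: local_rep_def coords_over_iff[OF c']\<close>)
  qed (use K in auto)
qed

text \<open>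
  A vector field with coefficients \<open>X0\<close> in the chart \<open>c0\<close>, written in the chart \<open>c\<close> by the transformation law
  and extended by 0 to the points outside \<open>c0\<close>.
\<close>

definition spread_family ::
  "('a, 'm) chart \<Rightarrow> ('m \<times> bool \<Rightarrow> 'a \<Rightarrow> complex) \<Rightarrow> ('a, 'm) chart \<Rightarrow> 'm \<times> bool \<Rightarrow> 'a \<Rightarrow> complex" where
  "spread_family c0 X0 c m x = (if x \<in> fst c0
     then prolong 0 (\<lambda>m. local_rep c0 (X0 m)) (local_rep c0 (coord_fun c m)) (0, \<lambda>_. snd c0 x) else 0)"

lemma local_rep_coord_fun:
  "p \<in> coords_dom c \<Longrightarrow> local_rep c (coord_fun c m) p = coordinate (0, m) p"
  using point_of_coords(2)[of p c UNIV] by (cases m) (simp add: local_rep_def coord_fun_def coordinate_def coords_dom_eq)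

lemma local_rep_spread_family:
  assumes "c0 \<in> A" "p \<in> coords_dom c0"
  shows "local_rep c0 (spread_family c0 X0 c m) p =
    prolong 0 (\<lambda>m. local_rep c0 (X0 m)) (local_rep c0 (coord_fun c m)) p"
proof -
  have "point_of c0 p \<in> fst c0" "snd c0 (point_of c0 p) = snd p 0"
    using point_of_coords[of p c0 UNIV] assms(2) by (simp_all add: coords_dom_eq)
  then show ?thesis
    by (simp add: local_rep_def[of c0 "spread_family _ _ _ _"] spread_family_def)
       (rule jet_functionD[OF jet_function_prolong[OF jet_function_local_rep jet_function_local_rep]], simp)
qed

lemma local_rep_spread_family_same:
  assumes "c0 \<in> A" "p \<in> coords_dom c0"
  shows "local_rep c0 (spread_family c0 X0 c0 m) p = local_rep c0 (X0 m) p"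
proof -
  have "wirtinger (0, m') (local_rep c0 (coord_fun c0 m)) p = wirtinger (0, m') (coordinate (0, m)) p" for m'
    by (rule wirtinger_cong[OF open_coords_dom[OF assms(1)] assms(2) local_rep_coord_fun])
  then show ?thesis
    by (simp add: local_rep_spread_family[OF assms] prolong_0 wirtinger_coordinate of_bool_def if_distrib[of "\<lambda>x. _ * x"] sum.delta
        cong: if_cong)
qed

text \<open>
  At a point of \<open>c0\<close> the transformation law from \<open>c\<close> to \<open>c'\<close> follows from those from \<open>c0\<close> by the chain
  rule; at other points all coefficients are 0.
\<close>

lemma vector_family_spread_family:
  assumes c0: "c0 \<in> A" and K: "closed K" "K \<subseteq> fst c0"
    and X0: "\<And>m. jet_smooth (coords_dom c0) (local_rep c0 (X0 m))" "\<And>m x. x \<notin> K \<Longrightarrow> X0 m x = 0"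
  shows "vector_family (spread_family c0 X0)"
  unfolding vector_family_def
proof (intro conjI ballI allI)
  fix c m assume c: "c \<in> A"
  have zero: "spread_family c0 X0 c m x = 0" if "x \<notin> K" for x
    using that X0(2) point_of_eq[OF c0] by (simp add: spread_family_def prolong_0 local_rep_def)
  show "jet_smooth (coords_dom c) (local_rep c (spread_family c0 X0 c m))"
  proof (rule jet_smooth_coords_domI[OF c open_chart[OF c0] open_Compl[OF K(1)]])
    have sub: "coords_over c0 (fst c) \<subseteq> coords_dom c0" by (rule coords_over_subset)
    have op: "open (coords_over c0 (fst c))" by (intro open_coords_over open_chart c c0)
    have "jet_smooth (coords_over c0 (fst c)) (local_rep c0 (spread_family c0 X0 c m))"
      by (rule jet_smooth_cong[OF op local_rep_spread_family[OF c0, symmetric] jet_smooth_prolong[OF op]])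
         (use sub jet_smooth_transition[OF c0 c] jet_smooth_subset[OF X0(1) sub] in auto)
    from jet_smooth_change_of_chart[OF c0 c open_chart[OF c] this]
    have "jet_smooth (coords_over c (fst c0 \<inter> fst c)) (local_rep c (spread_family c0 X0 c m))" .
    moreover have "coords_over c (fst c0 \<inter> fst c) = coords_over c (fst c0)" by (auto simp: coords_over_def)
    ultimately show "jet_smooth (coords_over c (fst c0)) (local_rep c (spread_family c0 X0 c m))" by simp
    show "jet_smooth (coords_over c (- K)) (local_rep c (spread_family c0 X0 c m))"
      by (rule jet_smooth_cong[OF open_coords_over[OF c open_Compl[OF K(1)]] _ jet_smooth_const[of _ 0]])
         (use zero in \<open>auto simp: local_rep_def coords_over_iff[OF c]\<close>)
  qed (use K in auto)
next
  fix c c' m p assume c: "c \<in> A" and c': "c' \<in> A" and p: "p \<in> coords_over c (fst c')"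
  define x where "x = point_of c p"
  have p': "p \<in> coords_dom c" using p coords_over_subset by blast
  show "local_rep c (spread_family c0 X0 c' m) p =
      prolong 0 (\<lambda>m. local_rep c (spread_family c0 X0 c m)) (local_rep c (coord_fun c' m)) p"
  proof (cases "x \<in> fst c0")
    case False
    then show ?thesis by (simp add: local_rep_def prolong_0 spread_family_def x_def)
  next
    case True
    define P where "P = of_coords A 0 c p"
    define p0 where "p0 = to_coords 0 c0 P"
    have P: "P \<in> chart_dom A 0 c" "base_point P = x" "P \<in> chart_dom A 0 c0"
      using True of_coords_in_chart_dom[OF c p', of 0] base_point_of_coords[OF c p', of 0]
      by (simp_all add: P_def x_def chart_dom_def)
    have p0: "p0 \<in> coords_dom c0" "point_of c0 p0 = x"
      unfolding p0_def using to_coords_in_coords_dom[OF c0 P(3)] point_of_to_coords[OF c0 P(3)] P(2) by simp_all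
    have tP: "to_coords 0 c P = truncate 0 p" by (simp add: P_def to_coords_of_coords[OF c p'])
    have dom0: "in_coords A 0 c (on_N g) q = local_rep c g q" if "q \<in> coords_over c (fst c')" for g q
      by (rule in_coords_on_N[OF c subsetD[OF coords_over_subset that]])
    have S': "open (coords_over c (fst c'))" "to_coords 0 c P \<in> coords_over c (fst c')"
      by (rule open_coords_over[OF c open_chart[OF c']]) (use p in \<open>simp add: tP coords_over_def truncate_def\<close>)
    have smooth: "jet_smooth (coords_over c (fst c')) (in_coords A 0 c (on_N (coord_fun c' m)))"
      by (rule jet_smooth_cong[OF S'(1) dom0[symmetric] jet_smooth_transition[OF c c']])
    have 1: "wirtinger l (in_coords A 0 c0 (on_N g)) p0 = wirtinger l (local_rep c0 g) p0" for l g
      by (rule wirtinger_cong[OF open_coords_dom[OF c0] p0(1) in_coords_on_N[OF c0]])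
    have 2: "wirtinger l (in_coords A 0 c (on_N g)) (to_coords 0 c P) = wirtinger l (local_rep c g) p" for l g
    proof -
      have "wirtinger l (in_coords A 0 c (on_N g)) (to_coords 0 c P) = wirtinger l (local_rep c g) (to_coords 0 c P)"
        by (rule wirtinger_cong[OF S' dom0])
      also have "\<dots> = wirtinger l (local_rep c g) p"
        by (rule jet_functionD[OF jet_function_wirtinger[OF jet_function_local_rep]]) (simp add: tP truncate_def)
      finally show ?thesis .
    qed
    have 3: "spread_family c0 X0 c'' m x = 
        (\<Sum>m'\<in>UNIV. X0 m' x * wirtinger (0, m') (local_rep c0 (coord_fun c'' m)) p0)" for c'' m
      using local_rep_spread_family[OF c0 p0(1), of X0 c'' m]
      by (simp add: local_rep_def[of c0 "spread_family _ _ _ _"] p0(2) prolong_0 local_rep_def[of c0 "X0 _"])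
    have "spread_family c0 X0 c' m x =
        (\<Sum>m'\<in>UNIV. spread_family c0 X0 c m' x * wirtinger (0, m') (local_rep c (coord_fun c' m)) p)"
      using change_of_chart[OF c0 P(3) c P(1) S' coords_over_subset smooth, of 0 "\<lambda>l. X0 (snd l) x"]
      by (simp add: sum_cdirs_0 1 2 3 p0_def[symmetric])
    then show ?thesis
      by (simp add: local_rep_def[of c "spread_family _ _ _ _"] prolong_0 x_def[symmetric])
  qed
qed

lemma bump_function:
  assumes c: "c \<in> A" and p: "p \<in> coords_dom c"
  obtains K B where "closed K" "K \<subseteq> fst c" "jet_function 0 B" "jet_smooth UNIV B" "B p \<noteq> 0"
    "\<And>q. q \<in> coords_dom c \<Longrightarrow> point_of c q \<notin> K \<Longrightarrow> B q = 0"
proof -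
  define z0 where "z0 = snd p 0"
  have z0: "z0 \<in> snd c ` fst c" using p by (auto simp: z0_def coords_dom_def)
  obtain \<epsilon> where \<epsilon>: "\<epsilon> > 0" "cball z0 \<epsilon> \<subseteq> snd c ` fst c"
    using open_contains_cball[of "snd c ` fst c"] open_chart_image[OF c] z0 by blast
  define K where "K = inv_into (fst c) (snd c) ` cball z0 \<epsilon>"
  have "continuous_on (cball z0 \<epsilon>) (inv_into (fst c) (snd c))"
    using chart_homeomorphism[OF c] \<epsilon>(2) continuous_on_subset unfolding homeomorphism_def by metis
  then have K: "closed K" unfolding K_def by (intro compact_imp_closed compact_continuous_image compact_cball)
  have K_sub: "K \<subseteq> fst c" unfolding K_def using \<epsilon>(2) by (auto intro: inv_into_into)
  \<comment> \<open>The function is positive exactly inside the ball.\<close>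
  define \<rho> where "\<rho> q = \<epsilon>\<^sup>2 - (norm (snd q 0 - z0))\<^sup>2" for q :: "'m coords"
  define B where "B q = complex_of_real (flat_exp 0 (\<rho> q))" for q
  have "complex_of_real (\<rho> q) = of_real (\<epsilon>\<^sup>2) + (-1) * (\<Sum>i\<in>UNIV. (coordinate (0, i, False) q + (- z0 $ i)) * (coordinate (0, i, True) q + (- cnj (z0 $ i))))" for q
  proof -
    have "(norm (snd q 0 - z0))\<^sup>2 = (\<Sum>i\<in>UNIV. (norm (snd q 0 $ i - z0 $ i))\<^sup>2)"
      by (simp add: norm_vec_def L2_set_def sum_nonneg)
    moreover have "complex_of_real ((norm (snd q 0 $ i - z0 $ i))\<^sup>2) = (snd q 0 $ i - z0 $ i) * cnj (snd q 0 $ i - z0 $ i)" for i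
      by (rule complex_norm_square)
    ultimately show ?thesis by (simp add: \<rho>_def coordinate_def del: of_real_power)
  qed
  moreover have "jet_smooth UNIV (\<lambda>q. of_real (\<epsilon>\<^sup>2) + (-1) * (\<Sum>i\<in>UNIV. (coordinate (0, i, False) q + (- z0 $ i)) * (coordinate (0, i, True) q + (- cnj (z0 $ i)))))"
    by (intro jet_smooth_add jet_smooth_mult jet_smooth_sum jet_smooth_const jet_smooth_coordinate open_UNIV)
  ultimately have "jet_smooth UNIV (\<lambda>q. of_real (\<rho> q))" by simp
  from jet_smooth_flat_exp[OF open_UNIV this] have B: "jet_smooth UNIV B" by (simp add: B_def[abs_def])
  have "B q = 0" if q: "q \<in> coords_dom c" "point_of c q \<notin> K" for q
  proof -
    have "snd q 0 \<notin> cball z0 \<epsilon>" using q(2) unfolding K_def point_of_def by blast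
    then have "\<epsilon> < norm (snd q 0 - z0)" by (simp add: dist_norm norm_minus_commute)
    then have "\<rho> q \<le> 0" using \<epsilon>(1) by (simp add: \<rho>_def power_mono)
    then show ?thesis by (simp add: B_def flat_exp_def)
  qed
  moreover have "jet_function 0 B" by (simp add: jet_function_def B_def \<rho>_def)
  moreover have "B p \<noteq> 0" using \<epsilon>(1) by (simp add: B_def \<rho>_def z0_def flat_exp_def)
  ultimately show ?thesis using that[OF K K_sub _ B] by blast
qed

end

section \<open>Test functions and density\<close>

text \<open>At these jets the total derivative of every coordinate of order 0 is different from 0.\<close>

definition regular_jet :: "'m::finite coords \<Rightarrow> bool" where
  "regular_jet p \<longleftrightarrow> (\<forall>i. snd p 1 $ i \<noteq> 0)"

lemma has_vector_derivative_time_move: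
  "((\<lambda>s. complex_of_real (fst (move j p s))) has_vector_derivative of_bool (j = None)) (at 0)"
proof -
  have "((\<lambda>s. fst (move j p s)) has_real_derivative of_bool (j = None)) (at 0)"
    unfolding fst_move by (cases j) (auto intro!: derivative_eq_intros)
  from has_vector_derivative_of_real[OF this] show ?thesis by (cases j) simp_all
qed

lemmas pd_time = has_vector_derivative_time_move[THEN pd_eqI]

lemma jet_smooth_time: 
  assumes "open S" shows "jet_smooth S (\<lambda>p. complex_of_real (fst p))"
proof (rule jet_smoothI)
  fix n k
  have cont: "continuous_on S (\<lambda>p. complex_of_real (fst p))"
    by (rule continuous_on_of_real[OF continuous_on_fst[OF continuous_on_id]])
  show "C_on n k (\<lambda>p. complex_of_real (fst p)) S"
  proof (cases n)
    case 0
    then show ?thesis using cont by (simp only: C_on.simps(1))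
  next
    case (Suc m)
    show ?thesis unfolding Suc
      by (rule C_on_SucI[OF assms cont has_vector_derivative_time_move]) simp
  qed
qed

text \<open>
  The test functions \<open>L\<^sup>n H\<close> have a zero of order \<open>n\<close> along \<open>L = 0\<close>. Differentiating less than \<open>n\<close> times leaves
  0, differentiating \<open>n\<close> times leaves the term where each factor has been hit. After \<open>n - 1\<close>
  differentiations one factor \<open>L\<close> is left, and the differential of the result is a multiple of \<open>dL\<close>.
\<close>

lemma total_pow_test:
  assumes S: "open S" "p \<in> S" and H: "jet_smooth S H" and L: "L = (\<lambda>q. coordinate (0, m) q - coordinate (0, m) p)"
    and G: "\<And>q. q \<in> S \<Longrightarrow> G q = L q ^ n * H q"
  shows total_pow_test_lower: "j < n \<Longrightarrow> total_pow j G p = 0"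
    and total_pow_test_same: "total_pow n G p = fact n * (coordinate (1, m) p ^ n * H p)"
    and wirtinger_total_pow_test:
      "n = Suc k \<Longrightarrow> wirtinger l (total_pow k G) p = of_bool (l = (0, m)) * (fact n * (coordinate (1, m) p ^ k * H p))"
proof -
  have L0: "L p = 0" by (simp add: L)
  have Ljet: "jet_function 0 L" unfolding L by (rule jet_function_coordinate_diff) simp
  have Ls: "jet_smooth S L" unfolding L by (rule jet_smooth_coordinate_diff[OF S(1)])
  have wirtinger_L: "wirtinger l L p = of_bool (l = (0, m))" for l
    unfolding L by (rule wirtinger_coordinate_diff)
  have DL: "total_deriv 0 L p = coordinate (1, m) p"
  proof -
    have "total_deriv 0 L p = (\<Sum>m'\<in>UNIV. if m' = m then coordinate (1, m') p else 0)"
      unfolding total_deriv_def sum_cdirs_0 by (intro sum.cong) (auto simp: wirtinger_L next_order_def)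
    then show ?thesis by simp
  qed
  have pow: "\<exists>R. jet_smooth S R \<and> (\<forall>q\<in>S. total_pow j G q =
     fact n / fact (n - j) * L q ^ (n - j) * (total_deriv 0 L q ^ j * H q) + L q ^ Suc (n - j) * R q)" if "j \<le> n" for j
    using total_pow_power[OF S(1) Ljet Ls H that] total_pow_cong[OF S(1) G] by simp
  show "total_pow j G p = 0" if "j < n"
  proof -
    obtain d where "n - j = Suc d" using \<open>j < n\<close> by (metis Suc_diff_Suc)
    then show ?thesis using pow[of j] S(2) L0 that by auto
  qed
  show "total_pow n G p = fact n * (coordinate (1, m) p ^ n * H p)"
    using pow[of n] S(2) L0 DL by auto
  show "wirtinger l (total_pow k G) p = of_bool (l = (0, m)) * (fact n * (coordinate (1, m) p ^ k * H p))" if n: "n = Suc k"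
  proof -
    obtain R where R: "jet_smooth S R" "\<And>q. q \<in> S \<Longrightarrow> total_pow k G q = 
       L q * (fact n * (total_deriv 0 L q ^ k * H q) + L q * R q)"
      using pow[of k] n by (auto simp: algebra_simps)
    have "wirtinger l (total_pow k G) p = wirtinger l (\<lambda>q. L q * (fact n * (total_deriv 0 L q ^ k * H q) + L q * R q)) p"
      by (rule wirtinger_cong[OF S R(2)])
    also have "\<dots> = wirtinger l L p * (fact n * (total_deriv 0 L p ^ k * H p))"
      by (subst wirtinger_mult[OF S(2) Ls])
         (auto simp: L0 intro!: jet_smooth_add jet_smooth_mult jet_smooth_const jet_smooth_power jet_smooth_total_deriv S Ls H R(1))
    finally show ?thesis by (simp add: wirtinger_L DL)
  qed
qed

context atlas
begin

text \<open>Adding the same small real number to all components of the velocity makes them different from 0.\<close>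

lemma zero_on_regular_jets:
  assumes c: "c \<in> A" and F: "jet_smooth (coords_dom c) F"
    and zero: "\<And>p. p \<in> coords_dom c \<Longrightarrow> regular_jet p \<Longrightarrow> F p = 0" and p: "p \<in> coords_dom c"
  shows "F p = 0"
proof -
  define q where "q s = (fst p, \<lambda>r. if r = 1 then snd p 1 + (\<chi> i. of_real s) else snd p r)" for s :: real
  have q0: "q 0 = p" by (auto simp: q_def prod_eq_iff vec_eq_iff fun_eq_iff)
  have q_dom: "q s \<in> coords_dom c" for s using p by (auto simp: q_def coords_dom_def split_def)
  have "continuous_on UNIV (\<lambda>s. snd p 1 + (\<chi> i. complex_of_real s))"
    by (intro continuous_on_add continuous_on_const continuous_on_vec_lambda continuous_on_of_real continuous_on_id)
  then have "continuous_on UNIV q"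
    unfolding q_def by (intro continuous_on_Pair continuous_on_const continuous_on_coordinatewise_then_product continuous_on_If_const)
  then have "isCont q 0" by (simp add: continuous_on_eq_continuous_at)
  then have "(q \<longlongrightarrow> p) (at 0)" by (simp add: isCont_def q0)
  moreover have "isCont F p"
    using jet_smooth_continuous[OF F] p open_coords_dom[OF c] continuous_on_eq_continuous_at by blast
  ultimately have "((\<lambda>s. F (q s)) \<longlongrightarrow> F p) (at 0)" by (rule isCont_tendsto_compose[rotated])
  moreover have "\<forall>\<^sub>F s in at 0. F (q s) = 0"
  proof -
    have "\<forall>\<^sub>F s in at 0. s \<noteq> - Re (snd p 1 $ i)" for i by (rule eventually_neq_at_within)
    then have "\<forall>\<^sub>F s in at 0. \<forall>i. s \<noteq> - Re (snd p 1 $ i)" by (rule eventually_all_finite)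
    then show ?thesis
    proof (rule eventually_mono)
      fix s assume s: "\<forall>i. s \<noteq> - Re (snd p 1 $ i)"
      have "regular_jet (q s)"
        using s by (auto simp: regular_jet_def q_def complex_eq_iff) (metis add.commute minus_unique)
      then show "F (q s) = 0" using zero q_dom by blast
    qed
  qed
  then have "((\<lambda>s. F (q s)) \<longlongrightarrow> 0) (at 0)" by (rule tendsto_eventually)
  ultimately show ?thesis using tendsto_unique[of "at (0::real)"] by simp
qed

text \<open>The functions \<open>\<beta> \<ell>\<^sup>n\<close> as smooth functions on all of \<open>M\<close>.\<close>

lemma test_function:
  assumes c: "c \<in> A" and p: "p \<in> coords_dom c"
  obtains g H K where "closed K" "K \<subseteq> fst c" "\<And>x. x \<notin> K \<Longrightarrow> g x = 0"
    "jet_smooth (coords_dom c) (local_rep c g)" "g \<in> smooth_fun_M A"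
    "jet_smooth UNIV H" "H p \<noteq> 0"
    "\<And>q. q \<in> coords_dom c \<Longrightarrow> local_rep c g q = (coordinate (0, m) q - coordinate (0, m) p) ^ n * H q"
proof -
  obtain K B where B: "closed K" "K \<subseteq> fst c" "jet_function 0 B" "jet_smooth UNIV B" "B p \<noteq> 0"
    "\<And>q. q \<in> coords_dom c \<Longrightarrow> point_of c q \<notin> K \<Longrightarrow> B q = 0"
    by (rule bump_function[OF c p]) (rule that)
  define G where "G q = (coordinate (0, m) q - coordinate (0, m) p) ^ n * B q" for q
  have G: "jet_function 0 G" unfolding G_def
    by (intro jet_function_mult jet_function_power jet_function_coordinate_diff B(3)) simp
  define g where "g x = (if x \<in> fst c then G (0, \<lambda>_. snd c x) else 0)" for x
  have zero: "g x = 0" if x: "x \<notin> K" for x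
  proof (cases "x \<in> fst c")
    case True
    then have "B (0, \<lambda>_. snd c x) = 0"
      using x point_of_eq[OF c True, of "(0, \<lambda>_. snd c x)"] by (intro B(6)) (auto simp: coords_dom_def)
    then show ?thesis by (simp add: g_def G_def)
  qed (simp add: g_def)
  have loc: "local_rep c g q = G q" if "q \<in> coords_dom c" for q
  proof -
    have "point_of c q \<in> fst c" "snd c (point_of c q) = snd q 0"
      using point_of_coords[of q c UNIV] that by (simp_all add: coords_dom_eq)
    then show ?thesis unfolding local_rep_def g_def by simp (rule jet_functionD[OF G], simp)
  qed
  have Bs: "jet_smooth (coords_dom c) B" by (rule jet_smooth_subset[OF B(4) subset_UNIV])
  have Gs: "jet_smooth (coords_dom c) G" unfolding G_def
    by (intro jet_smooth_mult jet_smooth_power jet_smooth_coordinate_diff Bs open_coords_dom c)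
  have smooth: "jet_smooth (coords_dom c) (local_rep c g)"
    by (rule jet_smooth_cong[OF open_coords_dom[OF c] loc[symmetric] Gs])
  show ?thesis
    by (rule that[OF B(1,2) zero smooth smooth_fun_M_extend[OF c B(1,2) smooth zero] B(4,5)])
       (simp_all add: loc G_def)
qed

lemma jet_function_at_truncate: "jet_function k F \<Longrightarrow> F (truncate k p) = F p"
  by (erule jet_functionD) (simp add: truncate_def)

text \<open>
  At a regular jet, the lift of \<open>\<beta> \<ell>\<^sup>k\<^sup>+\<^sup>1\<close> has a differential that is a non-zero multiple \<open>C\<close> of \<open>d\<ell>\<close>, so the
  defining equation of the complete lift becomes an equation between the coefficients belonging to \<open>\<ell>\<close>.
\<close>

lemma complete_lift_base_coeff:
  assumes Z: "vector_field_N A Z" and W: "complete_lift_of A k Z W" and c: "c \<in> A"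
    and \<zeta>: "\<And>m. jet_smooth (coords_dom c) (local_rep c (\<zeta> m))"
      "\<And>P. P \<in> chart_dom A 0 c \<Longrightarrow> Z P = tvec_of A 0 c P 1 (\<lambda>l. \<zeta> (snd l) (base_point P))"
    and b: "\<And>l. l \<in> cdirs k \<Longrightarrow> smooth_on_chart A k c (b l)"
      "\<And>P. P \<in> chart_dom A k c \<Longrightarrow> W P = tvec_of A k c P 1 (\<lambda>l. b l P)"
    and P: "P \<in> chart_dom A k c"
  shows "b (0, m) P = \<zeta> m (base_point P)"
proof -
  have op: "open (coords_dom c)" by (rule open_coords_dom[OF c])
  define F where "F q = in_coords A k c (b (0, m)) q + (-1) * local_rep c (\<zeta> m) q" for q
  have "jet_smooth (coords_dom c) F" unfolding F_def[abs_def]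
    by (intro jet_smooth_add jet_smooth_mult jet_smooth_const \<zeta> smooth_on_chartD[OF c] b(1) op) (cases m, simp)
  moreover have "F p = 0" if p: "p \<in> coords_dom c" and reg: "regular_jet p" for p
  proof -
    define Q where "Q = of_coords A k c p"
    have Q: "Q \<in> chart_dom A k c" "Q \<in> ext_N A k" and tQ: "to_coords k c Q = truncate k p"
      unfolding Q_def by (rule of_coords_in_chart_dom[OF c p], rule of_coords_in_ext_N[OF c p], rule to_coords_of_coords[OF c p])
    define L where "L = (\<lambda>q. coordinate (0, m) q - coordinate (0, m) p)"
    obtain g H K where "closed K" "K \<subseteq> fst c" "\<And>x. x \<notin> K \<Longrightarrow> g x = 0"
      "jet_smooth (coords_dom c) (local_rep c g)" and g: "g \<in> smooth_fun_M A" "jet_smooth UNIV H" "H p \<noteq> 0"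
      "\<And>q. q \<in> coords_dom c \<Longrightarrow> local_rep c g q = L q ^ Suc k * H q"
      unfolding L_def by (rule test_function[OF c p, where m = m and n = "Suc k"])
        (rule that[unfolded L_def])
    have Hs: "jet_smooth (coords_dom c) H" by (rule jet_smooth_subset[OF g(2) subset_UNIV])
    have \<lambda>: "coordinate (1, m) p \<noteq> 0" using reg by (cases m) (simp add: coordinate_def regular_jet_def)
    define C where "C = fact (Suc k) * (coordinate (1, m) p ^ k * H p)"
    have C: "C \<noteq> 0" using \<lambda> g(3) by (simp add: C_def del: fact_Suc)
    have "W Q (clift_pow A k (on_N g)) = (\<Sum>l\<in>cdirs k. b l Q * wirtinger l (total_pow k (local_rep c g)) p)"
      unfolding b(2)[OF Q(1)] tvec_of_clift_pow[OF g(1) c Q(1)] tQ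
      by (simp add: jet_function_at_truncate[OF jet_function_wirtinger[OF jet_function_total_pow[OF jet_function_local_rep]]])
    also have "\<dots> = (\<Sum>l\<in>cdirs k. if l = (0, m) then b (0, m) Q * C else 0)"
      by (intro sum.cong refl) (auto simp: wirtinger_total_pow_test[OF op p Hs L_def g(4) refl] C_def)
    also have "\<dots> = b (0, m) Q * C" by (cases m) simp
    finally have 1: "W Q (clift_pow A k (on_N g)) = b (0, m) Q * C" .
    have Ls: "jet_smooth (coords_dom c) L" unfolding L_def by (rule jet_smooth_coordinate_diff[OF op])
    define H' where "H' q = of_nat (Suc k) * local_rep c (\<zeta> m) q * H q + L q * (\<Sum>m'\<in>UNIV. local_rep c (\<zeta> m') q * wirtinger (0, m') H q)" for q
    have H': "jet_smooth (coords_dom c) H'" unfolding H'_def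
      by (intro jet_smooth_add jet_smooth_mult jet_smooth_sum jet_smooth_wirtinger jet_smooth_const op \<zeta> Hs Ls)
    have "prolong 0 (\<lambda>m. local_rep c (\<zeta> m)) (local_rep c g) q = L q ^ k * H' q" if q: "q \<in> coords_dom c" for q
    proof -
      have wirtinger_g: "wirtinger l (local_rep c g) q = wirtinger l (\<lambda>q. L q ^ Suc k * H q) q" for l
        by (rule wirtinger_cong[OF op q g(4)])
      have "wirtinger l (\<lambda>q. L q ^ n) q = of_nat n * L q ^ (n - 1) * of_bool (l = (0, m))" for l n
        unfolding wirtinger_power[OF op q Ls] by (simp add: L_def wirtinger_coordinate_diff)
      then have "wirtinger (0, m') (local_rep c g) q = (if m' = m then of_nat (Suc k) * L q ^ k * H q else 0) + L q ^ Suc k * wirtinger (0, m') H q" for m'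
        unfolding wirtinger_g wirtinger_mult[OF q jet_smooth_power[OF op Ls] Hs] by (simp del: power_Suc)
      then have "prolong 0 (\<lambda>m. local_rep c (\<zeta> m)) (local_rep c g) q =
          (\<Sum>m'\<in>UNIV. (if m' = m then local_rep c (\<zeta> m) q * (of_nat (Suc k) * L q ^ k * H q) else 0)
             + L q ^ k * (L q * (local_rep c (\<zeta> m') q * wirtinger (0, m') H q)))"
        unfolding prolong_0 by (intro sum.cong refl) (simp add: algebra_simps)
      then show ?thesis by (simp add: H'_def sum.distrib sum_distrib_left algebra_simps)
    qed
    from total_pow_test_same[OF op p H' L_def this]
    have "total_pow k (prolong 0 (\<lambda>m. local_rep c (\<zeta> m)) (local_rep c g)) p = fact k * (coordinate (1, m) p ^ k * H' p)" .
    also have "\<dots> = local_rep c (\<zeta> m) p * C" by (simp add: H'_def C_def L_def algebra_simps)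
    finally have "clift_pow A k (\<lambda>Q. Z Q (on_N g)) Q = local_rep c (\<zeta> m) p * C"
      using in_coords_clift_pow_vector_field[OF Z g(1) c p \<zeta>(2), of k] by (simp add: in_coords_def Q_def)
    moreover have "W Q (clift_pow A k (on_N g)) = clift_pow A k (\<lambda>Q. Z Q (on_N g)) Q"
      by (rule W[unfolded complete_lift_of_def, THEN conjunct2, rule_format, OF g(1) Q(2)])
    ultimately have "b (0, m) Q * C = local_rep c (\<zeta> m) p * C" using 1 by simp
    then show "F p = 0" using C by (simp add: F_def in_coords_def Q_def)
  qed
  ultimately have "F (to_coords k c P) = 0"
    by (rule zero_on_regular_jets[OF c _ _ to_coords_in_coords_dom[OF c P]])
  then show ?thesis by (simp add: F_def in_coords_def of_coords_to_coords[OF c P] local_rep_def point_of_to_coords[OF c P])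
qed

section \<open>The pullback of a form on the base\<close>

text \<open>
  Tangent vectors are defined to vanish on functions that are not smooth near the base point, and the
  image has to follow this convention at the projected point.
\<close>

definition push_tvec :: "nat \<Rightarrow> 'a ext_point \<Rightarrow> 'a tvec \<Rightarrow> 'a tvec" where
  "push_tvec k P v = (\<lambda>f. if smooth_near A 0 (proj_N A 0 P) f then v (f \<circ> proj_N A 0) else 0)"

definition pullback_form :: "nat \<Rightarrow> 'a form1 \<Rightarrow> 'a form1" where
  "pullback_form k \<omega> P v =
     (if P \<in> ext_N A k \<and> v \<in> tangent A k P then \<omega> (proj_N A 0 P) (push_tvec k P v) else 0)"

lemma proj_N_chart_dom: "P \<in> chart_dom A k c \<Longrightarrow> proj_N A 0 P \<in> chart_dom A 0 c"
  using ext_N_ex_curve[of P k] proj_N_in_ext_N(1)[of P k 0]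
  by (auto simp: chart_dom_def base_point_proj_N)

lemma to_coords_proj_N:
  assumes "c \<in> A" "P \<in> chart_dom A k c"
  shows "to_coords 0 c (proj_N A 0 P) = truncate 0 (to_coords k c P)"
  using proj_N_of_coords[OF assms(1) to_coords_in_coords_dom[OF assms], of 0 k]
    to_coords_of_coords[OF assms(1) to_coords_in_coords_dom[OF assms], of 0] by (simp add: of_coords_to_coords[OF assms])

lemma in_coords_proj_N:
  "c \<in> A \<Longrightarrow> p \<in> coords_dom c \<Longrightarrow> in_coords A k c (f \<circ> proj_N A 0) p = in_coords A 0 c f p"
  by (simp add: in_coords_def proj_N_of_coords)

lemma depends_upto_at_truncate: "depends_upto k F \<Longrightarrow> F (truncate k p) = F p"
  by (erule depends_uptoD) (simp_all add: truncate_def)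

lemma smooth_near_proj_N:
  assumes P: "P \<in> ext_N A k" and f: "smooth_near A 0 (proj_N A 0 P) f"
  shows "smooth_near A k P (f \<circ> proj_N A 0)"
proof -
  obtain c S where c: "c \<in> A" "proj_N A 0 P \<in> chart_dom A 0 c" and S: "open S" "to_coords 0 c (proj_N A 0 P) \<in> S"
    "S \<subseteq> coords_dom c" and smooth: "jet_smooth S (in_coords A 0 c f)"
    by (rule smooth_nearE[OF f])
  have Pc: "P \<in> chart_dom A k c" using c(2) P by (simp add: chart_dom_def base_point_proj_N)
  \<comment> \<open>Smoothness of \<open>f\<close> is known near a point of order 0 only; its preimage serves at order \<open>k\<close>.\<close>
  define T where "T = truncate 0 -` S"
  have "continuous_on UNIV (\<lambda>p. (fst p, \<lambda>r. if r \<le> 0 then snd p r else 0 :: complex ^ 'm))"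
    by (intro continuous_on_Pair continuous_on_fst continuous_on_id continuous_on_coordinatewise_then_product
        continuous_on_If_const continuous_on_snd_apply continuous_on_const)
  then have cont: "continuous_on UNIV (truncate 0 :: 'm coords \<Rightarrow> 'm coords)" unfolding truncate_def .
  have T: "open T" unfolding T_def by (rule open_vimage[OF S(1) cont])
  have "jet_smooth T (\<lambda>p. in_coords A 0 c f (truncate 0 p))"
  proof (rule jet_smooth_compose[OF T S(1) _ _ _ continuous_on_subset[OF cont subset_UNIV] depends_upto_in_coords smooth])
    show "jet_smooth T (\<lambda>p. coordinate l (truncate 0 p))" if "l \<in> cdirs 0" for l
    proof -
      have "coordinate l (truncate 0 p) = coordinate l p" for p
        using that by (cases l) (simp add: coordinate_def truncate_def)
      then show ?thesis using jet_smooth_coordinate[OF T] by simp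
    qed
  qed (simp_all add: T_def truncate_def)
  then have "jet_smooth T (in_coords A 0 c f)"
    by (simp add: depends_upto_at_truncate[OF depends_upto_in_coords])
  moreover have sub: "T \<subseteq> coords_dom c" using S(3) by (auto simp: T_def truncate_def coords_dom_def)
  ultimately have "jet_smooth T (in_coords A k c (f \<circ> proj_N A 0))"
    by (intro jet_smooth_cong[OF T in_coords_proj_N[OF c(1) subsetD[OF sub], symmetric]])
  moreover have "to_coords k c P \<in> T" using S(2) by (simp add: T_def to_coords_proj_N[OF c(1) Pc])
  ultimately show ?thesis using sub by (intro smooth_nearI[OF c(1) Pc T])
qed

text \<open>
  The derivatives of a pulled back function in coordinates of positive order vanish, so the projection keeps
  the coefficients of order 0 and drops the others.
\<close>

lemma push_tvec_of:
  assumes c: "c \<in> A" "P \<in> chart_dom A k c"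
  shows "push_tvec k P (tvec_of A k c P a \<beta>) = tvec_of A 0 c (proj_N A 0 P) a \<beta>"
proof
  fix f
  show "push_tvec k P (tvec_of A k c P a \<beta>) f = tvec_of A 0 c (proj_N A 0 P) a \<beta> f"
  proof (cases "smooth_near A 0 (proj_N A 0 P) f")
    case True
    define p where "p = to_coords k c P"
    have p: "p \<in> coords_dom c" unfolding p_def by (rule to_coords_in_coords_dom[OF c])
    note eq = open_coords_dom[OF c(1)] p in_coords_proj_N[OF c(1)]
    have "wirtinger l (in_coords A k c (f \<circ> proj_N A 0)) p = wirtinger l (in_coords A 0 c f) (truncate 0 p)" for l
      unfolding depends_upto_at_truncate[OF depends_upto_wirtinger[OF depends_upto_in_coords]] by (rule wirtinger_cong[OF eq])
    moreover have "d_time (in_coords A k c (f \<circ> proj_N A 0)) p = d_time (in_coords A 0 c f) (truncate 0 p)"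
      unfolding depends_upto_at_truncate[OF depends_upto_d_time[OF depends_upto_in_coords]]
      unfolding d_time_eq by (rule pd_cong[OF eq])
    moreover have "(\<Sum>l\<in>cdirs k. \<beta> l * wirtinger l (in_coords A 0 c f) (truncate 0 p)) =
        (\<Sum>l\<in>cdirs 0. \<beta> l * wirtinger l (in_coords A 0 c f) (truncate 0 p))"
      using cdirs_mono[of 0 k] wirtinger_above[OF depends_upto_in_coords] by (intro sum.mono_neutral_right) auto
    ultimately show ?thesis
      using True smooth_near_proj_N[OF chart_domD(1)[OF c(2)] True]
      by (simp add: push_tvec_def tvec_of_apply to_coords_proj_N[OF c] p_def[symmetric])
  qed (simp add: push_tvec_def tvec_of_apply)
qed

lemma push_tvec_tangent: "v \<in> tangent A k P \<Longrightarrow> push_tvec k P v \<in> tangent A 0 (proj_N A 0 P)"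
  unfolding tangent_iff using push_tvec_of proj_N_chart_dom by metis

text \<open>Coordinates only reach points of the extension, so values elsewhere do not matter.\<close>

lemma tangent_cong:
  assumes v: "v \<in> tangent A k P" and eq: "\<And>Q. Q \<in> ext_N A k \<Longrightarrow> f Q = g Q"
  shows "v f = v g"
proof -
  have near: "smooth_near A k P g" if f: "smooth_near A k P f" and fg: "\<And>Q. Q \<in> ext_N A k \<Longrightarrow> f Q = g Q" for f g
  proof -
    obtain c S where c: "c \<in> A" "P \<in> chart_dom A k c" and S: "open S" "to_coords k c P \<in> S"
      "S \<subseteq> coords_dom c" and smooth: "jet_smooth S (in_coords A k c f)"
      by (rule smooth_nearE[OF f])
    have "jet_smooth S (in_coords A k c g)"
      by (rule jet_smooth_cong[OF S(1) _ smooth])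
         (simp add: in_coords_def fg[OF of_coords_in_ext_N[OF c(1) subsetD[OF S(3)]]])
    then show ?thesis by (rule smooth_nearI[OF c S])
  qed
  obtain c a \<beta> where c: "c \<in> A" "P \<in> chart_dom A k c" and v_eq: "v = tvec_of A k c P a \<beta>"
    using v unfolding tangent_iff by metis
  have "in_coords A k c f p = in_coords A k c g p" if "p \<in> coords_dom c" for p
    by (simp add: in_coords_def eq[OF of_coords_in_ext_N[OF c(1) that]])
  note cong = open_coords_dom[OF c(1)] to_coords_in_coords_dom[OF c] this
  have "smooth_near A k P f \<longleftrightarrow> smooth_near A k P g" using near[of f g] near[of g f] eq by auto
  then show ?thesis
    unfolding v_eq tvec_of_apply using wirtinger_cong[OF cong] pd_cong[OF cong, where j = None] by (simp add: d_time_eq)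
qed

lemma push_tvec_apply:
  assumes v: "v \<in> tangent A k P" "P \<in> ext_N A k" and f: "smooth_near A 0 (proj_N A 0 P) f"
    and eq: "\<And>Q. Q \<in> ext_N A k \<Longrightarrow> f (proj_N A 0 Q) = f Q"
  shows "push_tvec k P v f = v f"
  using tangent_cong[OF v(1), of "f \<circ> proj_N A 0" f] f eq by (simp add: push_tvec_def)

lemma z_coord_eq: "z_coord c 0 i = on_N (coord_fun c (i, False))" "zbar_coord c 0 i = on_N (coord_fun c (i, True))"
  by (auto simp: z_coord_def zbar_coord_def z_vec_def on_N_def coord_fun_def base_point_def)

lemma smooth_coord_fun: "c \<in> A \<Longrightarrow> smooth_on_chart A k c (on_N (coord_fun c m))"
  unfolding smooth_on_chart_on_N
  by (rule jet_smooth_cong[OF open_coords_dom local_rep_coord_fun[symmetric] jet_smooth_coordinate[OF open_coords_dom]])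

lemma in_coords_t_coord: "in_coords A k c t_coord p = complex_of_real (fst p)"
  by (simp add: in_coords_def t_coord_def of_coords_def split_def)

lemma smooth_t_coord: "c \<in> A \<Longrightarrow> smooth_on_chart A k c t_coord"
  by (rule smooth_on_chartI[OF _ jet_smooth_time[OF open_coords_dom] in_coords_t_coord])

lemma pullback_form_eq:
  assumes \<omega>: "\<And>P v. P \<in> chart_dom A 0 c \<Longrightarrow> v \<in> tangent A 0 P \<Longrightarrow>
           \<omega> P v = d t_coord P v
             + (\<Sum>i\<in>UNIV. on_N (w i) P * d (z_coord c 0 i) P v)
             + (\<Sum>i\<in>UNIV. on_N (w' i) P * d (zbar_coord c 0 i) P v)"
    and c: "c \<in> A" "P \<in> chart_dom A k c" and v: "v \<in> tangent A k P"
  shows "pullback_form k \<omega> P v = d t_coord P v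
             + (\<Sum>i\<in>UNIV. on_N (w i) P * d (z_coord c 0 i) P v)
             + (\<Sum>i\<in>UNIV. on_N (w' i) P * d (zbar_coord c 0 i) P v)"
proof -
  note P = chart_domD(1)[OF c(2)]
  note P0 = proj_N_chart_dom[OF c(2)]
  have near: "smooth_near A 0 (proj_N A 0 P) f" if "smooth_on_chart A 0 c f" for f
    by (rule smooth_on_chart_imp_smooth_near[OF c(1) P0 that])
  have push: "push_tvec k P v (on_N (coord_fun c m)) = v (on_N (coord_fun c m))" for m
    by (rule push_tvec_apply[OF v P near[OF smooth_coord_fun[OF c(1)]]]) (simp add: on_N_def base_point_proj_N)
  have push_t: "push_tvec k P v t_coord = v t_coord"
    by (rule push_tvec_apply[OF v P near[OF smooth_t_coord[OF c(1)]]]) (simp add: t_coord_def proj_N_def split_def)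
  have "on_N g (proj_N A 0 P) = on_N g P" for g by (simp add: on_N_def base_point_proj_N[OF P])
  then show ?thesis
    using \<omega>[OF P0 push_tvec_tangent[OF v]] P v
    by (simp add: pullback_form_def d_def z_coord_eq push push_t)
qed

end

section \<open>Uniqueness of the vertical lift\<close>

context atlas
begin

definition coord_on_ext :: "('a, 'm) chart \<Rightarrow> 'm cdir \<Rightarrow> 'a ext_fun" where
  "coord_on_ext c l = (case l of (r, i, e) \<Rightarrow> if e then zbar_coord c r i else z_coord c r i)"

lemma in_coords_coord_on_ext:
  "c \<in> A \<Longrightarrow> p \<in> coords_dom c \<Longrightarrow> l \<in> cdirs k \<Longrightarrow> in_coords A k c (coord_on_ext c l) p = coordinate l p"
  by (cases l) (simp add: in_coords_def coord_on_ext_def z_coord_def zbar_coord_def z_vec_of_coords coordinate_def)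

text \<open>The definition with one family of coefficients, indexed by the complex directions.\<close>

lemma one_form_iff:
  "one_form A k \<eta> \<longleftrightarrow>
     (\<forall>c\<in>A. \<exists>a \<beta>. smooth_on_chart A k c a \<and> (\<forall>l\<in>cdirs k. smooth_on_chart A k c (\<beta> l)) \<and>
        (\<forall>P\<in>chart_dom A k c. \<forall>v\<in>tangent A k P.
           \<eta> P v = a P * v t_coord + (\<Sum>l\<in>cdirs k. \<beta> l P * v (coord_on_ext c l)))) \<and>
     (\<forall>P v. P \<notin> ext_N A k \<or> v \<notin> tangent A k P \<longrightarrow> \<eta> P v = 0)" (is "_ \<longleftrightarrow> (\<forall>c\<in>A. ?R c) \<and> ?Z")
proof -
  have "(\<exists>a b b'. smooth_on_chart A k c a \<and>
        (\<forall>r\<le>k. \<forall>i. smooth_on_chart A k c (b r i) \<and> smooth_on_chart A k c (b' r i)) \<and>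
        (\<forall>P\<in>chart_dom A k c. \<forall>v\<in>tangent A k P.
           \<eta> P v = a P * d t_coord P v
             + (\<Sum>r\<le>k. \<Sum>i\<in>UNIV. b r i P * d (z_coord c r i) P v
                              + b' r i P * d (zbar_coord c r i) P v))) \<longleftrightarrow> ?R c" (is "?L c \<longleftrightarrow> _") for c
  proof
    assume "?L c"
    then obtain a b b' where *: "smooth_on_chart A k c a"
      "\<forall>r\<le>k. \<forall>i. smooth_on_chart A k c (b r i) \<and> smooth_on_chart A k c (b' r i)"
      "\<forall>P\<in>chart_dom A k c. \<forall>v\<in>tangent A k P. \<eta> P v = a P * d t_coord P v
             + (\<Sum>r\<le>k. \<Sum>i\<in>UNIV. b r i P * d (z_coord c r i) P v + b' r i P * d (zbar_coord c r i) P v)"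
      by (elim exE conjE) (rule that)
    define \<beta> where "\<beta> l = (case l of (r, i, e) \<Rightarrow> if e then b' r i else b r i)" for l :: "'m cdir"
    have "smooth_on_chart A k c (\<beta> l)" if "l \<in> cdirs k" for l
      using *(2) that by (cases l) (simp add: \<beta>_def)
    then show "?R c"
      using *(1,3) by (intro exI[of _ a] exI[of _ \<beta>]) (simp add: sum_cdirs coord_on_ext_def d_def \<beta>_def)
  next
    assume "?R c"
    then obtain a \<beta> where *: "smooth_on_chart A k c a" "\<forall>l\<in>cdirs k. smooth_on_chart A k c (\<beta> l)"
      "\<forall>P\<in>chart_dom A k c. \<forall>v\<in>tangent A k P.
           \<eta> P v = a P * v t_coord + (\<Sum>l\<in>cdirs k. \<beta> l P * v (coord_on_ext c l))"
      by (elim exE conjE) (rule that)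
    show "?L c"
      by (rule exI[of _ a], rule exI[of _ "\<lambda>r i. \<beta> (r, i, False)"], rule exI[of _ "\<lambda>r i. \<beta> (r, i, True)"])
         (use * in \<open>simp add: sum_cdirs coord_on_ext_def d_def\<close>)
  qed
  then show ?thesis unfolding one_form_def by simp
qed

lemma tvec_of_coordinates:
  assumes c: "c \<in> A" "P \<in> chart_dom A k c"
  shows "tvec_of A k c P a \<beta> t_coord = a"
    and "l \<in> cdirs k \<Longrightarrow> tvec_of A k c P a \<beta> (coord_on_ext c l) = \<beta> l"
proof -
  define p where "p = to_coords k c P"
  note dom = open_coords_dom[OF c(1)] to_coords_in_coords_dom[OF c]
  have wirtinger_time: "wirtinger l (\<lambda>p. complex_of_real (fst p)) p = 0" for l
    by (cases l) (simp add: wirtinger_eq pd_time)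
  have "in_coords A k c t_coord = (\<lambda>p. complex_of_real (fst p))" by (rule ext) (rule in_coords_t_coord)
  then show "tvec_of A k c P a \<beta> t_coord = a"
    using smooth_on_chart_imp_smooth_near[OF c smooth_t_coord[OF c(1)]]
    by (simp add: tvec_of_apply wirtinger_time p_def[symmetric] d_time_eq pd_time)
  assume l: "l \<in> cdirs k"
  note eq = in_coords_coord_on_ext[OF c(1) _ l]
  have "smooth_on_chart A k c (coord_on_ext c l)"
    by (rule smooth_on_chartI[OF c(1) jet_smooth_coordinate[OF dom(1)] eq])
  moreover have "wirtinger m (in_coords A k c (coord_on_ext c l)) p = of_bool (m = l)" for m
    unfolding p_def wirtinger_coordinate[symmetric, of _ _ "to_coords k c P"] by (rule wirtinger_cong[OF dom eq])
  moreover have "d_time (in_coords A k c (coord_on_ext c l)) p = 0"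
  proof -
    have "d_time (in_coords A k c (coord_on_ext c l)) p = pd None (coordinate l) p"
      unfolding p_def d_time_eq by (rule pd_cong[OF dom eq])
    then show ?thesis by (cases l) (simp add: pd_coordinate)
  qed
  ultimately have "tvec_of A k c P a \<beta> (coord_on_ext c l) = (\<Sum>m\<in>cdirs k. if m = l then \<beta> l else 0)"
    using smooth_on_chart_imp_smooth_near[OF c]
    by (auto simp: tvec_of_apply p_def[symmetric] intro!: sum.cong)
  then show "tvec_of A k c P a \<beta> (coord_on_ext c l) = \<beta> l" using l by (simp add: sum.delta)
qed

lemma lifted_field_tangent: "P \<in> ext_N A k \<Longrightarrow> lifted_field X k P \<in> tangent A k P"
  unfolding lifted_field_def Let_def tangent_iff
  using chart_at[of "base_point P"] chart_domI[of P k "chart_at A (base_point P)"] by auto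

lemma vector_family_zero: "vector_family (\<lambda>c m x. 0)"
  by (simp add: vector_family_def local_rep_def[abs_def] prolong_0 jet_smooth_const)

lemma lift_coeff_spread_test:
  assumes c: "c \<in> A" and p: "p \<in> coords_dom c" and l: "l \<in> cdirs k"
  shows "lift_coeff (spread_family c X0) k c (of_coords A k c p) l = total_pow (fst l) (local_rep c (X0 (snd l))) p"
proof -
  have "lift_coeff (spread_family c X0) k c (of_coords A k c p) l
      = total_pow (fst l) (local_rep c (spread_family c X0 c (snd l))) p"
    using in_coords_lift_coeff[OF c p l] by (simp add: in_coords_def)
  also have "\<dots> = total_pow (fst l) (local_rep c (X0 (snd l))) p"
    by (rule total_pow_cong[OF open_coords_dom[OF c] local_rep_spread_family_same[OF c] p])
  finally show ?thesis .
qed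

text \<open>
  The zero field has the lift \<open>\<partial>/\<partial>t\<close>, which gives \<open>a = 0\<close>. For the others, the field with the single
  coefficient \<open>\<beta> \<ell>\<^sup>r\<close> has a lift without components of order below \<open>r\<close> at the jets over a zero of \<open>\<ell>\<close>.
  At a regular jet its component of order \<open>r\<close> is not 0, so the coefficients of the form vanish there by
  induction from order \<open>k\<close> downwards; regular jets are dense.
\<close>

lemma annihilator_of_lifts:
  assumes c: "c \<in> A" and \<beta>: "\<And>l. l \<in> cdirs k \<Longrightarrow> jet_smooth (coords_dom c) (in_coords A k c (\<beta> l))"
    and zero: "\<And>X P. vector_family X \<Longrightarrow> P \<in> chart_dom A k c \<Longrightarrow>
       a P + (\<Sum>l\<in>cdirs k. \<beta> l P * lift_coeff X k c P l) = 0"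
    and P: "P \<in> chart_dom A k c"
  shows "a P = 0" "l \<in> cdirs k \<Longrightarrow> \<beta> l P = 0"
proof -
  have op: "open (coords_dom c)" by (rule open_coords_dom[OF c])
  have a0: "a P = 0" if P: "P \<in> chart_dom A k c" for P
    using zero[OF vector_family_zero P] by (simp add: lift_coeff_def local_rep_def[abs_def])
  then show "a P = 0" using P .
  have reg: "\<beta> (r, m) (of_coords A k c p) = 0"
    if p: "p \<in> coords_dom c" "regular_jet p" and "r \<le> k" for r m p
    using \<open>r \<le> k\<close>
  proof (induction "k - r" arbitrary: r rule: less_induct)
    case less
    define Q where "Q = of_coords A k c p"
    have Q: "Q \<in> chart_dom A k c" unfolding Q_def by (rule of_coords_in_chart_dom[OF c p(1)])
    obtain g H K where K: "closed K" "K \<subseteq> fst c" "\<And>x. x \<notin> K \<Longrightarrow> g x = 0"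
      and g: "jet_smooth (coords_dom c) (local_rep c g)" "g \<in> smooth_fun_M A"
      and H: "jet_smooth UNIV H" "H p \<noteq> 0"
      and gH: "\<And>q. q \<in> coords_dom c \<Longrightarrow> local_rep c g q = (coordinate (0, m) q - coordinate (0, m) p) ^ r * H q"
      by (rule test_function[OF c p(1), where m = m and n = r]) (rule that)
    note test = total_pow_test_lower[OF op p(1) jet_smooth_subset[OF H(1) subset_UNIV] refl gH]
      total_pow_test_same[OF op p(1) jet_smooth_subset[OF H(1) subset_UNIV] refl gH]
    define X0 where "X0 m' = (if m' = m then g else (\<lambda>_. 0))" for m'
    have loc0: "local_rep c (\<lambda>_. 0) = (\<lambda>_. 0)" by (simp add: local_rep_def[abs_def])
    have X: "vector_family (spread_family c X0)"
      by (rule vector_family_spread_family[OF c K(1,2)]) (use g(1) K(3) in \<open>auto simp: X0_def loc0 jet_smooth_const\<close>)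
    have other: "\<beta> l Q * lift_coeff (spread_family c X0) k c Q l = 0" if l: "l \<in> cdirs k" "l \<noteq> (r, m)" for l
    proof -
      obtain r' m' where l': "l = (r', m')" by (cases l)
      have r': "r' \<le> k" using l(1) by (cases m') (simp add: l')
      have coeff: "lift_coeff (spread_family c X0) k c Q l = total_pow r' (local_rep c (X0 m')) p"
        unfolding Q_def lift_coeff_spread_test[OF c p(1) l(1)] by (simp add: l')
      \<comment> \<open>Other components are 0, lower orders vanish by the choice of the test function, higher ones by induction.\<close>
      consider "m' \<noteq> m" | "m' = m" "r' < r" | "m' = m" "r' > r" using l(2) l' by force
      then show ?thesis
      proof cases
        case 3
        then have "\<beta> l Q = 0" using less(1)[of r'] r' by (simp add: l' Q_def)
        then show ?thesis by simp
      qed (simp_all add: coeff X0_def loc0 test(1))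
    qed
    have rm: "(r, m) \<in> cdirs k" using less.prems by (cases m) simp
    have "0 = (\<Sum>l\<in>cdirs k. \<beta> l Q * lift_coeff (spread_family c X0) k c Q l)"
      using zero[OF X Q] a0[OF Q] by simp
    also have "\<dots> = \<beta> (r, m) Q * lift_coeff (spread_family c X0) k c Q (r, m)"
      by (subst sum.remove[OF finite_cdirs rm]) (simp add: other)
    also have "lift_coeff (spread_family c X0) k c Q (r, m) = fact r * (coordinate (1, m) p ^ r * H p)"
      by (simp add: Q_def lift_coeff_spread_test[OF c p(1) rm] X0_def test(2))
    finally show ?case
      using H(2) p(2) by (cases m) (auto simp: coordinate_def regular_jet_def Q_def split: if_splits)
  qed
  assume l: "l \<in> cdirs k"
  have "in_coords A k c (\<beta> l) (to_coords k c P) = 0"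
    by (rule zero_on_regular_jets[OF c \<beta>[OF l] _ to_coords_in_coords_dom[OF c P]])
       (use reg l in \<open>cases l; auto simp: in_coords_def cdirs_def\<close>)
  then show "\<beta> l P = 0" by (simp add: in_coords_def of_coords_to_coords[OF c P])
qed

text \<open>The coefficients of the difference satisfy the hypothesis of \<open>annihilator_of_lifts\<close>.\<close>

lemma one_form_eqI:
  assumes \<eta>: "one_form A k \<eta>" "one_form A k \<eta>'"
    and eq: "\<And>X P. vector_family X \<Longrightarrow> P \<in> ext_N A k \<Longrightarrow> \<eta> P (lifted_field X k P) = \<eta>' P (lifted_field X k P)"
  shows "\<eta> = \<eta>'"
proof (rule ext, rule ext)
  fix P v
  show "\<eta> P v = \<eta>' P v"
  proof (cases "P \<in> ext_N A k \<and> v \<in> tangent A k P")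
    case False
    then show ?thesis using \<eta> unfolding one_form_iff by metis
  next
    case True
    obtain c where c: "c \<in> A" "base_point P \<in> fst c" by (rule bexE[OF ex_chart])
    have P: "P \<in> chart_dom A k c" using True c(2) by (simp add: chart_dom_def)
    obtain a \<beta> where 1: "smooth_on_chart A k c a" "\<forall>l\<in>cdirs k. smooth_on_chart A k c (\<beta> l)"
      "\<forall>P\<in>chart_dom A k c. \<forall>v\<in>tangent A k P.
           \<eta> P v = a P * v t_coord + (\<Sum>l\<in>cdirs k. \<beta> l P * v (coord_on_ext c l))"
      using \<eta>(1)[unfolded one_form_iff, THEN conjunct1, rule_format, OF c(1)] by (elim exE conjE) (rule that)
    obtain a' \<beta>' where 2: "smooth_on_chart A k c a'" "\<forall>l\<in>cdirs k. smooth_on_chart A k c (\<beta>' l)"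
      "\<forall>P\<in>chart_dom A k c. \<forall>v\<in>tangent A k P.
           \<eta>' P v = a' P * v t_coord + (\<Sum>l\<in>cdirs k. \<beta>' l P * v (coord_on_ext c l))"
      using \<eta>(2)[unfolded one_form_iff, THEN conjunct1, rule_format, OF c(1)] by (elim exE conjE) (rule that)
    define \<delta> where "\<delta> l P = \<beta> l P + (-1) * \<beta>' l P" for l P
    have \<delta>_smooth: "jet_smooth (coords_dom c) (in_coords A k c (\<delta> l))" if "l \<in> cdirs k" for l
    proof -
      have "jet_smooth (coords_dom c) (\<lambda>p. in_coords A k c (\<beta> l) p + (-1) * in_coords A k c (\<beta>' l) p)"
        by (intro jet_smooth_add jet_smooth_mult jet_smooth_const open_coords_dom smooth_on_chartD c(1) 1(2)[rule_format] 2(2)[rule_format] that)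
      then show ?thesis by (simp add: in_coords_def \<delta>_def o_def)
    qed
    have zero: "(a Q - a' Q) + (\<Sum>l\<in>cdirs k. \<delta> l Q * lift_coeff X k c Q l) = 0"
      if X: "vector_family X" and Q: "Q \<in> chart_dom A k c" for X Q
    proof -
      define W where "W = lifted_field X k Q"
      have W: "W \<in> tangent A k Q" unfolding W_def by (rule lifted_field_tangent[OF chart_domD(1)[OF Q]])
      have "W t_coord = 1" "l \<in> cdirs k \<Longrightarrow> W (coord_on_ext c l) = lift_coeff X k c Q l" for l
        unfolding W_def lifted_field_eq[OF X c(1) Q] by (rule tvec_of_coordinates[OF c(1) Q], assumption?)+
      moreover have "\<eta> Q W = \<eta>' Q W" unfolding W_def by (rule eq[OF X chart_domD(1)[OF Q]])
      ultimately show ?thesis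
        using 1(3)[rule_format, OF Q W] 2(3)[rule_format, OF Q W]
        by (simp add: \<delta>_def algebra_simps sum_subtractf)
    qed
    have "\<beta> l P = \<beta>' l P" if "l \<in> cdirs k" for l
      using annihilator_of_lifts(2)[where a = "\<lambda>Q. a Q - a' Q" and \<beta> = \<delta>, OF c(1) _ _ P that] \<delta>_smooth zero
      by (simp add: \<delta>_def)
    moreover have "a P = a' P"
      using annihilator_of_lifts(1)[where a = "\<lambda>Q. a Q - a' Q" and \<beta> = \<delta>, OF c(1) _ _ P] \<delta>_smooth zero by simp
    ultimately show ?thesis using 1(3)[rule_format, OF P] 2(3)[rule_format, OF P] True by simp
  qed
qed

text \<open>Together with \<open>push_tvec_of\<close>, equality of the coefficients of order 0 says that \<open>W\<close> projects to \<open>Z\<close>.\<close>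

lemma complete_lift_pushforward:
  assumes Z: "vector_field_N A Z" and W: "complete_lift_of A k Z W" and P: "P \<in> ext_N A k"
  shows "push_tvec k P (W P) = Z (proj_N A 0 P)" "W P \<in> tangent A k P"
proof -
  obtain c where c: "c \<in> A" "base_point P \<in> fst c" by (rule bexE[OF ex_chart])
  have Pc: "P \<in> chart_dom A k c" using P c(2) by (simp add: chart_dom_def)
  obtain \<zeta> where \<zeta>: "\<And>m. jet_smooth (coords_dom c) (local_rep c (\<zeta> m))"
    "\<And>P. P \<in> chart_dom A 0 c \<Longrightarrow> Z P = tvec_of A 0 c P 1 (\<lambda>l. \<zeta> (snd l) (base_point P))"
    by (rule vector_field_N_local[OF Z c(1)]) (rule that)
  obtain b b' where b: "\<forall>r\<le>k. \<forall>i. smooth_on_chart A k c (b r i) \<and> smooth_on_chart A k c (b' r i)"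
    "\<forall>P\<in>chart_dom A k c. W P = coord_tvec A k c P 1 (\<lambda>r i. b r i P) (\<lambda>r i. b' r i P)"
    using W[unfolded complete_lift_of_def vector_field_ext_def, THEN conjunct1, rule_format, OF c(1)]
    by (elim exE conjE) (rule that)
  define \<beta> where "\<beta> l = (if snd (snd l) then b' (fst l) (fst (snd l)) else b (fst l) (fst (snd l)))" for l :: "'m cdir"
  have \<beta>: "smooth_on_chart A k c (\<beta> l)" if "l \<in> cdirs k" for l
    using b(1) that by (cases l) (simp add: \<beta>_def)
  have W_eq: "W Q = tvec_of A k c Q 1 (\<lambda>l. \<beta> l Q)" if "Q \<in> chart_dom A k c" for Q
    using b(2) that by (simp add: tvec_of_def \<beta>_def)
  show "W P \<in> tangent A k P" unfolding tangent_iff W_eq[OF Pc] using c(1) Pc by blast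
  have "push_tvec k P (W P) = tvec_of A 0 c (proj_N A 0 P) 1 (\<lambda>l. \<beta> l P)"
    unfolding W_eq[OF Pc] by (rule push_tvec_of[OF c(1) Pc])
  also have "\<dots> = tvec_of A 0 c (proj_N A 0 P) 1 (\<lambda>l. \<zeta> (snd l) (base_point (proj_N A 0 P)))"
  proof (rule tvec_of_cong)
    fix l :: "'m cdir" assume "l \<in> cdirs 0"
    then have "l = (0, snd l)" by (cases l) simp
    then show "\<beta> l P = \<zeta> (snd l) (base_point (proj_N A 0 P))"
      using complete_lift_base_coeff[OF Z W c(1) \<zeta> \<beta> W_eq Pc, of "snd l"] by (simp add: base_point_proj_N[OF P])
  qed
  also have "\<dots> = Z (proj_N A 0 P)" by (rule \<zeta>(2)[OF proj_N_chart_dom[OF Pc], symmetric])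
  finally show "push_tvec k P (W P) = Z (proj_N A 0 P)" .
qed

lemma one_form_pullback_form:
  assumes w: "\<And>c i. c \<in> A \<Longrightarrow> smooth_on_chart A 0 c (on_N (w c i))" "\<And>c i. c \<in> A \<Longrightarrow> smooth_on_chart A 0 c (on_N (w' c i))"
    and \<omega>: "\<And>c P v. c \<in> A \<Longrightarrow> P \<in> chart_dom A 0 c \<Longrightarrow> v \<in> tangent A 0 P \<Longrightarrow>
           \<omega> P v = d t_coord P v
             + (\<Sum>i\<in>UNIV. on_N (w c i) P * d (z_coord c 0 i) P v)
             + (\<Sum>i\<in>UNIV. on_N (w' c i) P * d (zbar_coord c 0 i) P v)"
  shows "one_form A k (pullback_form k \<omega>)"
  unfolding one_form_iff
proof (intro conjI ballI)
  show "\<forall>P v. P \<notin> ext_N A k \<or> v \<notin> tangent A k P \<longrightarrow> pullback_form k \<omega> P v = 0"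
    by (auto simp: pullback_form_def)
  fix c assume c: "c \<in> A"
  define \<beta> where "\<beta> l = (if fst l = 0 then on_N (if snd (snd l) then w' c (fst (snd l)) else w c (fst (snd l))) else (\<lambda>_. 0))"
    for l :: "'m cdir"
  have const: "smooth_on_chart A k c (\<lambda>_. a)" for a
    by (rule smooth_on_chartI[OF c jet_smooth_const]) (simp add: in_coords_def)
  have \<beta>: "smooth_on_chart A k c (\<beta> l)" for l
    using w[OF c] const by (simp add: \<beta>_def smooth_on_chart_on_N[OF c])
  have "pullback_form k \<omega> P v = 1 * v t_coord + (\<Sum>l\<in>cdirs k. \<beta> l P * v (coord_on_ext c l))"
    if P: "P \<in> chart_dom A k c" and v: "v \<in> tangent A k P" for P v
  proof -
    have "(\<Sum>l\<in>cdirs k. \<beta> l P * v (coord_on_ext c l)) = (\<Sum>l\<in>cdirs 0. \<beta> l P * v (coord_on_ext c l))"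
      using cdirs_mono[of 0 k] by (intro sum.mono_neutral_right) (auto simp: \<beta>_def cdirs_def)
    then show ?thesis
      using pullback_form_eq[OF \<omega>[OF c] c P v]
      by (simp add: sum_cdirs \<beta>_def coord_on_ext_def d_def sum.distrib)
  qed
  then show "\<exists>a \<beta>. smooth_on_chart A k c a \<and> (\<forall>l\<in>cdirs k. smooth_on_chart A k c (\<beta> l)) \<and>
        (\<forall>P\<in>chart_dom A k c. \<forall>v\<in>tangent A k P.
           pullback_form k \<omega> P v = a P * v t_coord + (\<Sum>l\<in>cdirs k. \<beta> l P * v (coord_on_ext c l)))"
    using \<beta> const by (intro exI[of _ "\<lambda>_. 1"] exI[of _ \<beta>]) auto
qed

lemma vertical_lift_eq_pullback:
  assumes "one_form A k (pullback_form k \<omega>)"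
  shows "vertical_lift_form A k \<omega> = pullback_form k \<omega>"
  unfolding vertical_lift_form_def
proof (rule the_equality)
  have "pullback_form k \<omega> P (W P) = vlift_pow A k (\<lambda>Q. \<omega> Q (Z Q)) P"
    if Z: "vector_field_N A Z" and W: "complete_lift_of A k Z W" and P: "P \<in> ext_N A k" for Z W P
    using complete_lift_pushforward[OF Z W P] P by (simp add: pullback_form_def vlift_pow_eq)
  then show *: "one_form A k (pullback_form k \<omega>) \<and>
     (\<forall>Z W. vector_field_N A Z \<and> complete_lift_of A k Z W \<longrightarrow>
        (\<forall>P\<in>ext_N A k. pullback_form k \<omega> P (W P) = vlift_pow A k (\<lambda>Q. \<omega> Q (Z Q)) P))"
    using assms by simp
  fix \<eta> assume \<eta>: "one_form A k \<eta> \<and> (\<forall>Z W. vector_field_N A Z \<and> complete_lift_of A k Z W \<longrightarrow>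
        (\<forall>P\<in>ext_N A k. \<eta> P (W P) = vlift_pow A k (\<lambda>Q. \<omega> Q (Z Q)) P))"
  show "\<eta> = pullback_form k \<omega>"
  proof (rule one_form_eqI[OF conjunct1[OF \<eta>] assms])
    fix X P assume X: "vector_family X" and P: "P \<in> ext_N A k"
    note lift = conjI[OF vector_field_N_lifted_field[OF X] complete_lift_lifted_field[OF X]]
    show "\<eta> P (lifted_field X k P) = pullback_form k \<omega> P (lifted_field X k P)"
      using conjunct2[OF \<eta>, rule_format, OF lift P] conjunct2[OF *, rule_format, OF lift P] by simp
  qed
qed

end

theorem proposition3p3p1:
  fixes A :: "('a::{t2_space, second_countable_topology}, 'm::finite) chart set"
    and \<omega> :: "'a form1"
    and w w' :: "('a, 'm) chart \<Rightarrow> 'm \<Rightarrow> 'a \<Rightarrow> complex"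
    and k :: nat
  assumes "complex_atlas A"
    and "one_form A 0 \<omega>"
    and "\<And>c i. c \<in> A \<Longrightarrow> smooth_on_chart A 0 c (on_N (w c i))"
    and "\<And>c i. c \<in> A \<Longrightarrow> smooth_on_chart A 0 c (on_N (w' c i))"
    and "\<And>c P v. c \<in> A \<Longrightarrow> P \<in> chart_dom A 0 c \<Longrightarrow> v \<in> tangent A 0 P \<Longrightarrow>
           \<omega> P v = d t_coord P v
             + (\<Sum>i\<in>UNIV. on_N (w c i) P * d (z_coord c 0 i) P v)
             + (\<Sum>i\<in>UNIV. on_N (w' c i) P * d (zbar_coord c 0 i) P v)"
  shows "\<forall>c\<in>A. \<forall>P\<in>chart_dom A k c. \<forall>v\<in>tangent A k P.
           vertical_lift_form A k \<omega> P v = d t_coord P v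
             + (\<Sum>i\<in>UNIV. vlift_pow A k (on_N (w c i)) P * d (z_coord c 0 i) P v)
             + (\<Sum>i\<in>UNIV. vlift_pow A k (on_N (w' c i)) P * d (zbar_coord c 0 i) P v)"
proof (intro ballI)
  interpret atlas A by unfold_locales (rule assms(1))
  fix c P v assume c: "c \<in> A" and P: "P \<in> chart_dom A k c" and v: "v \<in> tangent A k P"
  have "vertical_lift_form A k \<omega> = pullback_form k \<omega>"
    by (rule vertical_lift_eq_pullback[OF one_form_pullback_form[OF assms(3,4,5)]])
  moreover have lift: "vlift_pow A k (on_N g) P = on_N g P" for g
    using vlift_pow_on_N[OF chart_domD(1)[OF P]] by (simp add: on_N_def)
  ultimately show "vertical_lift_form A k \<omega> P v = d t_coord P v
             + (\<Sum>i\<in>UNIV. vlift_pow A k (on_N (w c i)) P * d (z_coord c 0 i) P v)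
             + (\<Sum>i\<in>UNIV. vlift_pow A k (on_N (w' c i)) P * d (zbar_coord c 0 i) P v)"
    using pullback_form_eq[OF assms(5)[OF c] c P v] by (simp only: lift)
qed

end
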